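(* Let $\Gamma$ be a general (finite, connected) network with edges $\mathbf{E}$ and vertices $\mathbf{V}=\mathbf{V}_{\mathbf i}\cup\mathbf{V}_{\mathbf b}$. Assume: (1) For each $E\in\mathbf{E}$, $H_E:\bar E\times\mathbb{R}\to\mathbb{R}$ is continuous and, for all $x,y\in\bar E$, $p,q\in\mathbb{R}$, $|H_E(x,p)-H_E(y,p)|\le C_H(1+|p|)|x-y|$ and $|H_E(x,p)-H_E(x,q)|\le C_H|p-q|$; and $a_E:\bar E\to[0,\infty)$ has the form $a_E=\sigma_E^2$ with $|\sigma_E(x)-\sigma_E(y)|\le C_a|x-y|$ for $x,y\in\bar E$. (2) For each $\mathbf{v}\in\mathbf{V}_{\mathbf i}$, $F^{\mathbf v}:\mathbb{R}\times\mathbb{R}^{N_{\mathbf v}}\to\mathbb{R}$ is continuous and satisfies: (i) for all $r,s\in\mathbb{R}$, $\mathbf{p},\mathbf{q}\in\mathbb{R}^{N_{\mathbf v}}$, if $r\ge s$ and $p_i\le q_i$ for all $i$, then $F^{\mathbf v}(r,\mathbf{p})\ge F^{\mathbf v}(s,\mathbf{q})$, and if moreover there exists $j$ such that $p_j<q_j$, then $F^{\mathbf v}(r,\mathbf{p})>F^{\mathbf v}(s,\mathbf{q})$; (ii) for all $i$, $r\in\mathbb{R}$ and $\{p_j\}_{j\ne i}$, $\lim_{p_i\to-\infty}F^{\mathbf v}(r,p_1,\dots,p_i,\dots,p_{N_{\mathbf v}})=+\infty$. (3) For each $\mathbf{v}\in\mathbf{V}$ and each $E\in\mathrm{Inc}(\mathbf{v})$,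 either $H_E(x,p)\ge C_H^{-1}|p|-C_H$ for all $p\in\mathbb{R}$ and all $x$ in an $\bar E$-neighborhood of $\mathbf{v}$, or $a_E(\mathbf{v})>0$. (4) $\lambda>0$ and $\{h_{\mathbf v}\}_{\mathbf{v}\in\mathbf{V}_{\mathbf b}}\subset\mathbb{R}$ are given. Then, for each bounded viscosity subsolution $u\in USC(\Gamma)$ and each bounded viscosity supersolution $v\in LSC(\Gamma)$ of $$\lambda u-a_E(x)u_{xx}+H_E(x,u_x)=0\ \text{ on }E,\ E\in\mathbf{E};\qquad F^{\mathbf v}(u(\mathbf{v}),\boldsymbol{\partial u}(\mathbf{v}))=0,\ \mathbf{v}\in\mathbf{V}_{\mathbf i};\qquad u(\mathbf{v})=h_{\mathbf v},\ \mathbf{v}\in\mathbf{V}_{\mathbf b},$$ we have $u\le v$ on $\Gamma\setminus\mathbf{V}_{\mathbf b}$. Moreover, if $\tilde u$ is defined by $\tilde u=u$ on $\Gamma\setminus\mathbf{V}_{\mathbf b}$ and $\tilde u(\mathbf{v})=\limsup_{x\to\mathbf{v},\,x\in E}u(x)$ for $\mathbf{v}\in\mathbf{V}_{\mathbf b}$ with incident edge $E$, then $\tilde u\le v$ on $\Gamma$.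
   Context: Network. $\mathbf{V}=\{\mathbf{v}_1,\dots,\mathbf{v}_N\}\subset\mathbb{R}^d$ is a finite set of vertices (labeled once for all) and $\mathbf{E}$ a finite set of edges. Each $E\in\mathbf{E}$ is an open line segment for which there are exactly two vertices $\mathbf{v}_i,\mathbf{v}_j$, $i<j$, with $\bar E\cap\mathbf{V}=\{\mathbf{v}_i,\mathbf{v}_j\}$ and $E=\{\mathbf{v}_i+t(\mathbf{v}_j-\mathbf{v}_i)/\ell_E:t\in J_E\}$, where $\ell_E=|\mathbf{v}_i-\mathbf{v}_j|$, $J_E=(0,\ell_E)$; distinct edges are disjoint. The closure $\bar E$ is parametrized by $\gamma_E:\bar J_E\to\bar E$, $\gamma_E(t)=\mathbf{v}_i+t(\mathbf{v}_j-\mathbf{v}_i)/\ell_E$. $E$ is incident to $\mathbf{v}$, written $E\in\mathrm{Inc}(\mathbf{v})$, if $\mathbf{v}\in\bar E$; every vertex has at least one incident edge. $N_{\mathbf v}=\mathrm{card}(\mathrm{Inc}(\mathbf{v}))$; $\mathbf{V}_{\mathbf i}$ is the set of (interior) vertices with $N_{\mathbf v}>1$ and $\mathbf{V}_{\mathbf b}$ the set of (boundary) vertices with $N_{\mathbf v}=1$. $\Gamma=\bigcup_{E\in\mathbf{E}}\bar E$ is assumed connected; $\rho$ is its geodesic distance. For $u:\Gamma\to\mathbb{R}$ and $x=\gamma_E(x_E)\in\bar E$, $u_E(x_E)=u(x)$. $USC(\Gamma)$, $LSC(\Gamma)$ are the sets of $u:\Gamma\to\mathbb{R}$ with all $u_E$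 upper, resp. lower, semicontinuous on $\bar J_E$; $C(\Gamma)=USC(\Gamma)\cap LSC(\Gamma)$; $C^m(\Gamma)$ is the set of $u\in C(\Gamma)$ with all $u_E\in C^m(\bar J_E)$. For $x\in E$, $u_x(x)=u_{x_E}(x)=u_E'(x_E)$, extended to vertices $\mathbf{v}\in\bar E$ by $u_{x_E}(\mathbf{v})=\lim_{x\to\mathbf{v},x\in E}u_x(x)$; similarly for second derivatives $u_{xx}=u_{x_Ex_E}$. The inward derivative of $u\in C^1(\Gamma)$ at $\mathbf{v}$ along $E\in\mathrm{Inc}(\mathbf{v})$ is $\partial_Eu(\mathbf{v})=\lim_{x\to\mathbf{v},x\in E}\frac{u(x)-u(\mathbf{v})}{\rho(x,\mathbf{v})}$. For $\mathbf{v}\in\mathbf{V}_{\mathbf i}$ the incident edges are listed as $E_1,\dots,E_{N_{\mathbf v}}$ and $\boldsymbol{\partial u}(\mathbf{v})=(\partial_{E_1}u(\mathbf{v}),\dots,\partial_{E_{N_{\mathbf v}}}u(\mathbf{v}))$. Viscosity sub/supersolutions. Set $G_E(r,p,X,x)=\lambda r-a_E(x)X+H_E(x,p)$. $u\in USC(\Gamma)$ is a viscosity subsolution if, for each $x\in\Gamma$ and $\varphi\in C^2(\Gamma)$ such that $x$ is a local maximum point of $u-\varphi$ on $\Gamma$: - if $x\in E$: $G_E(u(x),\varphi_{x_E}(x),\varphi_{x_Ex_E}(x),x)\le0$; - if $x=\mathbf{v}\in\mathbf{V}_{\mathbf i}$: $\min\{\min_{E\in\mathrm{Inc}(\mathbf{v})}G_E(u(\mathbf{v}),\varphi_{x_E}(\mathbf{v}),\varphi_{x_Ex_E}(\mathbf{v}),\mathbf{v}),\,F^{\mathbf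 v}(u(\mathbf{v}),\boldsymbol{\partial\varphi}(\mathbf{v}))\}\le0$; - if $x=\mathbf{v}\in\mathbf{V}_{\mathbf b}$ with incident edge $E$: $\min\{G_E(u(\mathbf{v}),\varphi_{x_E}(\mathbf{v}),\varphi_{x_Ex_E}(\mathbf{v}),\mathbf{v}),\,u(\mathbf{v})-h_{\mathbf v}\}\le0$. $v\in LSC(\Gamma)$ is a viscosity supersolution if, for each $x\in\Gamma$ and $\varphi\in C^2(\Gamma)$ such that $x$ is a local minimum point of $v-\varphi$, the same conditions hold with $u$ replaced by $v$, every $\min$ replaced by $\max$ and every $\le0$ by $\ge0$. $C_H,C_a>0$ denote fixed constants. *)

theory Defs
  imports "HOL-Analysis.Analysis"
begin

section \<open>Networks\<close>

text \<open>
  The vertices are \<open>vertex N 1, \<dots>, vertex N (vcount N)\<close>; edges are sets of points of the ambient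
  space. For an interior vertex \<open>z\<close>, \<open>inc_edge N z 1, inc_edge N z 2, \<dots>\<close> is the fixed listing of
  the edges incident to \<open>z\<close>, which identifies tuples indexed by these edges with
  real tuples of length \<open>deg N z\<close>.
\<close>

record 'a network =
  vcount :: nat
  vertex :: "nat \<Rightarrow> 'a"
  edges :: "'a set set"
  inc_edge :: "'a \<Rightarrow> nat \<Rightarrow> 'a set"

definition verts :: "'a network \<Rightarrow> 'a set" where
  "verts N = vertex N ` {1..vcount N}"

definition body :: "'a::euclidean_space network \<Rightarrow> 'a set" where
  "body N = (\<Union>E\<in>edges N. closure E)"

definition Inc :: "'a::euclidean_space network \<Rightarrow> 'a \<Rightarrow> 'a set set" where
  "Inc N z = {E \<in> edges N. z \<in> closure E}"

definition deg :: "'a::euclidean_space network \<Rightarrow> 'a \<Rightarrow> nat" where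
  "deg N z = card (Inc N z)"

definition interior_verts :: "'a::euclidean_space network \<Rightarrow> 'a set" where
  "interior_verts N = {z \<in> verts N. deg N z > 1}"

definition boundary_verts :: "'a::euclidean_space network \<Rightarrow> 'a set" where
  "boundary_verts N = {z \<in> verts N. deg N z = 1}"

definition is_network :: "'a::euclidean_space network \<Rightarrow> bool" where
  "is_network N \<longleftrightarrow>
     inj_on (vertex N) {1..vcount N} \<and>
     finite (edges N) \<and>
     (\<forall>E\<in>edges N. \<exists>i j. 1 \<le> i \<and> i < j \<and> j \<le> vcount N \<and>
        closure E \<inter> verts N = {vertex N i, vertex N j} \<and>
        E = (\<lambda>t. vertex N i + (t / dist (vertex N i) (vertex N j)) *\<^sub>R (vertex N j - vertex N i))
              ` {0<..<dist (vertex N i) (vertex N j)}) \<and>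
     pairwise disjnt (edges N) \<and>
     (\<forall>z\<in>verts N. Inc N z \<noteq> {}) \<and>
     connected (body N) \<and>
     (\<forall>z\<in>interior_verts N. bij_betw (inc_edge N z) {1..deg N z} (Inc N z))"

text \<open>Edges are oriented from the endpoint with the smaller label to the one with the larger label.\<close>

definition tail :: "'a::euclidean_space network \<Rightarrow> 'a set \<Rightarrow> 'a" where
  "tail N E = vertex N (Min {i \<in> {1..vcount N}. vertex N i \<in> closure E})"

definition head :: "'a::euclidean_space network \<Rightarrow> 'a set \<Rightarrow> 'a" where
  "head N E = vertex N (Max {i \<in> {1..vcount N}. vertex N i \<in> closure E})"

definition elen :: "'a::euclidean_space network \<Rightarrow> 'a set \<Rightarrow> real" where
  "elen N E = dist (tail N E) (head N E)"

definition gam :: "'a::euclidean_space network \<Rightarrow> 'a set \<Rightarrow> real \<Rightarrow> 'a" where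
  "gam N E t = tail N E + (t / elen N E) *\<^sub>R (head N E - tail N E)"

definition on_edge :: "'a::euclidean_space network \<Rightarrow> 'a set \<Rightarrow> ('a \<Rightarrow> real) \<Rightarrow> real \<Rightarrow> real" where
  "on_edge N E u = (\<lambda>t. u (gam N E t))"

definition curve_length :: "(real \<Rightarrow> 'a::euclidean_space) \<Rightarrow> ereal" where
  "curve_length g =
     (SUP (n, t) \<in> {(n::nat, t::nat \<Rightarrow> real). mono t \<and> range t \<subseteq> {0..1}}.
        ereal (\<Sum>i<n. dist (g (t i)) (g (t (Suc i)))))"

definition geo_dist :: "'a::euclidean_space network \<Rightarrow> 'a \<Rightarrow> 'a \<Rightarrow> real" where
  "geo_dist N x y = real_of_ereal
     (INF g \<in> {g. path g \<and> path_image g \<subseteq> body N \<and> pathstart g = x \<and> pathfinish g = y}.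
        curve_length g)"

section \<open>Function classes and derivatives\<close>

text \<open>
  Real functions on the network are total functions on the ambient space; their values
  outside \<open>body N\<close> are irrelevant throughout.
\<close>

definition usc_on :: "'b::topological_space set \<Rightarrow> ('b \<Rightarrow> real) \<Rightarrow> bool" where
  "usc_on S f \<longleftrightarrow> (\<forall>x\<in>S. \<forall>c. f x < c \<longrightarrow> (\<forall>\<^sub>F y in at x within S. f y < c))"

definition lsc_on :: "'b::topological_space set \<Rightarrow> ('b \<Rightarrow> real) \<Rightarrow> bool" where
  "lsc_on S f \<longleftrightarrow> (\<forall>x\<in>S. \<forall>c. c < f x \<longrightarrow> (\<forall>\<^sub>F y in at x within S. c < f y))"

definition USC :: "'a::euclidean_space network \<Rightarrow> ('a \<Rightarrow> real) set" where
  "USC N = {u. \<forall>E\<in>edges N. usc_on {0..elen N E} (on_edge N E u)}"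

definition LSC :: "'a::euclidean_space network \<Rightarrow> ('a \<Rightarrow> real) set" where
  "LSC N = {u. \<forall>E\<in>edges N. lsc_on {0..elen N E} (on_edge N E u)}"

text \<open>\<open>m\<close> times continuously differentiable on \<open>S\<close>, with one-sided derivatives at the endpoints
  when \<open>S\<close> is a compact interval.\<close>

definition Cm_on :: "nat \<Rightarrow> real set \<Rightarrow> (real \<Rightarrow> real) \<Rightarrow> bool" where
  "Cm_on m S f \<longleftrightarrow> (\<exists>D. (\<forall>t\<in>S. D 0 t = f t) \<and>
     (\<forall>k<m. \<forall>t\<in>S. (D k has_real_derivative D (Suc k) t) (at t within S)) \<and>
     (\<forall>k\<le>m. continuous_on S (D k)))"

definition Cm :: "nat \<Rightarrow> 'a::euclidean_space network \<Rightarrow> ('a \<Rightarrow> real) set" where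
  "Cm m N = {u \<in> USC N \<inter> LSC N. \<forall>E\<in>edges N. Cm_on m {0..elen N E} (on_edge N E u)}"

text \<open>
  The \<open>k\<close>-th derivative in the edge coordinate. A point \<open>x\<close> of \<open>E\<close> has coordinate
  \<open>dist (tail N E) x\<close>; at the endpoints of \<open>E\<close> the derivative is the limit taken inside \<open>E\<close>.
\<close>

definition dE_in :: "nat \<Rightarrow> 'a::euclidean_space network \<Rightarrow> 'a set \<Rightarrow> ('a \<Rightarrow> real) \<Rightarrow> 'a \<Rightarrow> real" where
  "dE_in k N E u x = (deriv ^^ k) (on_edge N E u) (dist (tail N E) x)"

definition dE :: "nat \<Rightarrow> 'a::euclidean_space network \<Rightarrow> 'a set \<Rightarrow> ('a \<Rightarrow> real) \<Rightarrow> 'a \<Rightarrow> real" where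
  "dE k N E u x = (if x \<in> E then dE_in k N E u x else Lim (at x within E) (dE_in k N E u))"

definition inward :: "'a::euclidean_space network \<Rightarrow> 'a set \<Rightarrow> ('a \<Rightarrow> real) \<Rightarrow> 'a \<Rightarrow> real" where
  "inward N E u z = Lim (at z within E) (\<lambda>x. (u x - u z) / geo_dist N x z)"

definition inward_vec :: "'a::euclidean_space network \<Rightarrow> ('a \<Rightarrow> real) \<Rightarrow> 'a \<Rightarrow> nat \<Rightarrow> real" where
  "inward_vec N u z = (\<lambda>i\<in>{1..deg N z}. inward N (inc_edge N z i) u z)"

section \<open>Viscosity sub- and supersolutions\<close>

definition local_max :: "'b::topological_space set \<Rightarrow> ('b \<Rightarrow> real) \<Rightarrow> 'b \<Rightarrow> bool" where
  "local_max S f x \<longleftrightarrow> x \<in> S \<and> (\<forall>\<^sub>F y in at x within S. f y \<le> f x)"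

definition local_min :: "'b::topological_space set \<Rightarrow> ('b \<Rightarrow> real) \<Rightarrow> 'b \<Rightarrow> bool" where
  "local_min S f x \<longleftrightarrow> x \<in> S \<and> (\<forall>\<^sub>F y in at x within S. f x \<le> f y)"

definition G_op :: "real \<Rightarrow> ('a set \<Rightarrow> 'a \<Rightarrow> real) \<Rightarrow> ('a set \<Rightarrow> 'a \<Rightarrow> real \<Rightarrow> real) \<Rightarrow>
    'a set \<Rightarrow> real \<Rightarrow> real \<Rightarrow> real \<Rightarrow> 'a \<Rightarrow> real" where
  "G_op lam a H E r p X x = lam * r - a E x * X + H E x p"

text \<open>
  \<open>F z r p\<close> is the vertex condition at an interior vertex \<open>z\<close>; \<open>p\<close> is a tuple
  indexed by \<open>{1..deg N z}\<close>, i.e. an extensional function on this set.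
\<close>

definition viscosity_subsolution ::
  "'a::euclidean_space network \<Rightarrow> real \<Rightarrow> ('a set \<Rightarrow> 'a \<Rightarrow> real) \<Rightarrow> ('a set \<Rightarrow> 'a \<Rightarrow> real \<Rightarrow> real) \<Rightarrow>
   ('a \<Rightarrow> real \<Rightarrow> (nat \<Rightarrow> real) \<Rightarrow> real) \<Rightarrow> ('a \<Rightarrow> real) \<Rightarrow> ('a \<Rightarrow> real) \<Rightarrow> bool" where
  "viscosity_subsolution N lam a H F h u \<longleftrightarrow> u \<in> USC N \<and>
     (\<forall>x. \<forall>\<phi>\<in>Cm 2 N. local_max (body N) (\<lambda>y. u y - \<phi> y) x \<longrightarrow>
        (\<forall>E\<in>edges N. x \<in> E \<longrightarrow> G_op lam a H E (u x) (dE 1 N E \<phi> x) (dE 2 N E \<phi> x) x \<le> 0) \<and>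
        (x \<in> interior_verts N \<longrightarrow>
           min (Min ((\<lambda>E. G_op lam a H E (u x) (dE 1 N E \<phi> x) (dE 2 N E \<phi> x) x) ` Inc N x))
               (F x (u x) (inward_vec N \<phi> x)) \<le> 0) \<and>
        (x \<in> boundary_verts N \<longrightarrow> (\<forall>E\<in>Inc N x.
           min (G_op lam a H E (u x) (dE 1 N E \<phi> x) (dE 2 N E \<phi> x) x) (u x - h x) \<le> 0)))"

definition viscosity_supersolution ::
  "'a::euclidean_space network \<Rightarrow> real \<Rightarrow> ('a set \<Rightarrow> 'a \<Rightarrow> real) \<Rightarrow> ('a set \<Rightarrow> 'a \<Rightarrow> real \<Rightarrow> real) \<Rightarrow>
   ('a \<Rightarrow> real \<Rightarrow> (nat \<Rightarrow> real) \<Rightarrow> real) \<Rightarrow> ('a \<Rightarrow> real) \<Rightarrow> ('a \<Rightarrow> real) \<Rightarrow> bool" where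
  "viscosity_supersolution N lam a H F h v \<longleftrightarrow> v \<in> LSC N \<and>
     (\<forall>x. \<forall>\<phi>\<in>Cm 2 N. local_min (body N) (\<lambda>y. v y - \<phi> y) x \<longrightarrow>
        (\<forall>E\<in>edges N. x \<in> E \<longrightarrow> G_op lam a H E (v x) (dE 1 N E \<phi> x) (dE 2 N E \<phi> x) x \<ge> 0) \<and>
        (x \<in> interior_verts N \<longrightarrow>
           max (Max ((\<lambda>E. G_op lam a H E (v x) (dE 1 N E \<phi> x) (dE 2 N E \<phi> x) x) ` Inc N x))
               (F x (v x) (inward_vec N \<phi> x)) \<ge> 0) \<and>
        (x \<in> boundary_verts N \<longrightarrow> (\<forall>E\<in>Inc N x.
           max (G_op lam a H E (v x) (dE 1 N E \<phi> x) (dE 2 N E \<phi> x) x) (v x - h x) \<ge> 0)))"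

text \<open>
  For \<open>u\<close> bounded on \<open>body N\<close> the upper limit below is finite, so \<open>real_of_ereal\<close> loses nothing.
\<close>

definition bdry_reg :: "'a::euclidean_space network \<Rightarrow> ('a \<Rightarrow> real) \<Rightarrow> 'a \<Rightarrow> real" where
  "bdry_reg N u x =
     (if x \<in> boundary_verts N
      then real_of_ereal (Limsup (at x within the_elem (Inc N x)) (\<lambda>y. ereal (u y)))
      else u x)"

end

theory Submission
  imports Defs
begin

text \<open>
  Let \<open>ub\<close> be \<open>u\<close> regularized at the boundary vertices. On the compact network the upper
  semicontinuous function \<open>ub - v\<close> attains its maximum at some point \<open>x\<close>, and the claim is that the
  maximum is not positive. Everything happens near \<open>x\<close>, and on each edge it is a statement about
  functions of one real variable.

  If \<open>x\<close> lies in an open edge, the variables are doubled as usual. The theorem on sums is replaced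
  by an elementary argument that is special to dimension one. At a maximum point \<open>(x, y)\<close> of
  \<open>f x - g y - (x - y)\<^sup>2 / (2 * \<epsilon>) - \<dots>\<close> one moves along \<open>(\<sigma> x * r, \<sigma> y * r)\<close>: maximality bounds the
  symmetric second difference of \<open>f x - g y\<close> in this direction from above by
  \<open>(\<sigma> x - \<sigma> y)\<^sup>2 / \<epsilon> * r\<^sup>2\<close>, up to small terms, while comparing \<open>f\<close> and \<open>g\<close> with parabolas bounds the
  second differences of \<open>f\<close> and \<open>- g\<close> from below by the zeroth and first order part of the equation
  (\<open>second_difference\<close>). Since \<open>\<sigma>\<close> is Lipschitz, this contradicts \<open>lam > 0\<close>
  (\<open>no_interior_maximum\<close>).

  If \<open>x\<close> is a vertex, put it at \<open>0\<close> on every incident edge and let \<open>f\<close>, \<open>g\<close> be \<open>ub\<close>, \<open>v\<close> on that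
  edge. The key is \<open>separating_jets\<close>: there are slopes \<open>p < q\<close> and second derivatives \<open>X\<close>, \<open>Y\<close> such
  that the jet \<open>(p, X)\<close> touches \<open>f\<close> from above, \<open>(q, Y)\<close> touches \<open>g\<close> from below, and the equation
  fails strictly for both in the direction that forces the vertex condition to hold. At an
  interior vertex this gives \<open>F x (u x) p \<le> 0 \<le> F x (v x) q\<close> with \<open>p < q\<close> componentwise and
  \<open>v x \<le> u x\<close>, against strict monotonicity. At a boundary vertex the barrier that touches \<open>u\<close> from
  above shows \<open>u \<le> h\<close>, so \<open>v < h\<close> there, and the jet \<open>(q, Y)\<close> contradicts the boundary condition.

  For \<open>separating_jets\<close> there are two cases. If \<open>\<sigma> 0 \<noteq> 0\<close>, the second derivatives are at our disposal
  and only \<open>p < q\<close> matters. Equal slopes \<open>p0\<close> are impossible by an argument of Hopf type: both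
  functions would be squeezed by parabolas of slope \<open>p0\<close> whose curvatures differ by the positive
  amount \<open>lam * (f 0 - g 0) / (\<sigma> 0)\<^sup>2\<close>, so \<open>f - g\<close> would increase away from \<open>0\<close>. If \<open>\<sigma> 0 = 0\<close>, then
  \<open>(\<sigma> x)\<^sup>2\<close> is of order \<open>x\<^sup>2\<close>, blowing up at \<open>0\<close> removes the second order term, and the extreme slopes
  satisfy first order inequalities: \<open>lam * f 0 + H 0 p0 \<le> 0\<close> for the largest slope \<open>p0\<close> of \<open>f\<close> and
  \<open>0 \<le> lam * g 0 + H 0 q0\<close> for the smallest slope \<open>q0\<close> of \<open>g\<close>. Since \<open>f 0 > g 0\<close>, this separates \<open>p0\<close>
  from \<open>q0\<close>, and the intermediate value theorem yields slopes in between at which both inequalities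
  are strictly violated. Here \<open>p0 > - \<infinity>\<close> is needed; it comes from the coercivity of \<open>F\<close> at interior
  vertices (\<open>interior_slope_bounded\<close>) and from the definition of \<open>ub\<close> as an upper limit at boundary
  vertices (\<open>limsup_slope_bounded\<close>).
\<close>

section \<open>Semicontinuous functions\<close>

text \<open>Full neighborhoods instead of punctured ones: this makes preimages and compositions easier,
  since a continuous map may take other points to the value at \<open>x\<close>.\<close>
lemma usc_on_nhds:
  "usc_on S f \<longleftrightarrow> (\<forall>x\<in>S. \<forall>c. f x < c \<longrightarrow> (\<forall>\<^sub>F y in nhds x. y \<in> S \<longrightarrow> f y < c))"
proof -
  have "(\<forall>\<^sub>F y in at x within S. f y < c) \<longleftrightarrow> (\<forall>\<^sub>F y in nhds x. y \<in> S \<longrightarrow> f y < c)"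
    if "f x < c" for x c
    unfolding eventually_at_filter using that by (auto elim: eventually_mono)
  then show ?thesis unfolding usc_on_def by blast
qed

lemma usc_on_openin:
  assumes "usc_on S f"
  shows "openin (top_of_set S) {x \<in> S. f x < c}"
proof -
  define T where "T = \<Union>{U. open U \<and> U \<inter> S \<subseteq> {x. f x < c}}"
  have "{x \<in> S. f x < c} = S \<inter> T"
  proof (intro set_eqI iffI)
    fix x assume x: "x \<in> {x \<in> S. f x < c}"
    then have "\<forall>\<^sub>F y in nhds x. y \<in> S \<longrightarrow> f y < c" using assms usc_on_nhds by blast
    then obtain U where "open U" "x \<in> U" "\<And>y. y \<in> U \<Longrightarrow> y \<in> S \<longrightarrow> f y < c"
      unfolding eventually_nhds by blast
    then show "x \<in> S \<inter> T" using x unfolding T_def by blast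
  next
    fix x assume "x \<in> S \<inter> T" then show "x \<in> {x \<in> S. f x < c}" unfolding T_def by blast
  qed
  moreover have "open T" unfolding T_def by (intro open_Union) auto
  ultimately show ?thesis unfolding openin_open by blast
qed

lemma usc_attains_max:
  assumes "compact S" "S \<noteq> {}" and f: "usc_on S f"
  shows "\<exists>x\<in>S. \<forall>y\<in>S. f y \<le> f x"
proof (rule ccontr)
  assume "\<not> ?thesis"
  then have lt: "\<forall>x\<in>S. \<exists>y\<in>S. f x < f y" by (meson not_le)
  define C where "C = (\<lambda>y. {x \<in> S. f x < f y}) ` S"
  have "\<forall>c\<in>C. openin (top_of_set S) c" unfolding C_def using usc_on_openin[OF f] by blast
  moreover have "S \<subseteq> \<Union>C" unfolding C_def using lt by blast
  ultimately obtain D where D: "D \<subseteq> C" "finite D" "S \<subseteq> \<Union>D"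
    using iffD1[OF compact_eq_openin_cover assms(1), rule_format, of C] by auto
  then obtain Y where Y: "Y \<subseteq> S" "finite Y" "D = (\<lambda>y. {x \<in> S. f x < f y}) ` Y"
    unfolding C_def using finite_subset_image[of D "\<lambda>y. {x \<in> S. f x < f y}" S] by blast
  have "Y \<noteq> {}" using D(3) Y(3) \<open>S \<noteq> {}\<close> by blast
  then have "Max (f ` Y) \<in> f ` Y" using Y(2) by (intro Max_in) auto
  then obtain m where m: "m \<in> Y" "f m = Max (f ` Y)" by auto
  have max: "\<forall>y\<in>Y. f y \<le> f m" unfolding m(2) using Y(2) by simp
  have "m \<in> \<Union>D" using m(1) Y(1) D(3) by blast
  then obtain y where "y \<in> Y" "f m < f y" using Y(3) by blast
  then show False using max by (meson not_le)
qed

lemma usc_on_add: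
  assumes "usc_on S f" "usc_on S g"
  shows "usc_on S (\<lambda>x. f x + g x)"
  unfolding usc_on_def
proof (intro ballI allI impI)
  fix x c assume x: "x \<in> S" "f x + g x < c"
  define e where "e = (c - f x - g x) / 2"
  have e: "f x < f x + e" "g x < g x + e" using x by (auto simp: e_def)
  have "\<forall>\<^sub>F y in at x within S. f y < f x + e" "\<forall>\<^sub>F y in at x within S. g y < g x + e"
    using assms x e unfolding usc_on_def by blast+
  then show "\<forall>\<^sub>F y in at x within S. f y + g y < c"
    by eventually_elim (simp add: e_def field_simps)
qed

lemma usc_on_continuous: "continuous_on S f \<Longrightarrow> usc_on S f"
  unfolding usc_on_def continuous_on_def by (auto intro: order_tendstoD(2))

lemma usc_on_compose:
  assumes f: "usc_on T f" and h: "continuous_on S h" "h ` S \<subseteq> T"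
  shows "usc_on S (\<lambda>x. f (h x))"
  unfolding usc_on_def
proof (intro ballI allI impI)
  fix x c assume x: "x \<in> S" "f (h x) < c"
  then have "\<forall>\<^sub>F y in nhds (h x). y \<in> T \<longrightarrow> f y < c" using f h(2) unfolding usc_on_nhds by blast
  moreover have "filterlim h (nhds (h x)) (at x within S)"
    using h(1) x unfolding continuous_on_def by blast
  ultimately have "\<forall>\<^sub>F y in at x within S. h y \<in> T \<longrightarrow> f (h y) < c"
    using eventually_compose_filterlim by blast
  moreover have "\<forall>\<^sub>F y in at x within S. y \<in> S"
    by (simp add: eventually_at_filter)
  ultimately show "\<forall>\<^sub>F y in at x within S. f (h y) < c"
    by eventually_elim (use h(2) in blast)
qed

lemma usc_on_subset: "usc_on T f \<Longrightarrow> S \<subseteq> T \<Longrightarrow> usc_on S f"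
  using usc_on_compose[of T f S "\<lambda>x. x"] by (simp add: continuous_on_id)

lemma lsc_on_iff: "lsc_on S f \<longleftrightarrow> usc_on S (\<lambda>x. - f x)"
proof
  assume f: "lsc_on S f"
  show "usc_on S (\<lambda>x. - f x)" unfolding usc_on_def
  proof (intro ballI allI impI)
    fix x c assume "x \<in> S" "- f x < c"
    then have "\<forall>\<^sub>F y in at x within S. - c < f y" using f unfolding lsc_on_def by auto
    then show "\<forall>\<^sub>F y in at x within S. - f y < c" by eventually_elim auto
  qed
next
  assume f: "usc_on S (\<lambda>x. - f x)"
  show "lsc_on S f" unfolding lsc_on_def
  proof (intro ballI allI impI)
    fix x c assume "x \<in> S" "c < f x"
    then have "\<forall>\<^sub>F y in at x within S. - f y < - c" using f unfolding usc_on_def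
      by (metis neg_less_iff_less)
    then show "\<forall>\<^sub>F y in at x within S. c < f y" by eventually_elim auto
  qed
qed

text \<open>
  The usual penalization, with one quantity \<open>\<eta>\<close> controlling all errors. Near the diagonal \<open>f x - g y\<close>
  exceeds its maximum \<open>f x0 - g x0\<close> on the diagonal by less than \<open>\<eta>\<close>, because the superlevel set of
  \<open>f x - g y\<close> is compact and disjoint from the diagonal. For small \<open>\<epsilon>\<close> the maximum point lies that
  near to the diagonal, so the penalization, which is bounded by this excess, is small as well.
\<close>
lemma doubling_penalization:
  fixes S :: "real set" and f g :: "real \<Rightarrow> real"
  assumes S: "compact S" and f: "usc_on S f" and g: "lsc_on S g" and x0: "x0 \<in> S"
    and max: "\<And>x. x \<in> S \<Longrightarrow> f x - g x \<le> f x0 - g x0" and \<eta>: "0 < \<eta>"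
    and \<mu>: "0 \<le> \<mu>"
  obtains \<epsilon> x y where "0 < \<epsilon>" "x \<in> S" "y \<in> S"
    "\<And>x' y'. x' \<in> S \<Longrightarrow> y' \<in> S \<Longrightarrow>
       f x' - g y' - (x' - y')\<^sup>2 / (2 * \<epsilon>) - \<mu> * (x' - x0)\<^sup>2
       \<le> f x - g y - (x - y)\<^sup>2 / (2 * \<epsilon>) - \<mu> * (x - x0)\<^sup>2"
    "\<bar>x - y\<bar> < \<eta>" "(x - y)\<^sup>2 / (2 * \<epsilon>) + \<mu> * (x - x0)\<^sup>2 < \<eta>" "f x0 - g x0 \<le> f x - g y - \<mu> * (x - x0)\<^sup>2"
proof -
  define M where "M = f x0 - g x0"
  define W where "W = (\<lambda>z. f (fst z) + - g (snd z))"
  have SS: "compact (S \<times> S)" "S \<times> S \<noteq> {}" using S x0 by (auto intro: compact_Times)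
  have W: "usc_on (S \<times> S) W"
    unfolding W_def using f g unfolding lsc_on_iff
    by (intro usc_on_add usc_on_compose[of S f "S \<times> S" fst] usc_on_compose[of S "\<lambda>x. - g x" "S \<times> S" snd]
        continuous_intros) auto
  have "\<exists>d>0. \<forall>x\<in>S. \<forall>y\<in>S. \<bar>x - y\<bar> < d \<longrightarrow> f x - g y < M + \<eta>"
  proof -
    define K where "K = {z \<in> S \<times> S. M + \<eta> \<le> W z}"
    have "K = S \<times> S - {z \<in> S \<times> S. W z < M + \<eta>}" by (auto simp: K_def)
    then have "closedin (top_of_set (S \<times> S)) K"
      using usc_on_openin[OF W, of "M + \<eta>"] by (simp add: closedin_diff)
    then have K: "compact K" using closedin_compact SS(1) by blast
    have "compact ((\<lambda>x. (x, x)) ` S)" using S by (intro compact_continuous_image continuous_intros)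
    then have D: "closed ((\<lambda>x. (x, x)) ` S)" by (rule compact_imp_closed)
    have "K \<inter> (\<lambda>x. (x, x)) ` S = {}"
    proof -
      have "f x - g x < M + \<eta>" if "x \<in> S" for x using max[OF that] \<eta> by (simp add: M_def)
      then show ?thesis by (force simp: K_def W_def)
    qed
    from separate_compact_closed[OF K D this] obtain d where d: "d > 0"
      "\<And>z w. z \<in> K \<Longrightarrow> w \<in> (\<lambda>x. (x, x)) ` S \<Longrightarrow> d \<le> dist z w" by blast
    have "f x - g y < M + \<eta>" if xy: "x \<in> S" "y \<in> S" "\<bar>x - y\<bar> < d" for x y
    proof (rule ccontr)
      assume "\<not> ?thesis"
      then have "(x, y) \<in> K" using xy by (auto simp: K_def W_def)
      then have "d \<le> dist (x, y) (x, x)" using d(2) xy by blast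
      also have "\<dots> = \<bar>x - y\<bar>" by (simp add: dist_Pair_Pair dist_real_def abs_minus_commute)
      finally show False using xy by simp
    qed
    then show ?thesis using d(1) by blast
  qed
  then obtain d where d: "d > 0" "\<And>x y. x \<in> S \<Longrightarrow> y \<in> S \<Longrightarrow> \<bar>x - y\<bar> < d \<Longrightarrow> f x - g y < M + \<eta>" by blast
  obtain z0 where z0: "z0 \<in> S \<times> S" "\<And>z. z \<in> S \<times> S \<Longrightarrow> W z \<le> W z0"
    using usc_attains_max[OF SS W] by blast
  define D where "D = W z0 - M"
  have D: "D \<ge> 0" using z0(2)[of "(x0, x0)"] x0 by (simp add: D_def M_def W_def)
  define e where "e = min d \<eta>"
  have e: "0 < e" "e \<le> d" "e \<le> \<eta>" using d \<eta> by (auto simp: e_def)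
  define \<epsilon> where "\<epsilon> = e\<^sup>2 / (2 * (D + 1))"
  have \<epsilon>: "\<epsilon> > 0" using e D by (simp add: \<epsilon>_def)
  have \<epsilon>D: "2 * \<epsilon> * D < e\<^sup>2"
  proof -
    have "2 * \<epsilon> * (D + 1) = e\<^sup>2" using D by (simp add: \<epsilon>_def field_simps)
    then show ?thesis using \<epsilon> by (simp add: algebra_simps)
  qed
  define \<Phi> where "\<Phi> = (\<lambda>z. W z + - ((fst z - snd z)\<^sup>2 / (2 * \<epsilon>) + \<mu> * (fst z - x0)\<^sup>2))"
  have "usc_on (S \<times> S) \<Phi>" unfolding \<Phi>_def
    by (intro usc_on_add W usc_on_continuous continuous_intros) (use \<epsilon> in auto)
  from usc_attains_max[OF SS this] obtain z where z: "z \<in> S \<times> S" "\<And>w. w \<in> S \<times> S \<Longrightarrow> \<Phi> w \<le> \<Phi> z" by blast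
  obtain x y where xy: "z = (x, y)" by (cases z)
  have S': "x \<in> S" "y \<in> S" using z xy by auto
  have ge: "M \<le> f x - g y - (x - y)\<^sup>2 / (2 * \<epsilon>) - \<mu> * (x - x0)\<^sup>2"
    using z(2)[of "(x0, x0)"] x0 xy by (simp add: \<Phi>_def W_def M_def)
  have p0: "0 \<le> \<mu> * (x - x0)\<^sup>2" "0 \<le> (x - y)\<^sup>2 / (2 * \<epsilon>)" using \<mu> \<epsilon> by auto
  have "f x - g y \<le> M + D" using z0(2)[OF z(1)] by (simp add: D_def W_def xy)
  then have "(x - y)\<^sup>2 / (2 * \<epsilon>) \<le> D" using ge p0 by linarith
  then have "(x - y)\<^sup>2 \<le> D * (2 * \<epsilon>)" using \<epsilon> by (simp add: pos_divide_le_eq)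
  then have "(x - y)\<^sup>2 < e\<^sup>2" using \<epsilon>D by (simp add: algebra_simps)
  then have xye: "\<bar>x - y\<bar> < e" using e by (intro power2_less_imp_less[of "\<bar>x - y\<bar>" e]) auto
  have "f x - g y < M + \<eta>" using d(2) S' xye e by auto
  then have "(x - y)\<^sup>2 / (2 * \<epsilon>) + \<mu> * (x - x0)\<^sup>2 < \<eta>" using ge by linarith
  moreover have "f x0 - g x0 \<le> f x - g y - \<mu> * (x - x0)\<^sup>2" using ge p0 by (simp add: M_def)
  moreover have "f x' - g y' - (x' - y')\<^sup>2 / (2 * \<epsilon>) - \<mu> * (x' - x0)\<^sup>2
     \<le> f x - g y - (x - y)\<^sup>2 / (2 * \<epsilon>) - \<mu> * (x - x0)\<^sup>2" if "x' \<in> S" "y' \<in> S" for x' y'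
    using z(2)[of "(x', y')"] that xy by (simp add: \<Phi>_def W_def)
  ultimately show thesis using that[OF \<epsilon> S'] xye e by auto
qed

lemma frequently_at_right_E:
  fixes a b :: real
  assumes "frequently P (at_right a)" "a < b"
  obtains y where "a < y" "y < b" "P y"
proof -
  have "\<exists>y. a < y \<and> y < b \<and> P y"
  proof (rule ccontr)
    assume "\<not> ?thesis"
    then have "\<forall>\<^sub>F y in at_right a. \<not> P y"
      unfolding eventually_at_right_field using assms(2) by blast
    then show False using assms(1) by (simp add: frequently_def)
  qed
  then show thesis using that by blast
qed

lemma frequently_conj_eventually:
  "frequently P F \<Longrightarrow> eventually Q F \<Longrightarrow> (\<And>x. P x \<Longrightarrow> Q x \<Longrightarrow> R x) \<Longrightarrow> frequently R F"
  by (rule frequently_mp[of P R]) (auto elim: eventually_mono)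

text \<open>Near \<open>0\<close> a strict inequality of slopes outweighs any second order term; so the second
  derivative of a test function is free as soon as its slope is not the critical one.\<close>
lemma slope_absorbs_curvature:
  fixes p q X :: real
  assumes "p < q"
  shows "\<forall>\<^sub>F x in at_right 0. p * x \<le> q * x + X / 2 * x\<^sup>2"
proof -
  define d where "d = (q - p) / (\<bar>X\<bar> + 1)"
  have d: "d > 0" using assms by (simp add: d_def)
  have "p * x \<le> q * x + X / 2 * x\<^sup>2" if x: "0 < x" "x < d" for x
  proof -
    have "(\<bar>X\<bar> + 1) * x < q - p" using x(2) by (simp add: d_def pos_less_divide_eq mult.commute)
    then have "- X / 2 * x \<le> q - p" using x(1) by (smt (verit) mult_right_mono field_sum_of_halves)
    then have "(- X / 2 * x) * x \<le> (q - p) * x" using x(1) by (intro mult_right_mono) auto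
    then show ?thesis by (simp add: power2_eq_square algebra_simps)
  qed
  then show ?thesis using d unfolding eventually_at_right_field by blast
qed

section \<open>The equation on one edge\<close>

lemma taylor2_upper:
  fixes \<theta> \<theta>' :: "real \<Rightarrow> real"
  assumes d1: "\<forall>\<^sub>F y in nhds z. (\<theta> has_real_derivative \<theta>' y) (at y)"
    and d2: "(\<theta>' has_real_derivative X) (at z)" and XY: "X < Y"
  shows "\<forall>\<^sub>F y in at z. \<theta> y \<le> \<theta> z + \<theta>' z * (y - z) + Y / 2 * (y - z)\<^sup>2"
proof -
  have "((\<lambda>y. (\<theta>' y - \<theta>' z) / (y - z)) \<longlongrightarrow> X) (at z)"
    using d2 unfolding has_field_derivative_iff .
  then have "\<forall>\<^sub>F y in at z. (\<theta>' y - \<theta>' z) / (y - z) < Y" using XY by (rule order_tendstoD)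
  then have "\<forall>\<^sub>F y in nhds z. (y \<noteq> z \<longrightarrow> (\<theta>' y - \<theta>' z) / (y - z) < Y)
      \<and> (\<theta> has_real_derivative \<theta>' y) (at y)"
    using d1 by (auto simp: eventually_at_filter eventually_conj_iff)
  then obtain d where d: "d > 0" and D: "\<And>y. dist y z < d \<Longrightarrow>
      (y \<noteq> z \<longrightarrow> (\<theta>' y - \<theta>' z) / (y - z) < Y) \<and> (\<theta> has_real_derivative \<theta>' y) (at y)"
    unfolding eventually_nhds_metric by blast
  define k where "k = (\<lambda>y. \<theta> y - \<theta>' z * (y - z) - Y / 2 * (y - z)\<^sup>2)"
  have k: "(k has_real_derivative (\<theta>' y - \<theta>' z - Y * (y - z))) (at y)" if "dist y z < d" for y
    unfolding k_def using D[OF that]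
    by (auto intro!: derivative_eq_intros simp: power2_eq_square algebra_simps)
  have "k y \<le> k z" if y: "dist y z < d" for y
  proof (cases "y < z")
    case True
    have "\<exists>\<xi>>y. \<xi> < z \<and> k z - k y = (z - y) * (\<theta>' \<xi> - \<theta>' z - Y * (\<xi> - z))"
      using True y by (intro MVT2 k) (auto simp: dist_real_def)
    then obtain \<xi> where \<xi>: "y < \<xi>" "\<xi> < z" "k z - k y = (z - y) * (\<theta>' \<xi> - \<theta>' z - Y * (\<xi> - z))"
      by blast
    have "(\<theta>' \<xi> - \<theta>' z) / (\<xi> - z) < Y" using D[of \<xi>] \<xi> y by (auto simp: dist_real_def)
    then have "\<theta>' \<xi> - \<theta>' z - Y * (\<xi> - z) \<ge> 0" using \<xi>(2) by (simp add: neg_divide_less_eq)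
    then have "(z - y) * (\<theta>' \<xi> - \<theta>' z - Y * (\<xi> - z)) \<ge> 0" using True by simp
    then show ?thesis using \<xi>(3) by linarith
  next
    case False
    show ?thesis
    proof (cases "y = z")
      case False
      with \<open>\<not> y < z\<close> have zy: "z < y" by simp
      have "\<exists>\<xi>>z. \<xi> < y \<and> k y - k z = (y - z) * (\<theta>' \<xi> - \<theta>' z - Y * (\<xi> - z))"
        using zy y by (intro MVT2 k) (auto simp: dist_real_def)
      then obtain \<xi> where \<xi>: "z < \<xi>" "\<xi> < y" "k y - k z = (y - z) * (\<theta>' \<xi> - \<theta>' z - Y * (\<xi> - z))"
        by blast
      have "(\<theta>' \<xi> - \<theta>' z) / (\<xi> - z) < Y" using D[of \<xi>] \<xi> y by (auto simp: dist_real_def)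
      then have "\<theta>' \<xi> - \<theta>' z - Y * (\<xi> - z) \<le> 0" using \<xi>(1) by (simp add: pos_divide_less_eq)
      then have "(y - z) * (\<theta>' \<xi> - \<theta>' z - Y * (\<xi> - z)) \<le> 0"
        using zy by (simp add: mult_nonneg_nonpos)
      then show ?thesis using \<xi>(3) by linarith
    qed simp
  qed
  then have "\<forall>y. dist y z < d \<longrightarrow> \<theta> y \<le> \<theta> z + \<theta>' z * (y - z) + Y / 2 * (y - z)\<^sup>2"
    by (simp add: k_def algebra_simps)
  then show ?thesis using d unfolding eventually_at by blast
qed

text \<open>
  The equation \<open>lam * u - (\<sigma> x)\<^sup>2 * u'' + H x u' = 0\<close> on an interval \<open>(0, L)\<close>; the endpoint \<open>0\<close> is going
  to be the vertex under consideration.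
\<close>
locale edge_eq =
  fixes L C lam :: real and \<sigma> :: "real \<Rightarrow> real" and H :: "real \<Rightarrow> real \<Rightarrow> real"
  assumes L: "0 < L" and C: "0 < C" and lam: "0 < lam"
    and Hx: "\<And>x y p. x \<in> {0..L} \<Longrightarrow> y \<in> {0..L} \<Longrightarrow> \<bar>H x p - H y p\<bar> \<le> C * (1 + \<bar>p\<bar>) * \<bar>x - y\<bar>"
    and Hp: "\<And>x p q. x \<in> {0..L} \<Longrightarrow> \<bar>H x p - H x q\<bar> \<le> C * \<bar>p - q\<bar>"
    and sig: "\<And>x y. x \<in> {0..L} \<Longrightarrow> y \<in> {0..L} \<Longrightarrow> \<bar>\<sigma> x - \<sigma> y\<bar> \<le> C * \<bar>x - y\<bar>"
begin

definition G :: "real \<Rightarrow> real \<Rightarrow> real \<Rightarrow> real \<Rightarrow> real" where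
  "G r p X x = lam * r - (\<sigma> x)\<^sup>2 * X + H x p"

text \<open>It suffices to test with parabolas, as every \<open>C\<^sup>2\<close> test function lies locally below its
  second order Taylor polynomial with a slightly larger leading coefficient.\<close>
definition subsol :: "(real \<Rightarrow> real) \<Rightarrow> bool" where
  "subsol f \<longleftrightarrow> usc_on {0..L} f \<and> (\<forall>x\<in>{0<..<L}. \<forall>p X.
     (\<forall>\<^sub>F y in at x. f y \<le> f x + p * (y - x) + X / 2 * (y - x)\<^sup>2) \<longrightarrow> G (f x) p X x \<le> 0)"

lemma G_open:
  assumes x0: "x0 \<in> {0..L}" and pos: "G r0 p0 X x0 > 0"
  obtains \<eta> where "\<eta> > 0"
    "\<And>x r p. x \<in> {0..L} \<Longrightarrow> \<bar>x - x0\<bar> < \<eta> \<Longrightarrow> \<bar>r - r0\<bar> < \<eta> \<Longrightarrow> \<bar>p - p0\<bar> < \<eta> \<Longrightarrow> G r p X x > 0"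
proof -
  define K where "K = lam + C * (C + 2 * \<bar>\<sigma> x0\<bar>) * \<bar>X\<bar> + C + C * (1 + \<bar>p0\<bar>)"
  have Kpos: "K > 0" unfolding K_def using lam C by (intro add_pos_nonneg add_nonneg_nonneg mult_nonneg_nonneg) auto
  define \<eta> where "\<eta> = min 1 (G r0 p0 X x0 / (2 * K))"
  have \<eta>: "\<eta> > 0" "\<eta> \<le> 1" using Kpos pos by (auto simp: \<eta>_def)
  have "\<eta> \<le> G r0 p0 X x0 / (2 * K)" by (simp add: \<eta>_def)
  then have "\<eta> * (2 * K) \<le> G r0 p0 X x0" using Kpos by (subst (asm) pos_le_divide_eq) auto
  then have "K * \<eta> \<le> G r0 p0 X x0 / 2" by (simp add: algebra_simps)
  then have K\<eta>: "K * \<eta> < G r0 p0 X x0" using pos by linarith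
  show thesis
  proof (rule that[OF \<eta>(1)])
    fix x r p assume x: "x \<in> {0..L}" and a: "\<bar>x - x0\<bar> < \<eta>" "\<bar>r - r0\<bar> < \<eta>" "\<bar>p - p0\<bar> < \<eta>"
    have 1: "lam * r0 - lam * r \<le> lam * \<eta>"
      using a(2) lam by (simp add: right_diff_distrib[symmetric])
    have s: "\<bar>\<sigma> x - \<sigma> x0\<bar> \<le> C * \<eta>"
      using sig[OF x x0] a(1) C by (smt (verit) mult_left_mono)
    then have s1: "\<bar>\<sigma> x - \<sigma> x0\<bar> \<le> C" using \<eta>(2) C by (smt (verit) mult_left_le)
    have "(\<sigma> x)\<^sup>2 - (\<sigma> x0)\<^sup>2 = (\<sigma> x - \<sigma> x0) * (\<sigma> x + \<sigma> x0)" by (simp add: power2_eq_square algebra_simps)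
    then have "\<bar>(\<sigma> x)\<^sup>2 - (\<sigma> x0)\<^sup>2\<bar> = \<bar>\<sigma> x - \<sigma> x0\<bar> * \<bar>\<sigma> x + \<sigma> x0\<bar>" by (simp add: abs_mult)
    also have "\<dots> \<le> (C * \<eta>) * (C + 2 * \<bar>\<sigma> x0\<bar>)"
      using s s1 C \<eta> by (intro mult_mono) auto
    finally have sq: "\<bar>(\<sigma> x)\<^sup>2 - (\<sigma> x0)\<^sup>2\<bar> \<le> (C * \<eta>) * (C + 2 * \<bar>\<sigma> x0\<bar>)" .
    have "((\<sigma> x)\<^sup>2 - (\<sigma> x0)\<^sup>2) * X \<le> \<bar>(\<sigma> x)\<^sup>2 - (\<sigma> x0)\<^sup>2\<bar> * \<bar>X\<bar>"
      by (metis abs_ge_self abs_mult)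
    also have "\<dots> \<le> (C * \<eta>) * (C + 2 * \<bar>\<sigma> x0\<bar>) * \<bar>X\<bar>" using sq by (rule mult_right_mono) simp
    finally have 2: "(\<sigma> x)\<^sup>2 * X - (\<sigma> x0)\<^sup>2 * X \<le> (C * (C + 2 * \<bar>\<sigma> x0\<bar>) * \<bar>X\<bar>) * \<eta>"
      by (simp add: algebra_simps)
    have "\<bar>H x p - H x p0\<bar> \<le> C * \<eta>" using Hp[OF x, of p p0] a(3) C by (smt (verit) mult_left_mono)
    moreover have "C * (1 + \<bar>p0\<bar>) * \<bar>x - x0\<bar> \<le> C * (1 + \<bar>p0\<bar>) * \<eta>"
      using a(1) C by (intro mult_left_mono) auto
    ultimately have 3: "H x0 p0 - H x p \<le> C * \<eta> + C * (1 + \<bar>p0\<bar>) * \<eta>"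
      using Hx[OF x x0, of p0] by linarith
    have "G r0 p0 X x0 - G r p X x \<le> K * \<eta>"
      unfolding G_def K_def using 1 2 3 by (simp add: algebra_simps)
    then show "G r p X x > 0" using K\<eta> by linarith
  qed
qed

lemma G_bump:
  assumes "G r p X x > 0" obtains Y where "X < Y" "G r p Y x > 0"
proof
  define e where "e = G r p X x / (2 * ((\<sigma> x)\<^sup>2 + 1))"
  have q: "(\<sigma> x)\<^sup>2 + 1 > 0" by (simp add: add_nonneg_pos)
  then have e: "e > 0" using assms unfolding e_def by simp
  have "((\<sigma> x)\<^sup>2 + 1) * e = G r p X x / 2" unfolding e_def using q by (simp add: field_simps)
  then have "(\<sigma> x)\<^sup>2 * e < G r p X x" using e assms by (simp add: algebra_simps)
  then show "G r p (X + e) x > 0" by (simp add: G_def algebra_simps)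
  show "X < X + e" using e by simp
qed

text \<open>
  A smooth strict supersolution cannot be exceeded inside an interval if it is not exceeded at the
  ends: at a positive interior maximum of \<open>f - \<theta>\<close> it would be a test function. The barriers below are
  all instances of this lemma, with \<open>\<theta>\<close> a parabola or, once, a logarithm.
\<close>
lemma comparison_with_supersolution:
  assumes f: "subsol f" and st: "0 \<le> s" "s < t" "t \<le> L"
    and cont: "continuous_on {s..t} \<theta>"
    and d1: "\<And>x. x \<in> {s<..<t} \<Longrightarrow> (\<theta> has_real_derivative \<theta>' x) (at x)"
    and d2: "\<And>x. x \<in> {s<..<t} \<Longrightarrow> (\<theta>' has_real_derivative \<theta>'' x) (at x)"
    and ends: "f s \<le> \<theta> s" "f t \<le> \<theta> t"
    and super: "\<And>x. x \<in> {s<..<t} \<Longrightarrow> \<theta> x < f x \<Longrightarrow> G (f x) (\<theta>' x) (\<theta>'' x) x > 0"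
    and x: "x \<in> {s..t}"
  shows "f x \<le> \<theta> x"
proof (rule ccontr)
  assume neg: "\<not> f x \<le> \<theta> x"
  have "usc_on {s..t} (\<lambda>x. f x + - \<theta> x)"
    using f st cont unfolding subsol_def
    by (intro usc_on_add usc_on_continuous[of _ "\<lambda>x. - \<theta> x"] continuous_intros) (auto elim: usc_on_subset)
  then obtain z where z: "z \<in> {s..t}" "\<And>y. y \<in> {s..t} \<Longrightarrow> f y - \<theta> y \<le> f z - \<theta> z"
    using usc_attains_max[OF compact_Icc, of s t "\<lambda>x. f x + - \<theta> x"] st by auto
  have pos: "f z - \<theta> z > 0" using z(2)[OF x] neg by linarith
  then have zi: "z \<in> {s<..<t}" using z(1) ends by (cases "z = s \<or> z = t") auto
  from super[OF zi] pos obtain Y where Y: "\<theta>'' z < Y" "G (f z) (\<theta>' z) Y z > 0"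
    using G_bump by (metis diff_gt_0_iff_gt)
  have ev: "\<forall>\<^sub>F y in nhds z. y \<in> {s<..<t}" using zi by (intro eventually_nhds_in_open) auto
  then have "\<forall>\<^sub>F y in nhds z. (\<theta> has_real_derivative \<theta>' y) (at y)"
    by eventually_elim (rule d1)
  from taylor2_upper[OF this d2[OF zi] Y(1)]
  have "\<forall>\<^sub>F y in at z. \<theta> y \<le> \<theta> z + \<theta>' z * (y - z) + Y / 2 * (y - z)\<^sup>2" .
  moreover have "\<forall>\<^sub>F y in at z. y \<in> {s<..<t}"
    using ev unfolding eventually_at_filter by eventually_elim auto
  ultimately have "\<forall>\<^sub>F y in at z. f y \<le> f z + \<theta>' z * (y - z) + Y / 2 * (y - z)\<^sup>2"
  proof eventually_elim
    case (elim y)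
    then have "y \<in> {s..t}" by simp
    from z(2)[OF this] elim(1) show ?case by linarith
  qed
  then have "G (f z) (\<theta>' z) Y z \<le> 0" using f zi st unfolding subsol_def by auto
  then show False using Y(2) by simp
qed

lemma comparison_with_parabola:
  assumes f: "subsol f" and st: "0 \<le> s" "s < t" "t \<le> L"
    and ends: "f s \<le> r + p * (s - b) + X / 2 * (s - b)\<^sup>2" "f t \<le> r + p * (t - b) + X / 2 * (t - b)\<^sup>2"
    and super: "\<And>x. x \<in> {s<..<t} \<Longrightarrow>
      G (r + p * (x - b) + X / 2 * (x - b)\<^sup>2) (p + X * (x - b)) X x \<ge> 0"
    and x: "x \<in> {s..t}"
  shows "f x \<le> r + p * (x - b) + X / 2 * (x - b)\<^sup>2"
proof (rule comparison_with_supersolution[OF f st _ _ _ ends _ x, where \<theta>' = "\<lambda>x. p + X * (x - b)" and \<theta>'' = "\<lambda>_. X"])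
  show "continuous_on {s..t} (\<lambda>a. r + p * (a - b) + X / 2 * (a - b)\<^sup>2)" by (intro continuous_intros)
  show "((\<lambda>a. r + p * (a - b) + X / 2 * (a - b)\<^sup>2) has_real_derivative p + X * (x - b)) (at x)" for x
    by (auto intro!: derivative_eq_intros)
  show "((\<lambda>x. p + X * (x - b)) has_real_derivative X) (at x)" for x
    by (auto intro!: derivative_eq_intros)
  fix x assume x: "x \<in> {s<..<t}" and "r + p * (x - b) + X / 2 * (x - b)\<^sup>2 < f x"
  then have "lam * (r + p * (x - b) + X / 2 * (x - b)\<^sup>2) < lam * f x" using lam by simp
  then show "G (f x) (p + X * (x - b)) X x > 0" using super[OF x] by (simp add: G_def)
qed

section \<open>Subsolutions near an endpoint\<close>
definition coercive :: bool where
  "coercive \<longleftrightarrow> (\<exists>c>0. \<exists>d. \<exists>\<delta>>0. \<forall>x\<in>{0..L}. x < \<delta> \<longrightarrow> (\<forall>p. c * \<bar>p\<bar> - d \<le> H x p))"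

text \<open>
  Both alternatives of the vertex assumption lead to one estimate, for parabolas of slope between
  \<open>P / 2\<close> and \<open>P\<close> and second derivative \<open>- P / (2 * \<delta>)\<close> on \<open>[0, \<delta>]\<close>: either \<open>H\<close> itself grows with \<open>P\<close>, or
  the second order term beats the Lipschitz growth of \<open>H\<close> if \<open>\<delta>\<close> is small.
\<close>
lemma coercivity_margin:
  assumes "\<sigma> 0 \<noteq> 0 \<or> coercive"
  obtains \<delta> m k where "0 < \<delta>" "\<delta> \<le> L" "0 < m"
    "\<And>P x p. 0 \<le> P \<Longrightarrow> x \<in> {0..\<delta>} \<Longrightarrow> p \<in> {P/2..P} \<Longrightarrow>
       m * P - k \<le> (\<sigma> x)\<^sup>2 * (P / (2 * \<delta>)) + H x p"
proof (cases "coercive")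
  case True
  then obtain c d \<delta> where c: "c > 0" "\<delta> > 0"
    and H: "\<And>x p. x \<in> {0..L} \<Longrightarrow> x < \<delta> \<Longrightarrow> c * \<bar>p\<bar> - d \<le> H x p" unfolding coercive_def by blast
  define e where "e = min (\<delta> / 2) L"
  have e: "0 < e" "e \<le> L" "e < \<delta>" using c L by (auto simp: e_def)
  show thesis
  proof (rule that[of e "c / 2" d])
    fix P x p :: real assume a: "0 \<le> P" "x \<in> {0..e}" "p \<in> {P/2..P}"
    have "c / 2 * P \<le> c * \<bar>p\<bar>" using a c mult_left_mono[of "P / 2" "\<bar>p\<bar>" c] by simp
    moreover have "0 \<le> (\<sigma> x)\<^sup>2 * (P / (2 * e))" using a e by simp
    ultimately show "c / 2 * P - d \<le> (\<sigma> x)\<^sup>2 * (P / (2 * e)) + H x p"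
      using H[of x p] a e by (smt (verit, best) atLeastAtMost_iff)
  qed (use e c in auto)
next
  case False
  then have s: "\<sigma> 0 \<noteq> 0" using assms by blast
  define e where "e = min L (min (\<bar>\<sigma> 0\<bar> / (2 * C)) ((\<sigma> 0)\<^sup>2 / (8 * (C + 1))))"
  have e: "0 < e" "e \<le> L" "e \<le> \<bar>\<sigma> 0\<bar> / (2 * C)" "e \<le> (\<sigma> 0)\<^sup>2 / (8 * (C + 1))"
    using s C L by (auto simp: e_def)
  show thesis
  proof (rule that[of e 1 "\<bar>H 0 0\<bar> + C * L"])
    fix P x p :: real assume a: "0 \<le> P" "x \<in> {0..e}" "p \<in> {P/2..P}"
    have x: "x \<in> {0..L}" using a e by auto
    have "\<bar>\<sigma> x - \<sigma> 0\<bar> \<le> C * x" using sig[OF x, of 0] x by auto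
    also have "\<dots> \<le> C * (\<bar>\<sigma> 0\<bar> / (2 * C))" using a e C by (intro mult_left_mono) auto
    also have "\<dots> = \<bar>\<sigma> 0\<bar> / 2" using C by simp
    finally have "\<bar>\<sigma> 0\<bar> / 2 \<le> \<bar>\<sigma> x\<bar>" by linarith
    then have "(\<bar>\<sigma> 0\<bar> / 2)\<^sup>2 \<le> \<bar>\<sigma> x\<bar>\<^sup>2" by (intro power_mono) auto
    then have sq: "(\<sigma> 0)\<^sup>2 / 4 \<le> (\<sigma> x)\<^sup>2" by (simp add: power_divide)
    have "e * (8 * (C + 1)) \<le> (\<sigma> 0)\<^sup>2"
      using e(4) C by (simp add: pos_le_divide_eq)
    then have "(C + 1) * (2 * e) \<le> (\<sigma> x)\<^sup>2" using sq by (simp add: algebra_simps)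
    then have "C + 1 \<le> (\<sigma> x)\<^sup>2 / (2 * e)" using e by (simp add: pos_le_divide_eq)
    then have "(C + 1) * P \<le> ((\<sigma> x)\<^sup>2 / (2 * e)) * P" using a by (intro mult_right_mono) auto
    then have 1: "(C + 1) * P \<le> (\<sigma> x)\<^sup>2 * (P / (2 * e))" by simp
    have "C * \<bar>p - 0\<bar> \<le> C * P" using a C by (intro mult_left_mono) auto
    then have 2: "H x p \<ge> H x 0 - C * P" using Hp[OF x, of p 0] by linarith
    have "C * x \<le> C * L" using x C by auto
    then have 3: "H x 0 \<ge> - \<bar>H 0 0\<bar> - C * L" using Hx[OF x, of 0 0] x by auto
    show "1 * P - (\<bar>H 0 0\<bar> + C * L) \<le> (\<sigma> x)\<^sup>2 * (P / (2 * e)) + H x p"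
      using 1 2 3 by (simp add: algebra_simps)
  qed (use e in auto)
qed

text \<open>
  The concave parabola with large initial slope \<open>P\<close> is a supersolution and at \<open>\<delta>\<close> exceeds \<open>f\<close>, which
  is bounded. As it also violates the equation at \<open>0\<close>, it forces the vertex condition when it is
  used as a test function there.
\<close>
lemma upper_barrier:
  assumes f: "subsol f" and B: "\<And>x. x \<in> {0..L} \<Longrightarrow> \<bar>f x\<bar> \<le> B" and nd: "\<sigma> 0 \<noteq> 0 \<or> coercive"
  obtains P X where "G (f 0) P X 0 > 0" "\<forall>\<^sub>F x in at_right 0. f x \<le> f 0 + P * x + X / 2 * x\<^sup>2"
proof -
  obtain \<delta> m k where d: "0 < \<delta>" "\<delta> \<le> L" "0 < m" and
    M: "\<And>P x p. 0 \<le> P \<Longrightarrow> x \<in> {0..\<delta>} \<Longrightarrow> p \<in> {P/2..P} \<Longrightarrow>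
       m * P - k \<le> (\<sigma> x)\<^sup>2 * (P / (2 * \<delta>)) + H x p" using coercivity_margin[OF nd] by metis
  have B0: "B \<ge> 0" using B[of 0] L by auto
  define P where "P = (\<bar>k\<bar> + lam * B + 1) / m + 4 * B / \<delta>"
  have P1: "(\<bar>k\<bar> + lam * B + 1) / m \<le> P" "4 * B / \<delta> \<le> P" "0 < P"
  proof -
    have "0 \<le> 4 * B / \<delta>" "0 < (\<bar>k\<bar> + lam * B + 1) / m"
      using B0 d lam by (auto intro!: divide_pos_pos add_nonneg_pos)
    then show "(\<bar>k\<bar> + lam * B + 1) / m \<le> P" "4 * B / \<delta> \<le> P" "0 < P" unfolding P_def by linarith+
  qed
  have Pm: "\<bar>k\<bar> + lam * B + 1 \<le> m * P" using P1(1) d by (simp add: pos_divide_le_eq mult.commute)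
  have P\<delta>: "4 * B \<le> P * \<delta>" using P1(2) d by (simp add: pos_divide_le_eq)
  define X where "X = - P / (2 * \<delta>)"
  have slope: "P + X * x \<in> {P/2..P}" if "x \<in> {0..\<delta>}" for x
  proof -
    have "- X * x \<le> P / (2 * \<delta>) * \<delta>" unfolding X_def using that d P1 by (simp add: field_simps)
    moreover have "X * x \<le> 0" unfolding X_def using that d P1 by (simp add: divide_nonpos_pos mult_nonpos_nonneg)
    ultimately show ?thesis using d by auto
  qed
  have up: "f 0 \<le> f 0 + P * (x - 0) + X / 2 * (x - 0)\<^sup>2" if "x \<in> {0..\<delta>}" for x
  proof -
    have "0 \<le> (P + X / 2 * x) * x"
      using slope[OF that] that P1 by (intro mult_nonneg_nonneg) auto
    then show ?thesis by (simp add: power2_eq_square algebra_simps)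
  qed
  have f0: "- B \<le> f 0" "f 0 \<le> B" using B[of 0] L by auto
  have le: "f x \<le> f 0 + P * (x - 0) + X / 2 * (x - 0)\<^sup>2" if "x \<in> {0..\<delta>}" for x
  proof (rule comparison_with_parabola[OF f order_refl d(1,2) _ _ _ that])
    have "X / 2 * (\<delta> - 0)\<^sup>2 = - (P * \<delta>) / 4" unfolding X_def using d by (simp add: power2_eq_square)
    then have "2 * B \<le> P * (\<delta> - 0) + X / 2 * (\<delta> - 0)\<^sup>2" using P\<delta> B0 by simp
    then show "f \<delta> \<le> f 0 + P * (\<delta> - 0) + X / 2 * (\<delta> - 0)\<^sup>2"
      using f0 B[of \<delta>] d by auto
    fix x assume "x \<in> {0<..<\<delta>}"
    then have x: "x \<in> {0..\<delta>}" by auto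
    have "- (lam * B) \<le> lam * (f 0 + P * (x - 0) + X / 2 * (x - 0)\<^sup>2)"
      using up[OF x] f0 lam by (smt (verit) mult_left_mono mult_minus_right)
    then show "0 \<le> G (f 0 + P * (x - 0) + X / 2 * (x - 0)\<^sup>2) (P + X * (x - 0)) X x"
      using M[OF _ x slope[OF x]] Pm P1 unfolding G_def by (simp add: X_def)
  qed auto
  show thesis
  proof
    have "- (lam * B) \<le> lam * f 0" using f0 lam by (smt (verit) mult_left_mono mult_minus_right)
    then show "G (f 0) P X 0 > 0"
      using M[of P 0 P] Pm P1 d unfolding G_def by (simp add: X_def)
    show "\<forall>\<^sub>F x in at_right 0. f x \<le> f 0 + P * x + X / 2 * x\<^sup>2"
      unfolding eventually_at_right_field using le d by (intro exI[of _ \<delta>]) auto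
  qed
qed

lemma upper_slope:
  assumes "subsol f" "\<And>x. x \<in> {0..L} \<Longrightarrow> \<bar>f x\<bar> \<le> B" "\<sigma> 0 \<noteq> 0 \<or> coercive"
  obtains P where "\<forall>\<^sub>F x in at_right 0. f x \<le> f 0 + P * x"
proof -
  obtain P X where P: "\<forall>\<^sub>F x in at_right 0. f x \<le> f 0 + P * x + X / 2 * x\<^sup>2"
    using upper_barrier[OF assms] by metis
  have "\<forall>\<^sub>F x in at_right 0. P * x \<le> (P + 1) * x + (- X) / 2 * x\<^sup>2"
    by (rule slope_absorbs_curvature) simp
  with P have "\<forall>\<^sub>F x in at_right 0. f x \<le> f 0 + (P + 1) * x"
    by eventually_elim auto
  then show thesis using that by blast
qed

text \<open>
  If \<open>f\<close> came below the parabola at some \<open>x1\<close>, lower its slope to some \<open>p' < p0\<close> so that \<open>f \<le> \<theta>\<close> at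
  \<open>0\<close> and at \<open>x1\<close>. The new parabola \<open>\<theta>\<close> is still a supersolution, hence \<open>f \<le> \<theta>\<close> in between, and
  \<open>f\<close> could not frequently have slopes above \<open>p'\<close> near \<open>0\<close>.
\<close>
lemma lower_parabola:
  assumes f: "subsol f"
    and freq: "\<And>q. q < p0 \<Longrightarrow> \<exists>\<^sub>F x in at_right 0. f 0 + q * x < f x"
    and pos: "G (f 0) p0 X 0 > 0"
  shows "\<forall>\<^sub>F x in at_right 0. f 0 + p0 * x + X / 2 * x\<^sup>2 \<le> f x"
proof -
  have "(0::real) \<in> {0..L}" using L by auto
  from G_open[OF this pos] obtain \<eta> where \<eta>: "\<eta> > 0" and
    G: "\<And>x r p. x \<in> {0..L} \<Longrightarrow> \<bar>x - 0\<bar> < \<eta> \<Longrightarrow> \<bar>r - f 0\<bar> < \<eta> \<Longrightarrow> \<bar>p - p0\<bar> < \<eta> \<Longrightarrow> G r p X x > 0"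
    by metis
  define Q where "Q = \<bar>p0\<bar> + \<bar>X\<bar> + 2"
  have Q: "Q > 0" unfolding Q_def by auto
  define \<delta> where "\<delta> = min (min 1 L) (min \<eta> (\<eta> / (2 * Q)))"
  have \<delta>: "0 < \<delta>" "\<delta> \<le> 1" "\<delta> \<le> L" "\<delta> \<le> \<eta>" "\<delta> \<le> \<eta> / (2 * Q)" using \<eta> Q L by (auto simp: \<delta>_def)
  have \<delta>Q: "Q * \<delta> \<le> \<eta> / 2" using \<delta>(5) Q by (simp add: pos_le_divide_eq mult.commute mult.left_commute)
  have "f 0 + p0 * x1 + X / 2 * x1\<^sup>2 \<le> f x1" if x1: "0 < x1" "x1 < \<delta>" for x1
  proof (rule ccontr)
    assume "\<not> ?thesis"
    then have neg: "f x1 - f 0 - X / 2 * x1\<^sup>2 < p0 * x1" by simp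
    define p' where "p' = max (max (p0 - \<eta> / 4) (p0 - 1)) ((f x1 - f 0 - X / 2 * x1\<^sup>2) / x1)"
    have "(f x1 - f 0 - X / 2 * x1\<^sup>2) / x1 < p0" using neg x1 by (simp add: pos_divide_less_eq)
    then have p': "p' < p0" "p0 - \<eta> / 4 \<le> p'" "p0 - 1 \<le> p'" "(f x1 - f 0 - X / 2 * x1\<^sup>2) / x1 \<le> p'"
      using \<eta> by (auto simp: p'_def)
    have p'1: "f x1 - f 0 - X / 2 * x1\<^sup>2 \<le> p' * x1" using p'(4) x1 by (simp add: pos_divide_le_eq)
    have le: "f x \<le> f 0 + p' * (x - 0) + X / 2 * (x - 0)\<^sup>2" if x: "x \<in> {0..x1}" for x
    proof (rule comparison_with_parabola[OF f order_refl x1(1) _ _ _ _ x])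
      show "x1 \<le> L" using x1 \<delta> by auto
      show "f x1 \<le> f 0 + p' * (x1 - 0) + X / 2 * (x1 - 0)\<^sup>2" using p'1 by simp
      fix x assume x: "x \<in> {0<..<x1}"
      have xs: "x \<le> 1" "0 < x" "x < \<delta>" using x x1 \<delta> by auto
      have "\<bar>p' * x + X / 2 * x\<^sup>2\<bar> \<le> \<bar>p'\<bar> * x + \<bar>X\<bar> / 2 * (x * x)"
        using xs by (simp add: power2_eq_square abs_mult order_trans[OF abs_triangle_ineq])
      also have "\<dots> \<le> (\<bar>p0\<bar> + 1) * x + \<bar>X\<bar> * x"
      proof -
        have "\<bar>p'\<bar> * x \<le> (\<bar>p0\<bar> + 1) * x" using p' xs by (intro mult_right_mono) auto
        moreover have "x * x \<le> x" using xs by (simp add: mult_left_le)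
        then have "\<bar>X\<bar> / 2 * (x * x) \<le> \<bar>X\<bar> * x" by (intro mult_mono) auto
        ultimately show ?thesis by linarith
      qed
      also have "\<dots> \<le> Q * x" using xs by (simp add: Q_def algebra_simps)
      also have "\<dots> < Q * \<delta>" using xs Q by simp
      finally have 1: "\<bar>p' * x + X / 2 * x\<^sup>2\<bar> < \<eta>" using \<delta>Q \<eta> by linarith
      have "\<bar>X * x\<bar> \<le> Q * x" using xs by (auto simp: Q_def abs_mult intro!: mult_right_mono)
      also have "\<dots> < Q * \<delta>" using xs Q by simp
      finally have 2: "\<bar>p' + X * x - p0\<bar> < \<eta>" using \<delta>Q \<eta> p' by linarith
      have "G (f 0 + p' * (x - 0) + X / 2 * (x - 0)\<^sup>2) (p' + X * (x - 0)) X x > 0"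
        using 1 2 xs \<delta> by (intro G) auto
      then show "0 \<le> G (f 0 + p' * (x - 0) + X / 2 * (x - 0)\<^sup>2) (p' + X * (x - 0)) X x" by simp
    qed simp_all
    define q where "q = (p' + p0) / 2"
    have q: "p' < q" "q < p0" using p' by (auto simp: q_def)
    have "\<forall>\<^sub>F x in at_right 0. p' * x \<le> q * x + (- X) / 2 * x\<^sup>2"
      by (rule slope_absorbs_curvature[OF q(1)])
    with freq[OF q(2)] have "\<exists>\<^sub>F x in at_right 0. f 0 + p' * x + X / 2 * x\<^sup>2 < f x"
      by (rule frequently_conj_eventually) auto
    then obtain y where "0 < y" "y < x1" "f 0 + p' * y + X / 2 * y\<^sup>2 < f y"
      by (rule frequently_at_right_E[OF _ x1(1)])
    then show False using le[of y] by auto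
  qed
  then show ?thesis unfolding eventually_at_right_field using \<delta>(1) by blast
qed

text \<open>
  A blow-up argument without passing to a limit. At a point \<open>x1\<close> where the slope of \<open>f\<close> is nearly
  the largest one, bend the line of slope \<open>p0 + \<epsilon>\<close> to a parabola on \<open>[x1 / 2, 3 * x1 / 2]\<close> so that \<open>f\<close>
  exceeds it at \<open>x1\<close> but not at the ends. Its second derivative is of order \<open>\<epsilon> / x1\<close>, and
  \<open>(\<sigma> x)\<^sup>2\<close> is at most of order \<open>x1\<^sup>2\<close>, so the second order term is negligible.
\<close>
lemma limsup_slope_critical:
  assumes f: "subsol f" and s0: "\<sigma> 0 = 0"
    and up: "\<And>q. p0 < q \<Longrightarrow> \<forall>\<^sub>F x in at_right 0. f x \<le> f 0 + q * x"
    and low: "\<And>q. q < p0 \<Longrightarrow> \<exists>\<^sub>F x in at_right 0. f 0 + q * x < f x"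
  shows "lam * f 0 + H 0 p0 \<le> 0"
proof (rule ccontr)
  define \<kappa> where "\<kappa> = lam * f 0 + H 0 p0"
  assume "\<not> ?thesis"
  then have \<kappa>: "\<kappa> > 0" by (simp add: \<kappa>_def)
  have z: "(0::real) \<in> {0..L}" using L by auto
  have "G (f 0 - \<kappa> / (2 * lam)) p0 0 0 = \<kappa> / 2"
    unfolding G_def using lam by (simp add: \<kappa>_def[symmetric] right_diff_distrib)
       (simp add: \<kappa>_def)
  then have "G (f 0 - \<kappa> / (2 * lam)) p0 0 0 > 0" using \<kappa> by simp
  from G_open[OF z this] obtain \<eta> where \<eta>: "\<eta> > 0" and
    G: "\<And>x r p. x \<in> {0..L} \<Longrightarrow> \<bar>x - 0\<bar> < \<eta> \<Longrightarrow> \<bar>r - (f 0 - \<kappa> / (2 * lam))\<bar> < \<eta> \<Longrightarrow> \<bar>p - p0\<bar> < \<eta>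
      \<Longrightarrow> G r p 0 x > 0"
    by metis
  define \<epsilon> where "\<epsilon> = min 1 (\<eta> / 26)"
  have \<epsilon>: "0 < \<epsilon>" "\<epsilon> \<le> 1" "\<epsilon> \<le> \<eta> / 26" using \<eta> by (auto simp: \<epsilon>_def)
  obtain b where b: "b > 0" "\<And>x. 0 < x \<Longrightarrow> x < b \<Longrightarrow> f x \<le> f 0 + (p0 + \<epsilon>) * x"
    using up[of "p0 + \<epsilon>"] \<epsilon> unfolding eventually_at_right_field by auto
  define Q where "Q = 2 * \<bar>p0\<bar> + 20"
  have Q: "Q > 0" unfolding Q_def by auto
  define \<delta> where "\<delta> = min (min (b / 2) (L / 2)) (min (min (\<eta> / 2) (\<eta> / Q)) (\<kappa> / (108 * C\<^sup>2)))"
  have \<delta>: "0 < \<delta>" "\<delta> \<le> b / 2" "\<delta> \<le> L / 2" "\<delta> \<le> \<eta> / 2" "\<delta> \<le> \<eta> / Q" "\<delta> \<le> \<kappa> / (108 * C\<^sup>2)"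
    unfolding \<delta>_def using \<eta> Q L b \<kappa> C by (simp_all only: min.bounded_iff min_less_iff_conj) auto
  obtain x1 where x1: "0 < x1" "x1 < \<delta>" "f 0 + (p0 - \<epsilon>) * x1 < f x1"
    using frequently_at_right_E[OF low[of "p0 - \<epsilon>"] \<delta>(1)] \<epsilon> by auto
  (* The drop 3 * \<epsilon> * x1 at x1 puts the vertex of the parabola below f x1, which is larger than
     f 0 + (p0 - \<epsilon>) * x1; the leading coefficient regains the drop at distance x1 / 2. *)
  define r where "r = f 0 + (p0 + \<epsilon>) * x1 - 3 * \<epsilon> * x1"
  define X where "X = 24 * \<epsilon> / x1"
  define s where "s = x1 / 2"
  define t where "t = 3 * x1 / 2"
  have Xsq: "X / 2 * (x1 / 2)\<^sup>2 = 3 * \<epsilon> * x1"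
    unfolding X_def using x1 by (simp add: power2_eq_square field_simps)
  have "x1 < \<eta> / Q" using x1(2) \<delta>(5) by linarith
  then have Qx: "Q * x1 < \<eta>" using Q by (simp add: pos_less_divide_eq mult.commute)
  have C2: "108 * C\<^sup>2 > 0" using C by simp
  have "x1 < \<kappa> / (108 * C\<^sup>2)" using x1(2) \<delta>(6) by linarith
  then have "x1 * (108 * C\<^sup>2) < \<kappa>" using C2 by (simp only: pos_less_divide_eq)
  then have Kx: "54 * C\<^sup>2 * x1 \<le> \<kappa> / 2" by (simp add: algebra_simps)
  have "f x1 \<le> r + (p0 + \<epsilon>) * (x1 - x1) + X / 2 * (x1 - x1)\<^sup>2"
  proof (rule comparison_with_parabola[OF f, of s t])
    show "0 \<le> s" "s < t" "t \<le> L" "x1 \<in> {s..t}" using x1 \<delta> by (auto simp: s_def t_def)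
    have s': "s - x1 = - (x1 / 2)" "t - x1 = x1 / 2" by (auto simp: s_def t_def)
    have "f s \<le> f 0 + (p0 + \<epsilon>) * s" using x1 \<delta> b by (intro b) (auto simp: s_def)
    also have "\<dots> = r + (p0 + \<epsilon>) * (s - x1) + X / 2 * (s - x1)\<^sup>2"
      unfolding s' power2_minus Xsq by (simp add: r_def s_def algebra_simps)
    finally show "f s \<le> r + (p0 + \<epsilon>) * (s - x1) + X / 2 * (s - x1)\<^sup>2" .
    have "f t \<le> f 0 + (p0 + \<epsilon>) * t" using x1 \<delta> b by (intro b) (auto simp: t_def)
    also have "\<dots> = r + (p0 + \<epsilon>) * (t - x1) + X / 2 * (t - x1)\<^sup>2"
      unfolding s' Xsq by (simp add: r_def t_def algebra_simps)
    finally show "f t \<le> r + (p0 + \<epsilon>) * (t - x1) + X / 2 * (t - x1)\<^sup>2" .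
    fix x assume x: "x \<in> {s<..<t}"
    then have xL: "x \<in> {0..L}" and x2: "0 < x" "x < 3 * x1 / 2" and x3: "x1 / 2 < x"
      using x1 \<delta> by (auto simp: s_def t_def)
    have xd: "\<bar>x - x1\<bar> \<le> x1 / 2" by (rule abs_leI) (use x2(2) x3 in linarith)+
    define \<theta> where "\<theta> = r + (p0 + \<epsilon>) * (x - x1) + X / 2 * (x - x1)\<^sup>2"
    have th: "\<theta> - f 0 = (p0 + \<epsilon>) * x - 3 * \<epsilon> * x1 + X / 2 * (x - x1)\<^sup>2"
      by (simp add: \<theta>_def r_def algebra_simps)
    have X0: "X > 0" using \<epsilon> x1 by (simp add: X_def)
    have "(x - x1)\<^sup>2 \<le> (x1 / 2)\<^sup>2" using power_mono[OF xd abs_ge_zero, of 2] by simp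
    then have "X / 2 * (x - x1)\<^sup>2 \<le> X / 2 * (x1 / 2)\<^sup>2" using X0 by (intro mult_left_mono) auto
    then have q1: "X / 2 * (x - x1)\<^sup>2 \<le> 3 * \<epsilon> * x1" unfolding Xsq .
    have q0: "0 \<le> X / 2 * (x - x1)\<^sup>2" using X0 by simp
    have q2: "3 * \<epsilon> * x1 \<le> 3 * x1" using \<epsilon> x1 by simp
    have "\<bar>(p0 + \<epsilon>) * x\<bar> = \<bar>p0 + \<epsilon>\<bar> * x" using x2 by (simp add: abs_mult)
    also have "\<dots> \<le> (\<bar>p0\<bar> + 1) * (3 * x1 / 2)" using x2 \<epsilon> by (intro mult_mono) auto
    finally have q3: "\<bar>(p0 + \<epsilon>) * x\<bar> \<le> (\<bar>p0\<bar> + 1) * (3 * x1 / 2)" .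
    have "\<bar>\<theta> - f 0\<bar> \<le> (\<bar>p0\<bar> + 1) * (3 * x1 / 2) + 3 * x1"
      unfolding th using q0 q1 q2 q3 by linarith
    also have "\<dots> \<le> Q * x1" using x1 by (simp add: Q_def algebra_simps)
    finally have t1: "\<bar>\<theta> - f 0\<bar> < \<eta>" using Qx by linarith
    have "\<bar>X * (x - x1)\<bar> \<le> X * (x1 / 2)" using xd X0 by (simp add: abs_mult)
    also have "\<dots> = 12 * \<epsilon>" using x1 by (simp add: X_def)
    finally have t2: "\<bar>p0 + \<epsilon> + X * (x - x1) - p0\<bar> < \<eta>" using \<epsilon> \<eta> by linarith
    have "G (\<theta> - \<kappa> / (2 * lam)) (p0 + \<epsilon> + X * (x - x1)) 0 x > 0"
      using t1 t2 xL x2 x1 \<delta> by (intro G) auto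
    then have g: "lam * \<theta> + H x (p0 + \<epsilon> + X * (x - x1)) > \<kappa> / 2"
      using lam by (simp add: G_def right_diff_distrib)
    have "\<bar>\<sigma> x\<bar> \<le> C * x" using sig[OF xL z] s0 x2 by auto
    also have "\<dots> \<le> C * (3 * x1 / 2)" using x2 C by auto
    finally have "\<bar>\<sigma> x\<bar>\<^sup>2 \<le> (C * (3 * x1 / 2))\<^sup>2" by (intro power_mono) auto
    then have "(\<sigma> x)\<^sup>2 * X \<le> (C * (3 * x1 / 2))\<^sup>2 * X" using X0 by (intro mult_right_mono) auto
    also have "\<dots> = 54 * C\<^sup>2 * x1 * \<epsilon>" unfolding X_def using x1 by (simp add: power2_eq_square field_simps)
    also have "\<dots> \<le> 54 * C\<^sup>2 * x1 * 1" using \<epsilon> x1 by (intro mult_left_mono) auto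
    finally have "(\<sigma> x)\<^sup>2 * X \<le> \<kappa> / 2" using Kx by linarith
    then show "0 \<le> G (r + (p0 + \<epsilon>) * (x - x1) + X / 2 * (x - x1)\<^sup>2) (p0 + \<epsilon> + X * (x - x1)) X x"
      using g unfolding G_def \<theta>_def by linarith
  qed
  then have "f x1 \<le> f 0 + (p0 + \<epsilon>) * x1 - 3 * \<epsilon> * x1" by (simp add: r_def)
  moreover have "\<epsilon> * x1 > 0" using \<epsilon> x1 by simp
  ultimately show False using x1(3) by (simp add: algebra_simps)
qed

text \<open>
  Suppose \<open>f\<close> fell below \<open>f 0\<close> with slope at least \<open>K\<close>. Compare it with a line of slope \<open>- K / 2\<close> plus
  \<open>\<eta> * ln (x0 / x)\<close>. The logarithm dominates at \<open>0\<close>, it only steepens the descent, and it costs just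
  \<open>(\<sigma> x)\<^sup>2 * \<eta> / x\<^sup>2 \<le> C\<^sup>2 * \<eta>\<close> in the second order term; so this is a supersolution by coercivity. As
  \<open>\<eta>\<close> tends to \<open>0\<close>, \<open>f\<close> stays below \<open>f 0 - K * x0 / 2\<close>, and \<open>f 0\<close> is not its upper limit.
\<close>
lemma limsup_slope_bounded:
  assumes f: "subsol f" and B: "\<And>x. x \<in> {0..L} \<Longrightarrow> \<bar>f x\<bar> \<le> B" and s0: "\<sigma> 0 = 0" and co: "coercive"
    and lim: "\<And>c. c < f 0 \<Longrightarrow> \<exists>\<^sub>F x in at_right 0. c < f x"
  obtains K where "\<exists>\<^sub>F x in at_right 0. f 0 - K * x < f x"
proof -
  obtain c d \<delta> where c: "c > 0" "\<delta> > 0"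
    and H: "\<And>x p. x \<in> {0..L} \<Longrightarrow> x < \<delta> \<Longrightarrow> c * \<bar>p\<bar> - d \<le> H x p"
    using co unfolding coercive_def by blast
  have B0: "B \<ge> 0" using B[of 0] L by auto
  define K where "K = 2 * (\<bar>d\<bar> + lam * B + C\<^sup>2 + 1) / c"
  have K0: "K > 0" unfolding K_def using c B0 lam by (auto intro!: add_nonneg_pos divide_pos_pos)
  have cK: "c * (K / 2) = \<bar>d\<bar> + lam * B + C\<^sup>2 + 1" unfolding K_def using c by simp
  have "\<exists>\<^sub>F x in at_right 0. f 0 - K * x < f x"
  proof (rule ccontr)
    assume "\<not> ?thesis"
    then have "\<forall>\<^sub>F x in at_right 0. f x \<le> f 0 - K * x"
      by (simp add: not_frequently not_less)
    then obtain b where b: "b > 0" "\<And>x. 0 < x \<Longrightarrow> x < b \<Longrightarrow> f x \<le> f 0 - K * x"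
      unfolding eventually_at_right_field by auto
    define x0 where "x0 = min (min (b / 2) (\<delta> / 2)) L"
    have x0: "0 < x0" "x0 < b" "x0 < \<delta>" "x0 \<le> L" using b c L by (auto simp: x0_def)
    obtain x1 where x1: "0 < x1" "x1 < x0" "f 0 - K * x0 / 2 < f x1"
      using frequently_at_right_E[OF lim[of "f 0 - K * x0 / 2"] x0(1)] K0 x0 by auto
    have ln: "ln (x0 / x1) > 0" using x1 x0 by simp
    (* So small that at x1 the logarithmic term is absorbed by the linear one. *)
    define \<eta> where "\<eta> = min 1 ((K / 2 * x1) / ln (x0 / x1))"
    have \<eta>: "0 < \<eta>" "\<eta> \<le> 1" using ln K0 x1 by (auto simp: \<eta>_def)
    have "\<eta> \<le> (K / 2 * x1) / ln (x0 / x1)" by (simp add: \<eta>_def)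
    then have \<eta>ln: "\<eta> * ln (x0 / x1) \<le> K / 2 * x1" using ln by (simp add: pos_le_divide_eq)
    (* So close to 0 that at s the logarithmic term makes up for the whole descent of the line. *)
    define s where "s = min (x1 / 2) (x0 * exp (- (K * x0) / \<eta>))"
    have s: "0 < s" "s < x1" "s \<le> x0 * exp (- (K * x0) / \<eta>)" using x1 x0 by (auto simp: s_def)
    have "ln s \<le> ln (x0 * exp (- (K * x0) / \<eta>))" using s by simp
    also have "\<dots> = ln x0 + - (K * x0) / \<eta>" using x0 by (subst ln_mult) auto
    finally have "K * x0 / \<eta> \<le> ln x0 - ln s" by simp
    then have sln: "K * x0 \<le> \<eta> * (ln x0 - ln s)" using \<eta> by (simp add: pos_divide_le_eq mult.commute)
    define \<theta> where "\<theta> = (\<lambda>x. f 0 - K / 2 * x - K * x0 / 2 + \<eta> * (ln x0 - ln x))"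
    have "f x1 \<le> \<theta> x1"
    proof (rule comparison_with_supersolution[OF f, of s x0 \<theta> "\<lambda>x. - K / 2 - \<eta> / x" "\<lambda>x. \<eta> / x\<^sup>2"])
      show "0 \<le> s" "s < x0" "x0 \<le> L" "x1 \<in> {s..x0}" using s x1 x0 by auto
      show "continuous_on {s..x0} \<theta>" unfolding \<theta>_def using s by (intro continuous_intros) auto
      show "(\<theta> has_real_derivative - K / 2 - \<eta> / x) (at x)" if "x \<in> {s<..<x0}" for x
        unfolding \<theta>_def using that s by (auto intro!: derivative_eq_intros simp: field_simps)
      show "((\<lambda>x. - K / 2 - \<eta> / x) has_real_derivative \<eta> / x\<^sup>2) (at x)" if "x \<in> {s<..<x0}" for x
        using that s by (auto intro!: derivative_eq_intros simp: field_simps power2_eq_square)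
      have "K / 2 * s \<le> K / 2 * x0" using K0 s x1 by (intro mult_left_mono) auto
      moreover have "f s \<le> f 0 - K * s" using s x1 x0 by (intro b) auto
      moreover have "0 \<le> K * s" using K0 s by simp
      ultimately show "f s \<le> \<theta> s" using sln by (simp add: \<theta>_def)
      show "f x0 \<le> \<theta> x0" using b(2)[of x0] x0 by (simp add: \<theta>_def)
      fix x assume x: "x \<in> {s<..<x0}"
      then have xL: "x \<in> {0..L}" "0 < x" "x < \<delta>" using s x0 by auto
      have "\<bar>\<sigma> x\<bar> \<le> C * x" using sig[OF xL(1), of 0] s0 xL L by auto
      then have "\<bar>\<sigma> x\<bar>\<^sup>2 \<le> (C * x)\<^sup>2" by (intro power_mono) auto
      then have "(\<sigma> x)\<^sup>2 * (\<eta> / x\<^sup>2) \<le> (C * x)\<^sup>2 * (\<eta> / x\<^sup>2)" using \<eta> by (intro mult_right_mono) auto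
      also have "\<dots> = C\<^sup>2 * \<eta>" using xL by (simp add: power_mult_distrib)
      also have "\<dots> \<le> C\<^sup>2 * 1" using \<eta> by (intro mult_left_mono) auto
      finally have 1: "(\<sigma> x)\<^sup>2 * (\<eta> / x\<^sup>2) \<le> C\<^sup>2" by simp
      have "K / 2 \<le> \<bar>- K / 2 - \<eta> / x\<bar>" 
      proof -
        have "0 \<le> \<eta> / x" using \<eta> xL by simp
        then show ?thesis using K0 by linarith
      qed
      then have "c * (K / 2) \<le> c * \<bar>- K / 2 - \<eta> / x\<bar>" using c by (intro mult_left_mono) auto
      then have 2: "H x (- K / 2 - \<eta> / x) \<ge> lam * B + C\<^sup>2 + 1"
        using H[OF xL(1,3), of "- K / 2 - \<eta> / x"] cK by linarith
      have "- B \<le> f x" using B[OF xL(1)] by auto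
      then have "lam * (- B) \<le> lam * f x" using lam by (intro mult_left_mono) auto
      then show "0 < G (f x) (- K / 2 - \<eta> / x) (\<eta> / x\<^sup>2) x" using 1 2 by (simp add: G_def)
    qed
    also have "\<dots> \<le> f 0 - K * x0 / 2" using \<eta>ln x1 x0 by (simp add: \<theta>_def ln_div)
    finally show False using x1(3) by simp
  qed
  then show thesis by (rule that)
qed

section \<open>Separation of slopes at an endpoint\<close>
definition supersol :: "(real \<Rightarrow> real) \<Rightarrow> bool" where
  "supersol g \<longleftrightarrow> lsc_on {0..L} g \<and> (\<forall>x\<in>{0<..<L}. \<forall>p X.
     (\<forall>\<^sub>F y in at x. g x + p * (y - x) + X / 2 * (y - x)\<^sup>2 \<le> g y) \<longrightarrow> 0 \<le> G (g x) p X x)"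

text \<open>Negation turns supersolutions into subsolutions of the equation with \<open>- H x (- p)\<close>, which
  satisfies the same structural assumptions but is not coercive if \<open>H\<close> is.\<close>
lemma negated_edge_eq: "edge_eq L C lam \<sigma> (\<lambda>x p. - H x (- p))"
proof
  show "0 < L" "0 < C" "0 < lam" by (fact L C lam)+
  show "\<bar>\<sigma> x - \<sigma> y\<bar> \<le> C * \<bar>x - y\<bar>" if "x \<in> {0..L}" "y \<in> {0..L}" for x y using sig that .
  show "\<bar>- H x (- p) - - H y (- p)\<bar> \<le> C * (1 + \<bar>p\<bar>) * \<bar>x - y\<bar>"
    if "x \<in> {0..L}" "y \<in> {0..L}" for x y p using Hx[OF that, of "- p"] by (simp add: abs_minus_commute)
  show "\<bar>- H x (- p) - - H x (- q)\<bar> \<le> C * \<bar>p - q\<bar>" if "x \<in> {0..L}" for x p q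
    using Hp[OF that, of "- q" "- p"] by simp
qed

lemma negated_G: "edge_eq.G lam \<sigma> (\<lambda>x p. - H x (- p)) r p X x = - G (- r) (- p) (- X) x"
  unfolding edge_eq.G_def[OF negated_edge_eq] G_def by simp

lemma G_dip:
  assumes "G r p X x < 0" obtains Y where "Y < X" "G r p Y x < 0"
proof -
  interpret neg: edge_eq L C lam \<sigma> "\<lambda>x p. - H x (- p)" by (rule negated_edge_eq)
  have "neg.G (- r) (- p) (- X) x > 0" using assms by (simp add: negated_G)
  then obtain Y where "- X < Y" "neg.G (- r) (- p) Y x > 0" by (rule neg.G_bump)
  then show thesis using that[of "- Y"] by (simp add: negated_G)
qed

lemma negated_supersol:
  assumes "supersol g"
  shows "edge_eq.subsol L lam \<sigma> (\<lambda>x p. - H x (- p)) (\<lambda>x. - g x)"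
  unfolding edge_eq.subsol_def[OF negated_edge_eq] negated_G
proof (intro conjI ballI allI impI)
  show "usc_on {0..L} (\<lambda>x. - g x)" using assms unfolding supersol_def lsc_on_iff by blast
  fix x p X assume x: "x \<in> {0<..<L}"
    and "\<forall>\<^sub>F y in at x. - g y \<le> - g x + p * (y - x) + X / 2 * (y - x)\<^sup>2"
  then have "\<forall>\<^sub>F y in at x. g x + (- p) * (y - x) + (- X) / 2 * (y - x)\<^sup>2 \<le> g y"
    by (auto elim: eventually_mono)
  then have "0 \<le> G (g x) (- p) (- X) x" using assms x unfolding supersol_def by blast
  then show "- G (- (- g x)) (- p) (- X) x \<le> 0" by simp
qed

lemma strict_jet_above:
  assumes s0: "\<sigma> 0 \<noteq> 0" and A: "\<forall>\<^sub>F x in at_right 0. f x \<le> f 0 + p' * x" and pp: "p' < p"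
  obtains X where "\<forall>\<^sub>F x in at_right 0. f x \<le> f 0 + p * x + X / 2 * x\<^sup>2" "G (f 0) p X 0 > 0"
proof
  define X where "X = (lam * f 0 + H 0 p - 1) / (\<sigma> 0)\<^sup>2"
  have "(\<sigma> 0)\<^sup>2 * X = lam * f 0 + H 0 p - 1" using s0 by (simp add: X_def)
  then show "G (f 0) p X 0 > 0" by (simp add: G_def)
  show "\<forall>\<^sub>F x in at_right 0. f x \<le> f 0 + p * x + X / 2 * x\<^sup>2"
    using A slope_absorbs_curvature[OF pp, of X] by eventually_elim auto
qed

lemma slope_above_mono:
  assumes "\<forall>\<^sub>F x in at_right 0. f x \<le> f 0 + p * x" "p \<le> q"
  shows "\<forall>\<^sub>F x in at_right 0. f x \<le> f 0 + q * (x::real)"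
  using assms(1) eventually_at_right_less[of 0]
  by eventually_elim (use assms(2) in \<open>smt (verit) mult_right_mono\<close>)

text \<open>The number \<open>p0\<close> is the upper limit of the difference quotients of \<open>f\<close> at \<open>0\<close>.\<close>
lemma limsup_slope_exists:
  assumes A: "\<forall>\<^sub>F x in at_right 0. f x \<le> f 0 + P * x"
    and K: "\<And>p. \<forall>\<^sub>F x in at_right 0. f x \<le> f 0 + p * x \<Longrightarrow> K \<le> p"
  obtains p0 where "\<And>q. p0 < q \<Longrightarrow> \<forall>\<^sub>F x in at_right 0. f x \<le> f 0 + q * x"
    "\<And>q. q < p0 \<Longrightarrow> \<exists>\<^sub>F x in at_right 0. f 0 + q * x < f (x::real)" "K \<le> p0"
proof
  define S where "S = {p. \<forall>\<^sub>F x in at_right 0. f x \<le> f 0 + p * x}"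
  have S: "P \<in> S" "\<And>p. p \<in> S \<Longrightarrow> K \<le> p" using A K by (auto simp: S_def)
  have bdd: "bdd_below S" using S(2) by (auto simp: bdd_below_def)
  show "K \<le> Inf S" using S by (intro cInf_greatest) auto
  show "\<forall>\<^sub>F x in at_right 0. f x \<le> f 0 + q * x" if q: "Inf S < q" for q
  proof -
    obtain p where "p \<in> S" "p < q" using q cInf_less_iff[of S q] bdd S(1) by auto
    then show ?thesis using slope_above_mono[of f p q] by (auto simp: S_def)
  qed
  show "\<exists>\<^sub>F x in at_right 0. f 0 + q * x < f x" if q: "q < Inf S" for q
  proof -
    have "q \<notin> S" using q cInf_lower[OF _ bdd] by force
    then show ?thesis by (simp add: S_def frequently_def not_less)
  qed
qed

text \<open>
  Otherwise \<open>f\<close> and \<open>g\<close> have the same critical slope \<open>p0\<close>. Then \<open>lower_parabola\<close>, applied to \<open>f\<close> and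
  to \<open>- g\<close>, gives parabolas whose curvatures almost solve the equations at \<open>0\<close>. Their difference is
  strictly convex because \<open>g 0 < f 0\<close>, so \<open>f - g\<close> exceeds \<open>f 0 - g 0\<close>.
\<close>
lemma separating_slopes_nondegenerate:
  assumes s0: "\<sigma> 0 \<noteq> 0" and f: "subsol f" and g: "supersol g"
    and Bf: "\<And>x. x \<in> {0..L} \<Longrightarrow> \<bar>f x\<bar> \<le> B" and Bg: "\<And>x. x \<in> {0..L} \<Longrightarrow> \<bar>g x\<bar> \<le> B"
    and max: "\<And>x. x \<in> {0..L} \<Longrightarrow> f x - g x \<le> f 0 - g 0" and pos: "g 0 < f 0"
  obtains p q where "p < q" "\<forall>\<^sub>F x in at_right 0. f x \<le> f 0 + p * x"
    "\<forall>\<^sub>F x in at_right 0. g 0 + q * x \<le> g x"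
proof -
  interpret neg: edge_eq L C lam \<sigma> "\<lambda>x p. - H x (- p)" by (rule negated_edge_eq)
  note ng = negated_supersol[OF g]
  obtain P where P: "\<forall>\<^sub>F x in at_right 0. f x \<le> f 0 + P * x"
    using upper_slope[OF f Bf] s0 by blast
  obtain Q where Q: "\<forall>\<^sub>F x in at_right 0. - g x \<le> - g 0 + Q * x"
    using neg.upper_slope[OF ng, of B] Bg s0 by auto
  have "\<exists>p q. p < q \<and> (\<forall>\<^sub>F x in at_right 0. f x \<le> f 0 + p * x) \<and>
    (\<forall>\<^sub>F x in at_right 0. g 0 + q * x \<le> g x)"
  proof (rule ccontr)
    assume "\<not> ?thesis"
    then have no: "\<And>p q. \<forall>\<^sub>F x in at_right 0. f x \<le> f 0 + p * x \<Longrightarrow>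
      \<forall>\<^sub>F x in at_right 0. g 0 + q * x \<le> g x \<Longrightarrow> q \<le> p" by force
    have "\<forall>\<^sub>F x in at_right 0. g 0 + (- Q) * x \<le> g x" using Q by eventually_elim auto
    then have low: "- Q \<le> p" if "\<forall>\<^sub>F x in at_right 0. f x \<le> f 0 + p * x" for p
      by (rule no[OF that])
    obtain p0 where p0: "\<And>q. p0 < q \<Longrightarrow> \<forall>\<^sub>F x in at_right 0. f x \<le> f 0 + q * x"
      and p0f: "\<And>q. q < p0 \<Longrightarrow> \<exists>\<^sub>F x in at_right 0. f 0 + q * x < f x"
      by (rule limsup_slope_exists[OF P low]) auto
    have p0g: "\<exists>\<^sub>F x in at_right 0. - g 0 + q * x < - g x" if q: "q < - p0" for q
    proof -
      obtain r where r: "p0 < r" "r < - q" using q dense[of p0 "- q"] by auto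
      have "\<not> (\<forall>\<^sub>F x in at_right 0. g 0 + (- q) * x \<le> g x)"
        using no[OF p0[OF r(1)], of "- q"] r by auto
      then have "\<exists>\<^sub>F x in at_right 0. \<not> (g 0 + (- q) * x \<le> g x)" by (simp add: frequently_def)
      then show ?thesis by (rule frequently_elim1) auto
    qed
    (* A quarter of the gap between the two curvatures: after giving up e on each side, half of the
       gap remains. *)
    define e where "e = lam * (f 0 - g 0) / (4 * (\<sigma> 0)\<^sup>2)"
    have e: "e > 0" using pos lam s0 by (simp add: e_def)
    define X where "X = (lam * f 0 + H 0 p0) / (\<sigma> 0)\<^sup>2 - e"
    define Z where "Z = - (lam * g 0 + H 0 p0) / (\<sigma> 0)\<^sup>2 - e"
    have s2: "(\<sigma> 0)\<^sup>2 > 0" using s0 by simp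
    have "(\<sigma> 0)\<^sup>2 * X = lam * f 0 + H 0 p0 - (\<sigma> 0)\<^sup>2 * e" using s0 by (simp add: X_def right_diff_distrib)
    then have "G (f 0) p0 X 0 = (\<sigma> 0)\<^sup>2 * e" by (simp add: G_def)
    then have "G (f 0) p0 X 0 > 0" using s2 e by simp
    from lower_parabola[OF f p0f this]
    have lf: "\<forall>\<^sub>F x in at_right 0. f 0 + p0 * x + X / 2 * x\<^sup>2 \<le> f x" by blast
    have "(\<sigma> 0)\<^sup>2 * Z = - (lam * g 0 + H 0 p0) - (\<sigma> 0)\<^sup>2 * e" 
      unfolding Z_def right_diff_distrib using s0 by (simp only: times_divide_eq_right) simp
    then have "neg.G (- g 0) (- p0) Z 0 = (\<sigma> 0)\<^sup>2 * e" by (simp add: neg.G_def)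
    then have "neg.G (- g 0) (- p0) Z 0 > 0" using s2 e by simp
    from neg.lower_parabola[OF ng p0g this]
    have lg: "\<forall>\<^sub>F x in at_right 0. - g 0 + - p0 * x + Z / 2 * x\<^sup>2 \<le> - g x" by blast
    have "X + Z = 2 * e" unfolding X_def Z_def e_def using s0 by (simp add: field_simps)
    have "\<forall>\<^sub>F x in at_right 0. x < L" using L eventually_at_right_field by blast
    with lf lg eventually_at_right_less[of 0] have "\<forall>\<^sub>F x::real in at_right 0. False"
    proof eventually_elim
      case (elim x)
      then have "f 0 - g 0 + (X + Z) / 2 * x\<^sup>2 \<le> f x - g x" by (simp add: algebra_simps add_divide_distrib)
      moreover have "(X + Z) / 2 * x\<^sup>2 > 0" using \<open>X + Z = 2 * e\<close> e elim by simp
      ultimately show False using max[of x] elim by simp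
    qed
    then show False by simp
  qed
  then show thesis using that by blast
qed

text \<open>
  Here \<open>S\<close> stands for the set of slopes of lines below \<open>g\<close>, and its supremum is the smallest slope of
  \<open>g\<close>. The function \<open>H 0\<close> is at most \<open>- lam * f0\<close> at \<open>p0\<close> and at least \<open>- lam * g0\<close> at the supremum of
  \<open>S\<close>, or at a large slope if \<open>S\<close> is unbounded; so in between it takes the mean of these two values.
\<close>
lemma coercive_intermediate_slope:
  assumes co: "coercive" and p0: "lam * f0 + H 0 p0 \<le> 0" and pos: "g0 < f0"
    and p1: "\<And>q. q < p0 \<Longrightarrow> q \<in> S" and down: "\<And>q r. q \<in> S \<Longrightarrow> r \<le> q \<Longrightarrow> r \<in> S"
    and crit: "bdd_above S \<Longrightarrow> 0 \<le> lam * g0 + H 0 (Sup S)"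
  obtains p q where "p0 < p" "p < q" "q \<in> S" "lam * f0 + H 0 p > 0" "lam * g0 + H 0 q < 0"
proof -
  have z: "(0::real) \<in> {0..L}" using L by auto
  have "\<exists>p1>p0. (\<forall>q<p1. q \<in> S) \<and> 0 \<le> lam * g0 + H 0 p1"
  proof (cases "bdd_above S")
    case True
    have ne: "S \<noteq> {}" using p1[of "p0 - 1"] by auto
    have S: "q \<in> S" if "q < Sup S" for q
      using that less_cSup_iff[OF ne True] down by (meson less_imp_le)
    have "q \<le> Sup S" if "q < p0" for q using cSup_upper[OF p1[OF that] True] .
    then have "p0 \<le> Sup S" by (rule dense_le)
    moreover have "lam * g0 < lam * f0" using pos lam by simp
    then have "p0 \<noteq> Sup S" using crit[OF True] p0 by auto
    ultimately show ?thesis using S crit[OF True] by (intro exI[of _ "Sup S"]) auto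
  next
    case False
    then have S: "q \<in> S" for q using down unfolding bdd_above_def by (meson linear)
    obtain c d where c: "c > 0" "\<And>p. c * \<bar>p\<bar> - d \<le> H 0 p" using co z unfolding coercive_def by blast
    define p1 where "p1 = max (p0 + 1) (\<bar>d - lam * g0\<bar> / c)"
    have "\<bar>d - lam * g0\<bar> / c \<le> p1" by (simp add: p1_def)
    then have "\<bar>d - lam * g0\<bar> / c \<le> \<bar>p1\<bar>" by linarith
    then have "\<bar>d - lam * g0\<bar> \<le> c * \<bar>p1\<bar>" using c by (simp add: pos_divide_le_eq mult.commute)
    then have "0 \<le> lam * g0 + H 0 p1" using c(2)[of p1] by linarith
    then show ?thesis using S by (intro exI[of _ p1]) (auto simp: p1_def)
  qed
  then obtain p1 where p1: "p0 < p1" "\<And>q. q < p1 \<Longrightarrow> q \<in> S" "0 \<le> lam * g0 + H 0 p1" by blast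
  define m where "m = - lam * (f0 + g0) / 2"
  define k where "k = lam * (f0 - g0) / 2"
  have k: "k > 0" using pos lam by (simp add: k_def)
  have mk: "- lam * f0 = m - k" "- lam * g0 = m + k" by (auto simp: m_def k_def field_simps)
  have lip: "C-lipschitz_on UNIV (H 0)"
    using Hp[OF z] C by (intro lipschitz_onI) (auto simp: dist_real_def)
  have "\<exists>x\<ge>p0. x \<le> p1 \<and> H 0 x = m"
    using p0 p1 mk k by (intro IVT' continuous_on_subset[OF lipschitz_on_continuous_on[OF lip]]) auto
  then obtain x where x: "p0 \<le> x" "x \<le> p1" "H 0 x = m" by blast
  have x1: "p0 < x" "x < p1" using x p0 p1 mk k by (auto simp: less_le)
  define e where "e = min (min ((x - p0) / 2) ((p1 - x) / 2)) (k / (2 * C))"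
  have "e > 0" "e \<le> (x - p0) / 2" "e \<le> (p1 - x) / 2" "e \<le> k / (2 * C)"
    unfolding e_def using x1 k C by (simp_all only: min.bounded_iff min_less_iff_conj) auto
  then have e: "e > 0" "e < x - p0" "e < p1 - x" "e \<le> k / (2 * C)" using x1 by auto
  have Ce: "C * e < k"
  proof -
    have "C * e \<le> C * (k / (2 * C))" using e C by (intro mult_left_mono) auto
    then show ?thesis using C k by simp
  qed
  show thesis
  proof
    show "p0 < x - e" "x - e < x + e" "x + e \<in> S" using e p1 by auto
    have "\<bar>H 0 (x - e) - H 0 x\<bar> \<le> C * e" using Hp[OF z, of "x - e" x] e by simp
    then show "lam * f0 + H 0 (x - e) > 0" using x(3) mk Ce by simp
    have "\<bar>H 0 (x + e) - H 0 x\<bar> \<le> C * e" using Hp[OF z, of "x + e" x] e by simp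
    then show "lam * g0 + H 0 (x + e) < 0" using x(3) mk Ce by simp
  qed
qed

text \<open>
  The only point not covered by the previous lemmas is that all slopes below \<open>p0\<close> belong to lines
  below \<open>g\<close>. If \<open>q < p0\<close> did not, then every line of slope \<open>c\<close> between \<open>q\<close> and \<open>p0\<close> would be crossed by
  \<open>g\<close> infinitely often near \<open>0\<close>: from below since \<open>g - g 0 \<ge> f - f 0\<close>, from above by the choice of \<open>q\<close>.
  If \<open>lam * g 0 + H 0 c\<close> were negative, \<open>lower_parabola\<close> for \<open>- g\<close> with zero curvature would keep \<open>g\<close>
  below this line; so it is nonnegative, and letting \<open>c\<close> tend to \<open>p0\<close> contradicts
  \<open>lam * f 0 + H 0 p0 \<le> 0\<close> because \<open>g 0 < f 0\<close>.
\<close>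
lemma separating_slopes_degenerate:
  assumes s0: "\<sigma> 0 = 0" and co: "coercive" and f: "subsol f" and g: "supersol g"
    and Bf: "\<And>x. x \<in> {0..L} \<Longrightarrow> \<bar>f x\<bar> \<le> B"
    and K: "\<exists>\<^sub>F x in at_right 0. f 0 - K * x < f x"
    and max: "\<And>x. x \<in> {0..L} \<Longrightarrow> f x - g x \<le> f 0 - g 0" and pos: "g 0 < f 0"
  obtains p q where "p < q" "\<forall>\<^sub>F x in at_right 0. f x \<le> f 0 + p * x"
    "\<forall>\<^sub>F x in at_right 0. g 0 + q * x \<le> g x" "lam * f 0 + H 0 p > 0" "lam * g 0 + H 0 q < 0"
proof -
  interpret neg: edge_eq L C lam \<sigma> "\<lambda>x p. - H x (- p)" by (rule negated_edge_eq)
  note ng = negated_supersol[OF g]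
  have z: "(0::real) \<in> {0..L}" using L by auto
  have near: "\<forall>\<^sub>F x in at_right 0. 0 < x \<and> x \<in> {0..L}"
    unfolding eventually_at_right_field using L by (intro exI[of _ L]) auto
  obtain P where P: "\<forall>\<^sub>F x in at_right 0. f x \<le> f 0 + P * x"
    using upper_slope[OF f Bf] co by blast
  have lowK: "- K \<le> p" if p: "\<forall>\<^sub>F x in at_right 0. f x \<le> f 0 + p * x" for p
  proof (rule ccontr)
    assume "\<not> - K \<le> p"
    then have "\<forall>\<^sub>F x in at_right 0. f x \<le> f 0 + (- K) * x" 
      by (intro slope_above_mono[OF p]) simp
    then show False using K by (simp add: frequently_def not_less)
  qed
  obtain p0 where p0: "\<And>q. p0 < q \<Longrightarrow> \<forall>\<^sub>F x in at_right 0. f x \<le> f 0 + q * x"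
      and p0f: "\<And>q. q < p0 \<Longrightarrow> \<exists>\<^sub>F x in at_right 0. f 0 + q * x < f x"
    by (rule limsup_slope_exists[OF P lowK]) auto
  have crit: "lam * f 0 + H 0 p0 \<le> 0" by (rule limsup_slope_critical[OF f s0 p0 p0f])
  define S where "S = {q. \<forall>\<^sub>F x in at_right 0. g 0 + q * x \<le> g x}"
  have down: "r \<in> S" if "q \<in> S" "r \<le> q" for q r
  proof -
    have "\<forall>\<^sub>F x in at_right 0. - g x \<le> - g 0 + (- q) * x"
      using that(1) unfolding S_def by (auto elim: eventually_mono)
    then have "\<forall>\<^sub>F x in at_right 0. - g x \<le> - g 0 + (- r) * x"
      using slope_above_mono[of "\<lambda>x. - g x" "- q" "- r"] that(2) by simp
    then show ?thesis unfolding S_def by (auto elim: eventually_mono)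
  qed
  have gfreq: "\<exists>\<^sub>F x in at_right 0. g 0 + q * x < g x" if "q < p0" for q
    using p0f[OF that] near
  proof (rule frequently_conj_eventually)
    fix x assume x: "f 0 + q * x < f x" "0 < x \<and> x \<in> {0..L}"
    then show "g 0 + q * x < g x" using max[of x] by simp
  qed
  have below: "q \<in> S" if q: "q < p0" for q
  proof (rule ccontr)
    assume "q \<notin> S"
    have ge: "lam * g 0 + H 0 c \<ge> 0" if c: "q < c" "c < p0" for c
    proof (rule ccontr)
      assume "\<not> ?thesis"
      then have "neg.G (- g 0) (- c) 0 0 > 0" by (simp add: neg.G_def)
      moreover have "\<exists>\<^sub>F x in at_right 0. - g 0 + r * x < - g x" if r: "r < - c" for r
      proof -
        have "- r \<notin> S" using \<open>q \<notin> S\<close> down[of "- r" q] r c by force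
        then have "\<exists>\<^sub>F x in at_right 0. \<not> (g 0 + (- r) * x \<le> g x)" by (simp add: S_def frequently_def)
        then show ?thesis by (rule frequently_elim1) auto
      qed
      ultimately have ev: "\<forall>\<^sub>F x in at_right 0. - g 0 + - c * x + 0 / 2 * x\<^sup>2 \<le> - g x"
        using neg.lower_parabola[OF ng, of "- c" 0] by blast
      then have "\<forall>\<^sub>F x in at_right 0. \<not> (g 0 + c * x < g x)" by eventually_elim auto
      then show False using gfreq[OF c(2)] by (simp add: frequently_def)
    qed
    have lt: "lam * g 0 + H 0 p0 < 0" using crit pos mult_strict_left_mono[OF pos lam] by linarith
    define e where "e = min ((p0 - q) / 2) (- (lam * g 0 + H 0 p0) / (2 * C))"
    have "e > 0" "e \<le> (p0 - q) / 2" and e2: "e \<le> - (lam * g 0 + H 0 p0) / (2 * C)"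
      unfolding e_def using q lt C by (simp_all only: min.bounded_iff min_less_iff_conj) (auto simp: divide_neg_pos)
    then have e: "e > 0" "e < p0 - q" using q by auto
    have "e * (2 * C) \<le> - (lam * g 0 + H 0 p0)" using e2 C by (simp add: pos_le_divide_eq)
    then have "C * e < - (lam * g 0 + H 0 p0)" using lt by (simp add: algebra_simps)
    moreover have "\<bar>H 0 (p0 - e) - H 0 p0\<bar> \<le> C * e" using Hp[OF z, of "p0 - e" p0] e by simp
    ultimately show False using ge[of "p0 - e"] e by simp
  qed
  have critg: "0 \<le> lam * g 0 + H 0 (Sup S)" if bdd: "bdd_above S"
  proof -
    have ne: "S \<noteq> {}" using below[of "p0 - 1"] by auto
    have "lam * (- g 0) + - H 0 (- (- Sup S)) \<le> 0"
    proof (rule neg.limsup_slope_critical[OF ng s0])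
      fix q assume "- Sup S < q"
      then have "- q < Sup S" by simp
      then have "- q \<in> S" using less_cSup_iff[OF ne bdd] down by (meson less_imp_le)
      then show "\<forall>\<^sub>F x in at_right 0. - g x \<le> - g 0 + q * x"
        unfolding S_def by (auto elim: eventually_mono)
    next
      fix q assume "q < - Sup S"
      then have "- q \<notin> S" using cSup_upper[OF _ bdd] by force
      then have "\<exists>\<^sub>F x in at_right 0. \<not> (g 0 + (- q) * x \<le> g x)" by (simp add: S_def frequently_def)
      then show "\<exists>\<^sub>F x in at_right 0. - g 0 + q * x < - g x" by (rule frequently_elim1) auto
    qed
    then show ?thesis by simp
  qed
  from coercive_intermediate_slope[OF co crit pos below down critg]
  obtain p q where "p0 < p" "p < q" "q \<in> S" "lam * f 0 + H 0 p > 0" "lam * g 0 + H 0 q < 0" .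
  then show thesis using that p0 unfolding S_def by blast
qed

text \<open>
  The strict violation of the equation by both jets is what excludes the alternative \<open>G \<le> 0\<close>, resp.
  \<open>G \<ge> 0\<close>, in the definition of viscosity solutions at a vertex.
\<close>
lemma separating_jets:
  assumes f: "subsol f" and g: "supersol g"
    and Bf: "\<And>x. x \<in> {0..L} \<Longrightarrow> \<bar>f x\<bar> \<le> B" and Bg: "\<And>x. x \<in> {0..L} \<Longrightarrow> \<bar>g x\<bar> \<le> B"
    and max: "\<And>x. x \<in> {0..L} \<Longrightarrow> f x - g x \<le> f 0 - g 0" and pos: "g 0 < f 0"
    and nd: "\<sigma> 0 \<noteq> 0 \<or> coercive \<and> (\<exists>K. \<exists>\<^sub>F x in at_right 0. f 0 - K * x < f x)"
  obtains p q X Y where "p < q"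
    "\<forall>\<^sub>F x in at_right 0. f x \<le> f 0 + p * x + X / 2 * x\<^sup>2" "G (f 0) p X 0 > 0"
    "\<forall>\<^sub>F x in at_right 0. g 0 + q * x + Y / 2 * x\<^sup>2 \<le> g x" "G (g 0) q Y 0 < 0"
proof (cases "\<sigma> 0 = 0")
  case True
  then obtain K where co: "coercive" and K: "\<exists>\<^sub>F x in at_right 0. f 0 - K * x < f x" using nd by blast
  from separating_slopes_degenerate[OF True co f g Bf K max pos]
  obtain p q where "p < q" "\<forall>\<^sub>F x in at_right 0. f x \<le> f 0 + p * x"
    "\<forall>\<^sub>F x in at_right 0. g 0 + q * x \<le> g x" "lam * f 0 + H 0 p > 0" "lam * g 0 + H 0 q < 0" .
  then show thesis using that[of p q 0 0] by (simp add: G_def)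
next
  case False
  interpret neg: edge_eq L C lam \<sigma> "\<lambda>x p. - H x (- p)" by (rule negated_edge_eq)
  from separating_slopes_nondegenerate[OF False f g Bf Bg max pos]
  obtain p q where pq: "p < q" and p: "\<forall>\<^sub>F x in at_right 0. f x \<le> f 0 + p * x"
    and q: "\<forall>\<^sub>F x in at_right 0. g 0 + q * x \<le> g x" .
  define r where "r = (q - p) / 3"
  have r: "r > 0" "p + r < q - r" using pq by (auto simp: r_def field_simps)
  obtain X where X: "\<forall>\<^sub>F x in at_right 0. f x \<le> f 0 + (p + r) * x + X / 2 * x\<^sup>2"
      "G (f 0) (p + r) X 0 > 0"
    using strict_jet_above[OF False p, of "p + r"] r by auto
  have "\<forall>\<^sub>F x in at_right 0. - g x \<le> - g 0 + (- q) * x" using q by eventually_elim auto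
  from neg.strict_jet_above[OF False this, of "- q + r"] r
  obtain Y where Y: "\<forall>\<^sub>F x in at_right 0. - g x \<le> - g 0 + (- q + r) * x + Y / 2 * x\<^sup>2"
      "neg.G (- g 0) (- q + r) Y 0 > 0"
    by auto
  show thesis
  proof (rule that[OF r(2) X])
    show "G (g 0) (q - r) (- Y) 0 < 0" using Y(2) unfolding negated_G by simp
    show "\<forall>\<^sub>F x in at_right 0. g 0 + (q - r) * x + (- Y) / 2 * x\<^sup>2 \<le> g x"
      using Y(1) by eventually_elim (simp add: algebra_simps)
  qed
qed

section \<open>No maximum inside an edge\<close>

text \<open>
  If the second difference at distance \<open>s\<close> were smaller than \<open>A * s\<^sup>2\<close>, a parabola with second
  derivative \<open>A\<close> could be put above \<open>f\<close> at \<open>x0 - s\<close> and \<open>x0 + s\<close> but below \<open>f\<close> at \<open>x0\<close>. The parabola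
  touching \<open>f\<close> from above at \<open>x0\<close> keeps its slope close to \<open>p\<close>, so that it is a supersolution.
\<close>
lemma second_difference_pos:
  assumes f: "subsol f" and x0: "x0 \<in> {0<..<L}"
    and touch: "\<forall>\<^sub>F y in at x0. f y \<le> f x0 + p * (y - x0) + Q / 2 * (y - x0)\<^sup>2"
    and pos: "G (f x0) p A x0 > 0"
  obtains \<delta> where "0 < \<delta>" "\<And>s. 0 < s \<Longrightarrow> s < \<delta> \<Longrightarrow> A * s\<^sup>2 \<le> f (x0 + s) + f (x0 - s) - 2 * f x0"
proof -
  obtain d where d: "d > 0" "\<And>y. y \<noteq> x0 \<Longrightarrow> \<bar>y - x0\<bar> < d \<Longrightarrow> f y \<le> f x0 + p * (y - x0) + Q / 2 * (y - x0)\<^sup>2"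
    using touch unfolding eventually_at dist_real_def by auto
  have "x0 \<in> {0..L}" using x0 by auto
  from G_open[OF this pos] obtain \<eta> where \<eta>: "\<eta> > 0" and
    G: "\<And>x r q. x \<in> {0..L} \<Longrightarrow> \<bar>x - x0\<bar> < \<eta> \<Longrightarrow> \<bar>r - f x0\<bar> < \<eta> \<Longrightarrow> \<bar>q - p\<bar> < \<eta> \<Longrightarrow> G r q A x > 0"
    by metis
  define B where "B = \<bar>Q\<bar> / 2 + \<bar>A\<bar> + 1"
  define R where "R = 2 * B + \<bar>A\<bar> + \<bar>p\<bar>"
  have R: "R \<ge> 1" and B0: "B > 0" unfolding R_def B_def by auto
  define \<delta> where "\<delta> = min (min 1 d) (min (min x0 (L - x0)) (\<eta> / R))"
  have \<delta>: "0 < \<delta>" "\<delta> \<le> 1" "\<delta> \<le> d" "\<delta> \<le> x0" "\<delta> \<le> L - x0" "\<delta> \<le> \<eta> / R"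
    unfolding \<delta>_def using d x0 \<eta> R by (simp_all only: min.bounded_iff min_less_iff_conj) auto
  show thesis
  proof (rule that[OF \<delta>(1)], rule ccontr)
    fix s assume s: "0 < s" "s < \<delta>" and "\<not> A * s\<^sup>2 \<le> f (x0 + s) + f (x0 - s) - 2 * f x0"
    then have neg: "f (x0 + s) + f (x0 - s) - 2 * f x0 < A * s\<^sup>2" by simp
    have s2: "s\<^sup>2 > 0" using s by simp
    have Rs: "R * s < \<eta>"
    proof -
      have "s < \<eta> / R" using s \<delta> by linarith
      then show ?thesis using R by (simp add: pos_less_divide_eq mult.commute)
    qed
    define dp where "dp = (f (x0 + s) - f x0 - p * s) / s\<^sup>2"
    define dm where "dm = (f (x0 - s) - f x0 + p * s) / s\<^sup>2"
    have dps: "dp * s\<^sup>2 = f (x0 + s) - f x0 - p * s" and dms: "dm * s\<^sup>2 = f (x0 - s) - f x0 + p * s"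
      using s by (auto simp: dp_def dm_def)
    have "dp * s\<^sup>2 \<le> Q / 2 * s\<^sup>2" unfolding dps using d(2)[of "x0 + s"] s \<delta> by auto
    then have dp: "dp \<le> Q / 2" by (rule mult_right_le_imp_le) (rule s2)
    have "dm * s\<^sup>2 \<le> Q / 2 * s\<^sup>2" unfolding dms using d(2)[of "x0 - s"] s \<delta> by auto
    then have dm: "dm \<le> Q / 2" by (rule mult_right_le_imp_le) (rule s2)
    have "(dp + dm) * s\<^sup>2 < A * s\<^sup>2" unfolding distrib_right dps dms using neg by simp
    then have dpm: "dp + dm < A" using s2 by simp
    (* There is no lower bound for f near x0. Cutting off at - B keeps the slope of the parabola under
       control, and B is so large that kp + km < A remains true. *)
    define kp where "kp = max dp (- B)"
    define km where "km = max dm (- B)"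
    have k: "dp \<le> kp" "dm \<le> km" "\<bar>kp\<bar> \<le> B" "\<bar>km\<bar> \<le> B" "kp + km < A"
      using dp dm dpm by (auto simp: kp_def km_def B_def max_def)
    define r where "r = f x0 + (kp + km - A) / 2 * s\<^sup>2"
    define p' where "p' = p + (kp - km) / 2 * s"
    have end1: "r + p' * s + A / 2 * s\<^sup>2 = f x0 + p * s + kp * s\<^sup>2"
      by (simp add: r_def p'_def power2_eq_square field_simps)
    have end2: "r - p' * s + A / 2 * s\<^sup>2 = f x0 - p * s + km * s\<^sup>2"
      by (simp add: r_def p'_def power2_eq_square field_simps)
    have "f x0 \<le> r + p' * (x0 - x0) + A / 2 * (x0 - x0)\<^sup>2"
    proof (rule comparison_with_parabola[OF f, of "x0 - s" "x0 + s"])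
      show "0 \<le> x0 - s" "x0 - s < x0 + s" "x0 + s \<le> L" "x0 \<in> {x0 - s..x0 + s}" using s \<delta> by auto
      have "dm * s\<^sup>2 \<le> km * s\<^sup>2" "dp * s\<^sup>2 \<le> kp * s\<^sup>2" using k s2 by auto
      then show "f (x0 - s) \<le> r + p' * (x0 - s - x0) + A / 2 * (x0 - s - x0)\<^sup>2"
        "f (x0 + s) \<le> r + p' * (x0 + s - x0) + A / 2 * (x0 + s - x0)\<^sup>2"
        using end1 end2 dms dps by auto
      fix x assume x: "x \<in> {x0 - s<..<x0 + s}"
      have xs: "\<bar>x - x0\<bar> \<le> s" using x by auto
      have xL: "x \<in> {0..L}" using x s \<delta> by auto
      have s1: "s\<^sup>2 \<le> s" using s \<delta> by (simp add: power2_eq_square mult_left_le)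
      have a1: "\<bar>(kp + km - A) / 2 * s\<^sup>2\<bar> \<le> (B + \<bar>A\<bar> / 2) * s"
        unfolding abs_mult using k s1 s by (intro mult_mono) auto
      have a2: "\<bar>A / 2 * (x - x0)\<^sup>2\<bar> \<le> \<bar>A\<bar> / 2 * s"
      proof -
        have "(x - x0)\<^sup>2 \<le> s\<^sup>2" using power_mono[OF xs abs_ge_zero, of 2] by simp
        then show ?thesis unfolding abs_mult using s1 by (intro mult_mono) auto
      qed
      have a3: "\<bar>p' - p\<bar> \<le> B * s" unfolding p'_def using k s by (simp add: abs_mult mult_right_mono)
      have "B * s \<le> B" using s \<delta> B0 by (simp add: mult_left_le)
      then have "\<bar>p'\<bar> \<le> \<bar>p\<bar> + B" using a3 by linarith
      then have a4: "\<bar>p' * (x - x0)\<bar> \<le> (\<bar>p\<bar> + B) * s" unfolding abs_mult using xs B0 by (intro mult_mono) auto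
      have a5: "\<bar>A * (x - x0)\<bar> \<le> \<bar>A\<bar> * s" unfolding abs_mult using xs by (intro mult_left_mono) auto
      have "\<bar>r + p' * (x - x0) + A / 2 * (x - x0)\<^sup>2 - f x0\<bar> \<le> (B + \<bar>A\<bar> / 2) * s + (\<bar>p\<bar> + B) * s + \<bar>A\<bar> / 2 * s"
        unfolding r_def using a1 a2 a4 by linarith
      also have "\<dots> = R * s" by (simp add: R_def algebra_simps)
      finally have b1: "\<bar>r + p' * (x - x0) + A / 2 * (x - x0)\<^sup>2 - f x0\<bar> < \<eta>" using Rs by linarith
      have "\<bar>p' + A * (x - x0) - p\<bar> \<le> B * s + \<bar>A\<bar> * s" using a3 a5 by linarith
      also have "\<dots> \<le> R * s" using s B0 by (simp add: R_def algebra_simps)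
      finally have b2: "\<bar>p' + A * (x - x0) - p\<bar> < \<eta>" using Rs by linarith
      have "1 * s \<le> R * s" using R s by (intro mult_right_mono) auto
      then have b3: "\<bar>x - x0\<bar> < \<eta>" using xs Rs by linarith
      show "0 \<le> G (r + p' * (x - x0) + A / 2 * (x - x0)\<^sup>2) (p' + A * (x - x0)) A x"
        using G[OF xL b3 b1 b2] by simp
    qed
    moreover have "(kp + km - A) / 2 * s\<^sup>2 < 0" using k(5) s2 by (intro mult_neg_pos) auto
    ultimately show False by (simp add: r_def)
  qed
qed

text \<open>
  With step \<open>\<sigma> x0 * r\<close> the second order coefficient drops out of the estimate; this also covers the
  degenerate case, where the step is \<open>0\<close> and the test function gives \<open>lam * f x0 + H x0 p \<le> 0\<close>.
\<close>
lemma second_difference: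
  assumes f: "subsol f" and x0: "x0 \<in> {0<..<L}"
    and touch: "\<forall>\<^sub>F y in at x0. f y \<le> f x0 + p * (y - x0) + Q / 2 * (y - x0)\<^sup>2"
    and e: "e > 0"
  shows "\<forall>\<^sub>F r in at_right 0. (lam * f x0 + H x0 p - e) * r\<^sup>2
     \<le> f (x0 + \<sigma> x0 * r) + f (x0 - \<sigma> x0 * r) - 2 * f x0"
proof (cases "\<sigma> x0 = 0")
  case True
  have "G (f x0) p Q x0 \<le> 0" using f x0 touch unfolding subsol_def by blast
  then have "lam * f x0 + H x0 p - e \<le> 0" using True e by (simp add: G_def)
  then have "(lam * f x0 + H x0 p - e) * r\<^sup>2 \<le> 0" for r by (simp add: mult_nonpos_nonneg)
  then show ?thesis using True by simp
next
  case False
  define A where "A = (lam * f x0 + H x0 p - e) / (\<sigma> x0)\<^sup>2"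
  have A: "(\<sigma> x0)\<^sup>2 * A = lam * f x0 + H x0 p - e" using False by (simp add: A_def)
  then have "G (f x0) p A x0 > 0" using e by (simp add: G_def)
  from second_difference_pos[OF f x0 touch this] obtain \<delta> where \<delta>: "0 < \<delta>"
    "\<And>s. 0 < s \<Longrightarrow> s < \<delta> \<Longrightarrow> A * s\<^sup>2 \<le> f (x0 + s) + f (x0 - s) - 2 * f x0" by metis
  have "(lam * f x0 + H x0 p - e) * r\<^sup>2 \<le> f (x0 + \<sigma> x0 * r) + f (x0 - \<sigma> x0 * r) - 2 * f x0"
    if r: "0 < r" "r < \<delta> / \<bar>\<sigma> x0\<bar>" for r
  proof -
    have s: "0 < \<bar>\<sigma> x0\<bar> * r" "\<bar>\<sigma> x0\<bar> * r < \<delta>" using r False by (auto simp: pos_less_divide_eq mult.commute)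
    have "(lam * f x0 + H x0 p - e) * r\<^sup>2 = A * (\<bar>\<sigma> x0\<bar> * r)\<^sup>2"
      unfolding A[symmetric] by (simp add: power_mult_distrib)
    also have "\<dots> \<le> f (x0 + \<bar>\<sigma> x0\<bar> * r) + f (x0 - \<bar>\<sigma> x0\<bar> * r) - 2 * f x0" by (rule \<delta>(2)[OF s])
    also have "\<dots> = f (x0 + \<sigma> x0 * r) + f (x0 - \<sigma> x0 * r) - 2 * f x0" by (cases "\<sigma> x0 \<ge> 0") auto
    finally show ?thesis .
  qed
  then show ?thesis unfolding eventually_at_right_field
    using \<delta>(1) False by (intro exI[of _ "\<delta> / \<bar>\<sigma> x0\<bar>"]) auto
qed

lemma no_interior_maximum:
  assumes f: "subsol f" and g: "supersol g" and x0: "x0 \<in> {0<..<L}"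
    and max: "\<And>x. x \<in> {0..L} \<Longrightarrow> f x - g x \<le> f x0 - g x0"
  shows "f x0 \<le> g x0"
proof (rule ccontr)
  assume neg0: "\<not> f x0 \<le> g x0"
  define M where "M = f x0 - g x0"
  have M: "M > 0" using neg0 by (simp add: M_def)
  interpret neg: edge_eq L C lam \<sigma> "\<lambda>x p. - H x (- p)" by (rule negated_edge_eq)
  define \<rho> where "\<rho> = min x0 (L - x0) / 2"
  have \<rho>: "\<rho> > 0" "\<rho> < x0" "\<rho> < L - x0" using x0 by (auto simp: \<rho>_def)
  define I where "I = {x0 - \<rho>..x0 + \<rho>}"
  have I: "x0 \<in> I" "I \<subseteq> {0..L}" "compact I" using \<rho> by (auto simp: I_def)
  define s where "s = \<bar>\<sigma> 0\<bar> + C * L"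
  have s: "(\<sigma> x)\<^sup>2 \<le> s\<^sup>2" if "x \<in> {0..L}" for x
  proof -
    have "C * \<bar>x - 0\<bar> \<le> C * L" using that C by auto
    then have "\<bar>\<sigma> x\<bar> \<le> s" using sig[OF that, of 0] L by (simp add: s_def)
    from power_mono[OF this abs_ge_zero, of 2] show ?thesis by simp
  qed
  define k where "k = lam * M"
  have k: "k > 0" using lam M by (simp add: k_def)
  define T where "T = C * L + s\<^sup>2 + 1"
  have T: "T > 0" using C L by (simp add: T_def add_nonneg_pos)
  (* Unlike (x - x0)^4, the localizing term \<mu> * (x - x0)^2 has a second derivative that does not
     vanish at x0; the choice of \<mu> makes its total contribution at most k / 4. *)
  define \<mu> where "\<mu> = k / (8 * T)"
  have \<mu>: "\<mu> > 0" using k T by (simp add: \<mu>_def)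
  have \<mu>T: "2 * \<mu> * T = k / 4" using T by (simp add: \<mu>_def)
  define \<eta> where "\<eta> = min (min (k / (16 * (C + C\<^sup>2))) (\<mu> * (\<rho> / 2)\<^sup>2)) (min (\<rho> / 2) (k / (8 * C)))"
  have \<eta>: "0 < \<eta>" "\<eta> \<le> k / (16 * (C + C\<^sup>2))" "\<eta> \<le> \<mu> * (\<rho> / 2)\<^sup>2" "\<eta> \<le> \<rho> / 2" "\<eta> \<le> k / (8 * C)"
    unfolding \<eta>_def using k C \<mu> \<rho>
    by (simp_all only: min.bounded_iff min_less_iff_conj) (auto intro!: divide_pos_pos mult_pos_pos add_pos_pos)
  have "usc_on I f" using f I unfolding subsol_def by (auto elim: usc_on_subset)
  moreover have "lsc_on I g" using g I unfolding supersol_def lsc_on_iff by (auto elim: usc_on_subset)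
  ultimately obtain \<epsilon> x y where \<epsilon>: "0 < \<epsilon>" and xy: "x \<in> I" "y \<in> I"
    and mx: "\<And>x' y'. x' \<in> I \<Longrightarrow> y' \<in> I \<Longrightarrow>
       f x' - g y' - (x' - y')\<^sup>2 / (2 * \<epsilon>) - \<mu> * (x' - x0)\<^sup>2
       \<le> f x - g y - (x - y)\<^sup>2 / (2 * \<epsilon>) - \<mu> * (x - x0)\<^sup>2"
    and close: "\<bar>x - y\<bar> < \<eta>" "(x - y)\<^sup>2 / (2 * \<epsilon>) + \<mu> * (x - x0)\<^sup>2 < \<eta>"
    and ge: "f x0 - g x0 \<le> f x - g y - \<mu> * (x - x0)\<^sup>2"
  proof (rule doubling_penalization[OF I(3) _ _ I(1) _ \<eta>(1), of f g \<mu>])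
    show "f x - g x \<le> f x0 - g x0" if "x \<in> I" for x using max that I by blast
  qed (use \<mu> in auto)
  have pen: "0 \<le> \<mu> * (x - x0)\<^sup>2" "0 \<le> (x - y)\<^sup>2 / (2 * \<epsilon>)" using \<mu> \<epsilon> by auto
  have "\<mu> * (x - x0)\<^sup>2 < \<mu> * (\<rho> / 2)\<^sup>2" using close(2) pen \<eta>(3) by linarith
  then have "(x - x0)\<^sup>2 < (\<rho> / 2)\<^sup>2" using \<mu> by simp
  then have xx0: "\<bar>x - x0\<bar> < \<rho> / 2" using \<rho> by (intro power2_less_imp_less[of "\<bar>x - x0\<bar>" "\<rho> / 2"]) auto
  have yx0: "\<bar>y - x0\<bar> < \<rho>" using xx0 close(1) \<eta>(4) by linarith
  have xr: "\<bar>x - x0\<bar> < \<rho>" using xx0 \<rho> by linarith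
  have inL: "x \<in> {0<..<L}" "y \<in> {0<..<L}" using xr yx0 \<rho> by (auto simp: abs_less_iff)
  then have inL': "x \<in> {0..L}" "y \<in> {0..L}" by auto
  have nearI: "\<forall>\<^sub>F z in at x. z \<in> I" "\<forall>\<^sub>F z in at y. z \<in> I"
  proof -
    have "x \<in> {x0 - \<rho><..<x0 + \<rho>}" "y \<in> {x0 - \<rho><..<x0 + \<rho>}" using xr yx0 by (auto simp: abs_less_iff)
    then have "\<forall>\<^sub>F z in at x. z \<in> {x0 - \<rho><..<x0 + \<rho>}" "\<forall>\<^sub>F z in at y. z \<in> {x0 - \<rho><..<x0 + \<rho>}"
      using eventually_at_in_open'[OF open_greaterThanLessThan] by blast+
    then show "\<forall>\<^sub>F z in at x. z \<in> I" "\<forall>\<^sub>F z in at y. z \<in> I"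
      by (auto simp: I_def elim!: eventually_mono)
  qed
  define p where "p = (x - y) / \<epsilon>"
  have p: "p * \<epsilon> = x - y" using \<epsilon> by (simp add: p_def)
  have touchf: "\<forall>\<^sub>F z in at x. f z \<le> f x + (p + 2 * \<mu> * (x - x0)) * (z - x) + (1 / \<epsilon> + 2 * \<mu>) / 2 * (z - x)\<^sup>2"
    using nearI(1)
  proof eventually_elim
    case (elim z)
    have "(z - y)\<^sup>2 / (2 * \<epsilon>) - (x - y)\<^sup>2 / (2 * \<epsilon>) = p * (z - x) + 1 / \<epsilon> / 2 * (z - x)\<^sup>2"
      unfolding p_def using \<epsilon> by (simp add: field_simps power2_eq_square)
    moreover have "\<mu> * (z - x0)\<^sup>2 - \<mu> * (x - x0)\<^sup>2 = 2 * \<mu> * (x - x0) * (z - x) + \<mu> * (z - x)\<^sup>2"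
      by (simp add: algebra_simps power2_eq_square)
    ultimately have "f z \<le> f x + (p * (z - x) + 1 / \<epsilon> / 2 * (z - x)\<^sup>2) + (2 * \<mu> * (x - x0) * (z - x) + \<mu> * (z - x)\<^sup>2)"
      using mx[OF elim xy(2)] by linarith
    then show ?case by (simp add: algebra_simps add_divide_distrib)
  qed
  have touchg: "\<forall>\<^sub>F z in at y. - g z \<le> - g y + (- p) * (z - y) + (1 / \<epsilon>) / 2 * (z - y)\<^sup>2"
    using nearI(2)
  proof eventually_elim
    case (elim z)
    have "(x - z)\<^sup>2 / (2 * \<epsilon>) - (x - y)\<^sup>2 / (2 * \<epsilon>) = (- p) * (z - y) + 1 / \<epsilon> / 2 * (z - y)\<^sup>2"
      unfolding p_def using \<epsilon> by (simp add: field_simps power2_eq_square)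
    then show ?case using mx[OF xy(1) elim] by linarith
  qed
  define Rf where "Rf = lam * f x + H x (p + 2 * \<mu> * (x - x0))"
  define Rg where "Rg = lam * g y + H y p"
  define \<tau> where "\<tau> = (\<sigma> x - \<sigma> y)\<^sup>2 / \<epsilon> + 2 * \<mu> * (\<sigma> x)\<^sup>2"
  (* In the direction (\<sigma> x, \<sigma> y) the penalization has second difference \<tau> * r^2, while those of f
     and - g are bounded below by second_difference. *)
  have main: "Rf - Rg \<le> \<tau>"
  proof (rule field_le_epsilon)
    fix e :: real assume e: "0 < e"
    have "\<forall>\<^sub>F r in at_right 0. (Rf - e / 2) * r\<^sup>2 \<le> f (x + \<sigma> x * r) + f (x - \<sigma> x * r) - 2 * f x"
      unfolding Rf_def using second_difference[OF f inL(1) touchf, of "e / 2"] e by simp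
    moreover have "\<forall>\<^sub>F r in at_right 0. (- Rg - e / 2) * r\<^sup>2 \<le> - g (y + \<sigma> y * r) + - g (y - \<sigma> y * r) - 2 * - g y"
      using neg.second_difference[OF negated_supersol[OF g] inL(2) touchg, of "e / 2"] e
      by (simp add: Rg_def algebra_simps)
    moreover have "\<forall>\<^sub>F r in at_right 0. c + d * r \<in> I" if c: "\<bar>c - x0\<bar> < \<rho>" for c d :: real
    proof -
      have "((\<lambda>r. c + d * r) \<longlongrightarrow> c + d * 0) (at_right 0)" by (intro tendsto_intros)
      moreover have "c + d * 0 \<in> {x0 - \<rho><..<x0 + \<rho>}" using c by auto
      ultimately have "\<forall>\<^sub>F r in at_right 0. c + d * r \<in> {x0 - \<rho><..<x0 + \<rho>}"
        using topological_tendstoD[OF _ open_greaterThanLessThan] by blast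
      then show ?thesis by eventually_elim (auto simp: I_def)
    qed
    note inI = this
    have "\<forall>\<^sub>F r in at_right 0. x + \<sigma> x * r \<in> I" "\<forall>\<^sub>F r in at_right 0. x + (- \<sigma> x) * r \<in> I"
      "\<forall>\<^sub>F r in at_right 0. y + \<sigma> y * r \<in> I" "\<forall>\<^sub>F r in at_right 0. y + (- \<sigma> y) * r \<in> I"
      by (intro inI xr yx0)+
    ultimately have "\<forall>\<^sub>F r::real in at_right 0. Rf - Rg \<le> \<tau> + e"
      using eventually_at_right_less[of 0]
    proof eventually_elim
      case (elim r)
      have q1: "(x + \<sigma> x * r - (y + \<sigma> y * r))\<^sup>2 / (2 * \<epsilon>) + (x - \<sigma> x * r - (y - \<sigma> y * r))\<^sup>2 / (2 * \<epsilon>)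
         - 2 * ((x - y)\<^sup>2 / (2 * \<epsilon>)) = (\<sigma> x - \<sigma> y)\<^sup>2 / \<epsilon> * r\<^sup>2"
        using \<epsilon> by (simp add: field_simps power2_eq_square)
      have q2: "\<mu> * (x + \<sigma> x * r - x0)\<^sup>2 + \<mu> * (x - \<sigma> x * r - x0)\<^sup>2 - 2 * (\<mu> * (x - x0)\<^sup>2) = 2 * \<mu> * (\<sigma> x)\<^sup>2 * r\<^sup>2"
        by (simp add: algebra_simps power2_eq_square)
      have "f (x + \<sigma> x * r) + f (x - \<sigma> x * r) - 2 * f x + (- g (y + \<sigma> y * r) + - g (y - \<sigma> y * r) - 2 * - g y) \<le> \<tau> * r\<^sup>2"
        using mx[of "x + \<sigma> x * r" "y + \<sigma> y * r"] mx[of "x - \<sigma> x * r" "y - \<sigma> y * r"] elim q1 q2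
        unfolding \<tau>_def distrib_right by simp
      then have "(Rf - Rg - e) * r\<^sup>2 \<le> \<tau> * r\<^sup>2" using elim(1,2) by (simp add: algebra_simps)
      moreover have "r\<^sup>2 > 0" using elim by simp
      ultimately show ?case by simp
    qed
    then show "Rf - Rg \<le> \<tau> + e" by simp
  qed
  define t where "t = (x - y)\<^sup>2 / \<epsilon>"
  have "(x - y)\<^sup>2 / (2 * \<epsilon>) < \<eta>" using close(2) pen by linarith
  moreover have "t = 2 * ((x - y)\<^sup>2 / (2 * \<epsilon>))" by (simp add: t_def)
  ultimately have t: "0 \<le> t" "t < 2 * \<eta>" using pen by auto
  have "\<bar>p\<bar> * \<bar>x - y\<bar> = t" unfolding p_def t_def using \<epsilon> by (simp add: abs_mult[symmetric] power2_eq_square)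
  then have pt: "C * (1 + \<bar>p\<bar>) * \<bar>x - y\<bar> = C * \<bar>x - y\<bar> + C * t" by (simp add: algebra_simps)
  have "\<bar>H x (p + 2 * \<mu> * (x - x0)) - H x p\<bar> \<le> C * \<bar>2 * \<mu> * (x - x0)\<bar>"
    using Hp[OF inL'(1), of "p + 2 * \<mu> * (x - x0)" p] by simp
  also have "\<dots> \<le> C * (2 * \<mu> * L)"
  proof -
    have "\<bar>x - x0\<bar> \<le> L" using inL x0 by auto
    then show ?thesis using \<mu> C by (simp add: abs_mult)
  qed
  finally have h1: "H x p - C * (2 * \<mu> * L) \<le> H x (p + 2 * \<mu> * (x - x0))" by linarith
  have h2: "H y p - (C * \<bar>x - y\<bar> + C * t) \<le> H x p" using Hx[OF inL', of p] pt by linarith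
  have "lam * M \<le> lam * (f x - g y)" using ge pen lam by (intro mult_left_mono) (auto simp: M_def)
  then have h3: "k \<le> lam * f x - lam * g y" by (simp add: k_def algebra_simps)
  have "(\<sigma> x - \<sigma> y)\<^sup>2 \<le> (C * \<bar>x - y\<bar>)\<^sup>2"
    using power_mono[OF sig[OF inL'] abs_ge_zero, of 2] by simp
  then have "(\<sigma> x - \<sigma> y)\<^sup>2 / \<epsilon> \<le> (C * \<bar>x - y\<bar>)\<^sup>2 / \<epsilon>" using \<epsilon> by (intro divide_right_mono) auto
  then have h4: "(\<sigma> x - \<sigma> y)\<^sup>2 / \<epsilon> \<le> C\<^sup>2 * t" by (simp add: t_def power_mult_distrib)
  have h5: "2 * \<mu> * (\<sigma> x)\<^sup>2 \<le> 2 * \<mu> * s\<^sup>2" using s[OF inL'(1)] \<mu> by simp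
  have "k \<le> (2 * \<mu> * s\<^sup>2 + C * (2 * \<mu> * L)) + C * \<bar>x - y\<bar> + (C + C\<^sup>2) * t"
    using main h1 h2 h3 h4 h5 unfolding Rf_def Rg_def \<tau>_def by (simp add: algebra_simps)
  also have "2 * \<mu> * s\<^sup>2 + C * (2 * \<mu> * L) \<le> 2 * \<mu> * T" using \<mu> by (simp add: T_def algebra_simps)
  also have "2 * \<mu> * T = k / 4" by (rule \<mu>T)
  also have "C * \<bar>x - y\<bar> \<le> k / 8"
  proof -
    have "\<bar>x - y\<bar> \<le> k / (8 * C)" using close(1) \<eta>(5) by linarith
    then have "C * \<bar>x - y\<bar> \<le> C * (k / (8 * C))" using C by (intro mult_left_mono) auto
    then show ?thesis using C by simp
  qed
  also have "(C + C\<^sup>2) * t \<le> k / 8"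
  proof -
    have CC: "C + C\<^sup>2 > 0" using C by (simp add: add_pos_pos)
    have "t \<le> 2 * (k / (16 * (C + C\<^sup>2)))" using t(2) \<eta>(2) by linarith
    moreover have "w * t \<le> k / 8" if "w > 0" "t \<le> 2 * (k / (16 * w))" for w
      using that by (simp add: field_simps)
    ultimately show ?thesis using CC by blast
  qed
  finally show False using k by simp
qed

end

section \<open>Geometry of a network\<close>

lemma gam_0: "gam N E 0 = tail N E"
  by (simp add: gam_def)

lemma gam_diff: "gam N E s - gam N E t = ((s - t) / elen N E) *\<^sub>R (head N E - tail N E)"
  by (simp add: gam_def diff_divide_distrib scaleR_left_diff_distrib)

lemma edge_structure:
  assumes N: "is_network N" and E: "E \<in> edges N"
  shows "0 < elen N E" "tail N E \<in> verts N" "head N E \<in> verts N"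
    "closure E \<inter> verts N = {tail N E, head N E}"
    "E = gam N E ` {0<..<elen N E}" "closure E = gam N E ` {0..elen N E}"
    "closure E = closed_segment (tail N E) (head N E)"
proof -
  from N E obtain i j where ij: "1 \<le> i" "i < j" "j \<le> vcount N"
    and v: "closure E \<inter> verts N = {vertex N i, vertex N j}"
    and E': "E = (\<lambda>t. vertex N i + (t / dist (vertex N i) (vertex N j)) *\<^sub>R (vertex N j - vertex N i))
              ` {0<..<dist (vertex N i) (vertex N j)}"
    and inj: "inj_on (vertex N) {1..vcount N}"
    unfolding is_network_def by metis
  have "{k \<in> {1..vcount N}. vertex N k \<in> closure E} = {i, j}"
  proof (intro set_eqI iffI)
    fix k assume k: "k \<in> {k \<in> {1..vcount N}. vertex N k \<in> closure E}"
    then have "vertex N k \<in> {vertex N i, vertex N j}" using v unfolding verts_def by auto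
    then show "k \<in> {i, j}" using inj_onD[OF inj, of k i] inj_onD[OF inj, of k j] k ij by auto
  next
    fix k assume "k \<in> {i, j}"
    then have "vertex N k \<in> closure E \<inter> verts N" using v by auto
    then show "k \<in> {k \<in> {1..vcount N}. vertex N k \<in> closure E}" using \<open>k \<in> {i, j}\<close> ij by auto
  qed
  then have t: "tail N E = vertex N i" and h: "head N E = vertex N j"
    using ij by (auto simp: tail_def head_def)
  have ne: "vertex N i \<noteq> vertex N j" using inj_onD[OF inj, of i j] ij by auto
  show len: "0 < elen N E" unfolding elen_def t h using ne by simp
  show "closure E \<inter> verts N = {tail N E, head N E}" using v t h by simp
  then show "tail N E \<in> verts N" "head N E \<in> verts N" by blast+
  show Eg: "E = gam N E ` {0<..<elen N E}"
    by (subst E') (simp add: gam_def[abs_def] t h elen_def)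
  have gam: "gam N E t = (1 - t / elen N E) *\<^sub>R tail N E + (t / elen N E) *\<^sub>R head N E" for t
    by (simp add: gam_def algebra_simps)
  have sc: "(\<lambda>t. t / elen N E) ` {0<..<elen N E} = {0<..<1}" "(\<lambda>t. t / elen N E) ` {0..elen N E} = {0..1}"
  proof -
    have "u \<in> (\<lambda>t. t / elen N E) ` {0<..<elen N E}" if "u \<in> {0<..<1}" for u
      using that len by (intro image_eqI[of _ _ "u * elen N E"]) auto
    then show "(\<lambda>t. t / elen N E) ` {0<..<elen N E} = {0<..<1}" using len by auto
    have "u \<in> (\<lambda>t. t / elen N E) ` {0..elen N E}" if "u \<in> {0..1}" for u
      using that len by (intro image_eqI[of _ _ "u * elen N E"]) (auto simp: mult_left_le_one_le)
    then show "(\<lambda>t. t / elen N E) ` {0..elen N E} = {0..1}" using len by auto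
  qed
  have "E = open_segment (tail N E) (head N E)"
    unfolding open_segment_image_interval sc(1)[symmetric] image_image gam[symmetric]
    using ne t h Eg by simp
  then show cl: "closure E = closed_segment (tail N E) (head N E)"
    using ne t h by (metis closure_open_segment)
  show "closure E = gam N E ` {0..elen N E}"
    unfolding cl closed_segment_image_interval sc(2)[symmetric] image_image gam[symmetric] ..
qed

lemma gam_elen: "is_network N \<Longrightarrow> E \<in> edges N \<Longrightarrow> gam N E (elen N E) = head N E"
  using edge_structure(1)[of N E] by (simp add: gam_def)

lemma dist_gam: "is_network N \<Longrightarrow> E \<in> edges N \<Longrightarrow> dist (gam N E s) (gam N E t) = \<bar>s - t\<bar>"
  using edge_structure(1)[of N E] unfolding dist_norm gam_diff
  by (simp add: elen_def dist_norm norm_minus_commute)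

lemma dist_tail_gam: "is_network N \<Longrightarrow> E \<in> edges N \<Longrightarrow> 0 \<le> t \<Longrightarrow> dist (tail N E) (gam N E t) = t"
  using dist_gam[of N E 0 t] by (simp add: gam_0)

lemma closure_edge_coordinate:
  assumes "is_network N" "E \<in> edges N" "x \<in> closure E"
  shows "dist (tail N E) x \<in> {0..elen N E}" "gam N E (dist (tail N E) x) = x"
  using assms edge_structure(6)[OF assms(1,2)] by (auto simp: dist_tail_gam)

lemma edge_coordinate:
  assumes "is_network N" "E \<in> edges N"
  shows "x \<in> E \<longleftrightarrow> x \<in> closure E \<and> dist (tail N E) x \<in> {0<..<elen N E}"
proof
  assume "x \<in> E"
  then show "x \<in> closure E \<and> dist (tail N E) x \<in> {0<..<elen N E}"
  proof -
    obtain t where t: "x = gam N E t" "t \<in> {0<..<elen N E}"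
      using \<open>x \<in> E\<close> edge_structure(5)[OF assms] by blast
    then have "dist (tail N E) x = t" using dist_tail_gam[OF assms, of t] by simp
    then show ?thesis using t \<open>x \<in> E\<close> closure_subset[of E] by auto
  qed
next
  assume a: "x \<in> closure E \<and> dist (tail N E) x \<in> {0<..<elen N E}"
  then have "gam N E (dist (tail N E) x) \<in> gam N E ` {0<..<elen N E}" by (intro imageI) auto
  then show "x \<in> E"
    unfolding edge_structure(5)[OF assms, symmetric] using closure_edge_coordinate(2)[OF assms, of x] a by simp
qed

lemma edge_verts_disjoint:
  assumes "is_network N" "E \<in> edges N" shows "E \<inter> verts N = {}"
proof (rule ccontr)
  assume "E \<inter> verts N \<noteq> {}"
  then obtain z where z: "z \<in> E" "z \<in> verts N" by blast
  then have "z \<in> {tail N E, head N E}" using edge_structure(4)[OF assms] closure_subset[of E] by blast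
  moreover have "dist (tail N E) z \<in> {0<..<elen N E}" using z edge_coordinate[OF assms] by blast
  ultimately show False by (auto simp: elen_def)
qed

lemma closure_edge_cases:
  assumes "is_network N" "E \<in> edges N" "x \<in> closure E"
  shows "x \<in> E \<or> x = tail N E \<or> x = head N E"
proof -
  let ?t = "dist (tail N E) x"
  have "?t = 0 \<or> ?t = elen N E \<or> ?t \<in> {0<..<elen N E}" using closure_edge_coordinate(1)[OF assms] by auto
  then show ?thesis
  proof (elim disjE)
    assume "?t = 0" then show ?thesis by simp
  next
    assume "?t = elen N E"
    then have "x = gam N E (elen N E)" using closure_edge_coordinate(2)[OF assms] by simp
    then show ?thesis using gam_elen[OF assms(1,2)] by simp
  next
    assume "?t \<in> {0<..<elen N E}" then show ?thesis using edge_coordinate[OF assms(1,2)] assms(3) by blast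
  qed
qed

lemma edge_unique:
  assumes "is_network N" "E \<in> edges N" "E' \<in> edges N" "x \<in> E" "x \<in> closure E'"
  shows "E' = E"
proof -
  have "x \<notin> verts N" using edge_verts_disjoint[OF assms(1,2)] assms(4) by blast
  then have "x \<in> E'"
    using closure_edge_cases[OF assms(1,3,5)] edge_structure(2,3)[OF assms(1,3)] by metis
  then show ?thesis using assms unfolding is_network_def pairwise_def disjnt_def by blast
qed

lemma Inc_of_edge_point: "is_network N \<Longrightarrow> E \<in> edges N \<Longrightarrow> x \<in> E \<Longrightarrow> Inc N x = {E}"
  unfolding Inc_def using edge_unique closure_subset by blast

lemma body_iff: "x \<in> body N \<longleftrightarrow> Inc N x \<noteq> {}"
  by (auto simp: body_def Inc_def)

lemma endpoint_of_incident_edge: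
  assumes "is_network N" "z \<in> verts N" "E \<in> Inc N z"
  shows "E \<in> edges N" "z \<in> closure E" "z = tail N E \<or> z = head N E" "tail N E \<noteq> head N E"
  using assms edge_structure(4)[of N E] edge_structure(1)[of N E] unfolding Inc_def elen_def by auto

lemma boundary_or_interior:
  assumes "is_network N" "z \<in> verts N"
  shows "z \<in> interior_verts N \<or> z \<in> boundary_verts N"
proof -
  have "Inc N z \<noteq> {}" "finite (Inc N z)" using assms unfolding is_network_def Inc_def by auto
  then have "deg N z > 0" by (simp add: deg_def card_gt_0_iff)
  then show ?thesis using assms(2) by (auto simp: interior_verts_def boundary_verts_def)
qed

text \<open>Neighborhoods in the network are unions of one-sided or two-sided intervals on the finitely
  many incident edges; the other closed edges keep a positive distance.\<close>
lemma eventually_within_body: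
  assumes N: "is_network N"
    and P: "\<And>E. E \<in> Inc N x \<Longrightarrow>
      \<forall>\<^sub>F t in at (dist (tail N E) x) within {0..elen N E}. P (gam N E t)"
  shows "\<forall>\<^sub>F y in at x within body N. P y"
proof -
  have fin: "finite (edges N)" using N by (simp add: is_network_def)
  have "\<forall>\<^sub>F y in nhds x. y \<noteq> x \<longrightarrow> y \<in> closure E \<longrightarrow> P y" if E: "E \<in> edges N" for E
  proof (cases "x \<in> closure E")
    case False
    then have "\<forall>\<^sub>F y in nhds x. y \<in> - closure E" by (intro eventually_nhds_in_open) auto
    then show ?thesis by eventually_elim auto
  next
    case True
    then have "E \<in> Inc N x" using E by (simp add: Inc_def)
    note ev = P[OF this]
    let ?c = "\<lambda>y. dist (tail N E) y"
    have "filterlim ?c (at (?c x) within {0..elen N E}) (at x within closure E)"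
      unfolding filterlim_at
    proof
      show "(?c \<longlongrightarrow> ?c x) (at x within closure E)" by (intro tendsto_intros)
      show "\<forall>\<^sub>F y in at x within closure E. ?c y \<in> {0..elen N E} \<and> ?c y \<noteq> ?c x"
        unfolding eventually_at_filter
        using closure_edge_coordinate[OF N E] True by (intro always_eventually) metis
    qed
    from eventually_compose_filterlim[OF ev this]
    have "\<forall>\<^sub>F y in nhds x. y \<noteq> x \<longrightarrow> y \<in> closure E \<longrightarrow> P (gam N E (?c y))"
      unfolding eventually_at_filter .
    then show ?thesis by eventually_elim (use closure_edge_coordinate(2)[OF N E] in auto)
  qed
  then have "\<forall>\<^sub>F y in nhds x. \<forall>E\<in>edges N. y \<noteq> x \<longrightarrow> y \<in> closure E \<longrightarrow> P y"
    by (intro eventually_ball_finite[OF fin]) blast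
  then show ?thesis unfolding eventually_at_filter body_def by eventually_elim blast
qed

lemma geo_dist_on_edge:
  assumes N: "is_network N" and E: "E \<in> edges N" and x: "x \<in> closure E" and y: "y \<in> closure E"
  shows "geo_dist N x y = dist x y"
proof -
  let ?A = "{g. path g \<and> path_image g \<subseteq> body N \<and> pathstart g = x \<and> pathfinish g = y}"
  have lower: "ereal (dist x y) \<le> curve_length g" if "g \<in> ?A" for g
  proof -
    let ?t = "\<lambda>i::nat. if i = 0 then 0 else 1::real"
    have "(1, ?t) \<in> {(n::nat, t::nat \<Rightarrow> real). mono t \<and> range t \<subseteq> {0..1}}" by (auto simp: mono_def)
    then have "(\<lambda>(n, t). ereal (\<Sum>i<n. dist (g (t i)) (g (t (Suc i))))) (1, ?t) \<le> curve_length g"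
      unfolding curve_length_def by (rule SUP_upper)
    then show ?thesis using that by (simp add: pathstart_def pathfinish_def)
  qed
  have "curve_length (linepath x y) \<le> ereal (dist x y)"
    unfolding curve_length_def
  proof (rule SUP_least, clarify)
    fix n :: nat and t :: "nat \<Rightarrow> real" assume t: "mono t" "range t \<subseteq> {0..1}"
    have d: "dist (linepath x y a) (linepath x y b) = \<bar>b - a\<bar> * dist x y" for a b
    proof -
      have "linepath x y a - linepath x y b = (b - a) *\<^sub>R (x - y)"
        by (simp add: linepath_def algebra_simps)
      then show ?thesis by (simp add: dist_norm)
    qed
    have "(\<Sum>i<n. dist (linepath x y (t i)) (linepath x y (t (Suc i)))) = (\<Sum>i<n. (t (Suc i) - t i) * dist x y)"
      unfolding d using t(1) by (intro sum.cong) (auto simp: mono_def)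
    also have "\<dots> = (t n - t 0) * dist x y"
      by (simp add: sum_distrib_right[symmetric] sum_lessThan_telescope)
    also have "\<dots> \<le> 1 * dist x y"
    proof (rule mult_right_mono)
      have "t n \<in> {0..1}" "t 0 \<in> {0..1}" using t(2) by blast+
      then show "t n - t 0 \<le> 1" by simp
    qed simp
    finally show "ereal (\<Sum>i<n. dist (linepath x y (t i)) (linepath x y (t (Suc i)))) \<le> ereal (dist x y)" by simp
  qed
  moreover have "linepath x y \<in> ?A"
  proof -
    have "closed_segment x y \<subseteq> closure E"
      unfolding edge_structure(7)[OF N E]
      using x y edge_structure(7)[OF N E] by (simp add: closed_segment_subset convex_closed_segment)
    then show ?thesis using E by (auto simp: body_def)
  qed
  ultimately have "(INF g\<in>?A. curve_length g) \<le> ereal (dist x y)" by (meson INF_lower order_trans)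
  moreover have "ereal (dist x y) \<le> (INF g\<in>?A. curve_length g)" using lower by (intro INF_greatest)
  ultimately have "(INF g\<in>?A. curve_length g) = ereal (dist x y)" by (rule antisym)
  then show ?thesis by (simp add: geo_dist_def)
qed

section \<open>Test functions with prescribed jets\<close>

text \<open>A cubic polynomial: besides the jet there are two free coefficients for the two zeros. The
  value at \<open>t0\<close> is irrelevant, because adding a constant to a test function changes nothing.\<close>
lemma vanishing_function_with_jet:
  fixes L t0 p X :: real
  assumes "0 < L"
  shows "\<exists>\<psi> \<psi>' \<psi>''. (\<forall>t. (\<psi> has_real_derivative \<psi>' t) (at t)) \<and> (\<forall>t. (\<psi>' has_real_derivative \<psi>'' t) (at t)) \<and>
    continuous_on UNIV \<psi>'' \<and> \<psi> 0 = 0 \<and> \<psi> L = 0 \<and> \<psi>' t0 = p \<and> \<psi>'' t0 = X"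
proof -
  define a where "a = - t0"
  define b where "b = L - t0"
  have ab: "b ^ 3 - a ^ 3 > 0"
  proof -
    have "a < b" using assms by (simp add: a_def b_def)
    then have "0 < (a + b / 2)\<^sup>2 + 3 / 4 * b\<^sup>2" by (cases "b = 0") (auto intro: add_nonneg_pos)
    then have "0 < (b - a) * ((a + b / 2)\<^sup>2 + 3 / 4 * b\<^sup>2)" using \<open>a < b\<close> by simp
    also have "\<dots> = b ^ 3 - a ^ 3" by (simp add: power2_eq_square power3_eq_cube algebra_simps)
    finally show ?thesis .
  qed
  define q where "q = (\<lambda>s. p * s + X / 2 * s\<^sup>2)"
  define d where "d = - (q b - q a) / (b ^ 3 - a ^ 3)"
  define c where "c = - q a - d * a ^ 3"
  have db: "d * (b ^ 3 - a ^ 3) = - (q b - q a)" using ab by (simp add: d_def)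
  define \<psi> where "\<psi> = (\<lambda>t. c + q (t - t0) + d * (t - t0) ^ 3)"
  define \<psi>' where "\<psi>' = (\<lambda>t. p + X * (t - t0) + 3 * d * (t - t0)\<^sup>2)"
  define \<psi>'' where "\<psi>'' = (\<lambda>t. X + 6 * d * (t - t0))"
  have "\<psi> 0 = 0" by (simp add: \<psi>_def c_def a_def[symmetric])
  moreover have "\<psi> L = 0" using db by (simp add: \<psi>_def c_def b_def[symmetric] algebra_simps)
  moreover have "(\<psi> has_real_derivative \<psi>' t) (at t)" for t
    unfolding \<psi>_def \<psi>'_def q_def by (auto intro!: derivative_eq_intros)
  moreover have "(\<psi>' has_real_derivative \<psi>'' t) (at t)" for t
    unfolding \<psi>'_def \<psi>''_def by (auto intro!: derivative_eq_intros)
  moreover have "continuous_on UNIV \<psi>''" unfolding \<psi>''_def by (intro continuous_intros)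
  moreover have "\<psi>' t0 = p" "\<psi>'' t0 = X" by (auto simp: \<psi>'_def \<psi>''_def)
  ultimately show ?thesis by blast
qed

text \<open>Orientation of \<open>E\<close> as seen from its endpoint \<open>z\<close>: the factor between the derivative in the
  edge coordinate and the inward derivative at \<open>z\<close>.\<close>
definition sgn_at :: "'a::euclidean_space network \<Rightarrow> 'a \<Rightarrow> 'a set \<Rightarrow> real" where
  "sgn_at N z E = (if z = tail N E then 1 else - 1)"

text \<open>The sum has at most one summand, as the open edges are disjoint. It is empty at vertices, which
  fits functions that vanish at the ends of all edges.\<close>
definition glue :: "'a::euclidean_space network \<Rightarrow> ('a set \<Rightarrow> real \<Rightarrow> real) \<Rightarrow> 'a \<Rightarrow> real" where
  "glue N \<psi> x = (\<Sum>E\<in>{E \<in> edges N. x \<in> E}. \<psi> E (dist (tail N E) x))"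

lemma glue_on_edge:
  assumes N: "is_network N" and E: "E \<in> edges N" and x: "x \<in> closure E"
    and van: "\<And>E. E \<in> edges N \<Longrightarrow> \<psi> E 0 = 0 \<and> \<psi> E (elen N E) = 0"
  shows "glue N \<psi> x = \<psi> E (dist (tail N E) x)"
proof (cases "x \<in> E")
  case True
  have "{E' \<in> edges N. x \<in> E'} = {E}" using edge_unique[OF N E _ True] True E closure_subset by blast
  then show ?thesis by (simp add: glue_def)
next
  case False
  then have xv: "x = tail N E \<or> x = head N E" using closure_edge_cases[OF N E x] by blast
  then have "x \<in> verts N" using edge_structure(2,3)[OF N E] by metis
  then have "{E' \<in> edges N. x \<in> E'} = {}" using edge_verts_disjoint[OF N] by blast
  then have "glue N \<psi> x = 0" unfolding glue_def by (simp only: sum.empty)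
  moreover have "\<psi> E (dist (tail N E) x) = 0" using xv van[OF E] by (auto simp: elen_def)
  ultimately show ?thesis by simp
qed

lemma edge_limit_nontrivial:
  assumes "is_network N" "E \<in> edges N" "x \<in> closure E"
  shows "at x within E \<noteq> bot"
proof (cases "x \<in> E")
  case False
  then show ?thesis using assms(3) by (simp add: closure_def trivial_limit_within)
next
  case True
  have "connected (gam N E ` {0<..<elen N E})"
    by (intro connected_continuous_image) (auto simp: gam_def[abs_def] intro!: continuous_intros)
  then have "connected E" unfolding edge_structure(5)[OF assms(1,2), symmetric] .
  moreover have "\<not> E \<subseteq> {x}"
  proof
    assume "E \<subseteq> {x}"
    then have "closure E \<subseteq> {x}" by (rule closure_minimal) simp
    then have "tail N E = head N E" using edge_structure(4)[OF assms(1,2)] by blast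
    then show False using edge_structure(1)[OF assms(1,2)] by (simp add: elen_def)
  qed
  ultimately show ?thesis using True connected_imp_perfect[of E x] by (auto simp: trivial_limit_within)
qed

text \<open>
  Gluing functions that vanish at all vertices, one can prescribe first and second derivatives at \<open>x\<close>
  independently on all incident edges. The last two properties allow \<open>\<phi>\<close> to be compared with parabolas
  of slightly different curvature.
\<close>
lemma test_function:
  assumes N: "is_network N"
  obtains \<phi> where "\<phi> \<in> Cm 2 N"
    "\<And>E. E \<in> Inc N x \<Longrightarrow> dE 1 N E \<phi> x = p E" "\<And>E. E \<in> Inc N x \<Longrightarrow> dE 2 N E \<phi> x = X E"
    "\<And>E. E \<in> Inc N x \<Longrightarrow> x \<in> verts N \<Longrightarrow> inward N E \<phi> x = sgn_at N x E * p E"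
    "\<And>E Y. E \<in> Inc N x \<Longrightarrow> Y < X E \<Longrightarrow> \<forall>\<^sub>F t in at (dist (tail N E) x) within {0..elen N E}.
       \<phi> x + p E * (t - dist (tail N E) x) + Y / 2 * (t - dist (tail N E) x)\<^sup>2 \<le> \<phi> (gam N E t)"
    "\<And>E Y. E \<in> Inc N x \<Longrightarrow> X E < Y \<Longrightarrow> \<forall>\<^sub>F t in at (dist (tail N E) x) within {0..elen N E}.
       \<phi> (gam N E t) \<le> \<phi> x + p E * (t - dist (tail N E) x) + Y / 2 * (t - dist (tail N E) x)\<^sup>2"
proof -
  have "\<forall>E. \<exists>\<psi> \<psi>' \<psi>''. E \<in> edges N \<longrightarrow> (\<forall>t. (\<psi> has_real_derivative \<psi>' t) (at t)) \<and> (\<forall>t. (\<psi>' has_real_derivative \<psi>'' t) (at t)) \<and>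
    continuous_on UNIV \<psi>'' \<and> \<psi> 0 = 0 \<and> \<psi> (elen N E) = 0 \<and> \<psi>' (dist (tail N E) x) = p E \<and> \<psi>'' (dist (tail N E) x) = X E"
    using vanishing_function_with_jet[OF edge_structure(1)[OF N]] by blast
  then obtain \<psi> \<psi>' \<psi>'' where J: "\<And>E. E \<in> edges N \<Longrightarrow> (\<forall>t. (\<psi> E has_real_derivative \<psi>' E t) (at t)) \<and> (\<forall>t. (\<psi>' E has_real_derivative \<psi>'' E t) (at t)) \<and>
    continuous_on UNIV (\<psi>'' E) \<and> \<psi> E 0 = 0 \<and> \<psi> E (elen N E) = 0 \<and> \<psi>' E (dist (tail N E) x) = p E \<and> \<psi>'' E (dist (tail N E) x) = X E"
    by metis
  define \<phi> where "\<phi> = glue N \<psi>"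
  have glue: "\<phi> y = \<psi> E (dist (tail N E) y)" if "E \<in> edges N" "y \<in> closure E" for E y
    unfolding \<phi>_def using glue_on_edge[OF N that] J by blast
  have on: "\<phi> (gam N E t) = \<psi> E t" if "E \<in> edges N" "t \<in> {0..elen N E}" for E t
  proof -
    have "gam N E t \<in> closure E" using edge_structure(6)[OF N that(1)] that(2) by blast
    then show ?thesis using glue[OF that(1)] dist_tail_gam[OF N that(1)] that(2) by auto
  qed
  have d0: "continuous_on UNIV (\<psi> E)" "continuous_on UNIV (\<psi>' E)" "continuous_on UNIV (\<psi>'' E)"
    if "E \<in> edges N" for E using J[OF that] by (auto intro!: DERIV_continuous_on)
  have der1: "deriv (on_edge N E \<phi>) t = \<psi>' E t" if E: "E \<in> edges N" and t: "t \<in> {0<..<elen N E}" for E t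
  proof (rule DERIV_imp_deriv)
    have "(\<psi> E has_real_derivative \<psi>' E t) (at t)" using J[OF E] by blast
    then show "(on_edge N E \<phi> has_real_derivative \<psi>' E t) (at t)"
      by (rule has_field_derivative_transform_within_open[OF _ open_greaterThanLessThan t])
        (auto simp: on_edge_def on[OF E])
  qed
  have der2: "deriv (deriv (on_edge N E \<phi>)) t = \<psi>'' E t" if E: "E \<in> edges N" and t: "t \<in> {0<..<elen N E}" for E t
  proof (rule DERIV_imp_deriv)
    have "(\<psi>' E has_real_derivative \<psi>'' E t) (at t)" using J[OF E] by blast
    then show "(deriv (on_edge N E \<phi>) has_real_derivative \<psi>'' E t) (at t)"
      by (rule has_field_derivative_transform_within_open[OF _ open_greaterThanLessThan t])
        (auto simp: der1[OF E])
  qed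
  have dE: "dE k N E \<phi> y = D (dist (tail N E) y)"
    if E: "E \<in> edges N" and y: "y \<in> closure E" and D: "continuous_on UNIV D"
      and kD: "\<And>t. t \<in> {0<..<elen N E} \<Longrightarrow> (deriv ^^ k) (on_edge N E \<phi>) t = D t" for k E y and D :: "real \<Rightarrow> real"
  proof -
    have in': "dE_in k N E \<phi> w = D (dist (tail N E) w)" if "w \<in> E" for w
      unfolding dE_in_def using that edge_coordinate[OF N E] kD by blast
    show ?thesis
    proof (cases "y \<in> E")
      case True
      then show ?thesis by (simp add: dE_def in')
    next
      case False
      have "isCont D (dist (tail N E) y)" using D by (simp add: continuous_on_eq_continuous_at)
      then have "((\<lambda>w. D (dist (tail N E) w)) \<longlongrightarrow> D (dist (tail N E) y)) (at y within E)"
        by (rule isCont_tendsto_compose) (intro tendsto_intros)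
      moreover have "\<forall>\<^sub>F w in at y within E. D (dist (tail N E) w) = dE_in k N E \<phi> w"
        unfolding eventually_at_filter using in' by (intro always_eventually) auto
      ultimately have "(dE_in k N E \<phi> \<longlongrightarrow> D (dist (tail N E) y)) (at y within E)"
        by (rule Lim_transform_eventually)
      then show ?thesis using False edge_limit_nontrivial[OF N E y]
        by (simp add: dE_def tendsto_Lim)
    qed
  qed
  show thesis
  proof (rule that[of \<phi>])
    have "continuous_on {0..elen N E} (on_edge N E \<phi>)" if "E \<in> edges N" for E
    proof -
      have "continuous_on {0..elen N E} (\<psi> E)" using d0(1)[OF that] continuous_on_subset by blast
      then show ?thesis by (rule continuous_on_eq) (simp add: on_edge_def on[OF that])
    qed
    moreover have "Cm_on 2 {0..elen N E} (on_edge N E \<phi>)" if E: "E \<in> edges N" for E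
    proof -
      define D where "D = (\<lambda>k::nat. if k = 0 then \<psi> E else if k = 1 then \<psi>' E else \<psi>'' E)"
      have "(D k has_real_derivative D (Suc k) t) (at t within {0..elen N E})" if "k < 2" for k t
        using J[OF E] that by (auto simp: D_def less_2_cases_iff intro: has_field_derivative_at_within)
      moreover have "continuous_on {0..elen N E} (D k)" for k
        using d0[OF E] by (auto simp: D_def intro: continuous_on_subset)
      moreover have "\<forall>t\<in>{0..elen N E}. D 0 t = on_edge N E \<phi> t" by (simp add: D_def on_edge_def on[OF E])
      ultimately show ?thesis unfolding Cm_on_def by blast
    qed
    ultimately show "\<phi> \<in> Cm 2 N"
      unfolding Cm_def USC_def LSC_def lsc_on_iff
      by (auto intro!: usc_on_continuous continuous_intros)
    fix E assume "E \<in> Inc N x"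
    then have E: "E \<in> edges N" and x: "x \<in> closure E" by (auto simp: Inc_def)
    let ?T = "dist (tail N E) x"
    note T = closure_edge_coordinate[OF N E x]
    show "dE 1 N E \<phi> x = p E" using dE[OF E x d0(2)[OF E], of 1] der1[OF E] J[OF E] by simp
    show "dE 2 N E \<phi> x = X E"
      using dE[OF E x d0(3)[OF E], of 2] der2[OF E] J[OF E] by (simp add: numeral_2_eq_2)
    have \<phi>x: "\<phi> x = \<psi> E ?T" using glue[OF E x] .
    have inside: "\<forall>\<^sub>F t in at ?T within {0..elen N E}. t \<in> {0..elen N E}" by (simp add: eventually_at_filter)
    have at_sub: "\<forall>\<^sub>F t in at ?T within {0..elen N E}. P t" if "\<forall>\<^sub>F t in at ?T. P t" for P
      using that filter_leD[OF at_le[of "{0..elen N E}" UNIV ?T]] by simp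
    have J1: "\<forall>\<^sub>F y in nhds ?T. (\<psi> E has_real_derivative \<psi>' E y) (at y)"
      and p: "\<psi>' E ?T = p E" "\<psi>'' E ?T = X E"
      using J[OF E] by simp_all
    have "(\<psi>' E has_real_derivative \<psi>'' E ?T) (at ?T)" using J[OF E] by blast
    then have J2: "(\<psi>' E has_real_derivative X E) (at ?T)" unfolding p(2) .
    show "\<forall>\<^sub>F t in at ?T within {0..elen N E}. \<phi> (gam N E t) \<le> \<phi> x + p E * (t - ?T) + Y / 2 * (t - ?T)\<^sup>2"
      if "X E < Y" for Y
      using at_sub[OF taylor2_upper[OF J1 J2 that]] inside
      by eventually_elim (simp add: on[OF E] \<phi>x p)
    show "\<forall>\<^sub>F t in at ?T within {0..elen N E}. \<phi> x + p E * (t - ?T) + Y / 2 * (t - ?T)\<^sup>2 \<le> \<phi> (gam N E t)"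
      if Y: "Y < X E" for Y
    proof -
      have "\<forall>\<^sub>F y in nhds ?T. ((\<lambda>y. - \<psi> E y) has_real_derivative - \<psi>' E y) (at y)"
        using J[OF E] by (auto intro!: always_eventually DERIV_minus)
      moreover have "((\<lambda>y. - \<psi>' E y) has_real_derivative - X E) (at ?T)" using J2 by (rule DERIV_minus)
      ultimately have "\<forall>\<^sub>F y in at ?T. - \<psi> E y \<le> - \<psi> E ?T + - \<psi>' E ?T * (y - ?T) + - Y / 2 * (y - ?T)\<^sup>2"
        using Y by (intro taylor2_upper) auto
      from at_sub[OF this] inside show ?thesis
        by eventually_elim (simp add: on[OF E] \<phi>x p)
    qed
    assume xv: "x \<in> verts N"
    have xE: "x \<notin> E" using edge_verts_disjoint[OF N E] xv by blast
    have ends: "?T = 0 \<and> sgn_at N x E = 1 \<or> ?T = elen N E \<and> sgn_at N x E = - 1"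
      using closure_edge_cases[OF N E x] xE edge_structure(1)[OF N E]
      by (auto simp: sgn_at_def elen_def)
    have "((\<lambda>t. (\<psi> E t - \<psi> E ?T) / (t - ?T)) \<longlongrightarrow> p E) (at ?T)"
      using J[OF E] p unfolding has_field_derivative_iff by metis
    moreover have "filterlim (\<lambda>w. dist (tail N E) w) (at ?T) (at x within E)"
      unfolding filterlim_at
    proof
      show "((\<lambda>w. dist (tail N E) w) \<longlongrightarrow> ?T) (at x within E)" by (intro tendsto_intros)
      have "dist (tail N E) w \<noteq> ?T" if "w \<in> E" for w
        using edge_coordinate[OF N E, of w] that ends by auto
      then show "\<forall>\<^sub>F w in at x within E. dist (tail N E) w \<in> UNIV \<and> dist (tail N E) w \<noteq> ?T"
        unfolding eventually_at_filter by (intro always_eventually) auto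
    qed
    ultimately have "((\<lambda>w. (\<psi> E (dist (tail N E) w) - \<psi> E ?T) / (dist (tail N E) w - ?T)) \<longlongrightarrow> p E) (at x within E)"
      by (rule filterlim_compose)
    then have "((\<lambda>w. sgn_at N x E * ((\<psi> E (dist (tail N E) w) - \<psi> E ?T) / (dist (tail N E) w - ?T))) \<longlongrightarrow> sgn_at N x E * p E) (at x within E)"
      by (intro tendsto_intros)
    moreover have "sgn_at N x E * ((\<psi> E (dist (tail N E) w) - \<psi> E ?T) / (dist (tail N E) w - ?T)) = (\<phi> w - \<phi> x) / geo_dist N w x"
      if w: "w \<in> E" for w
    proof -
      have wc: "w \<in> closure E" using w closure_subset by blast
      have c: "dist (tail N E) w \<in> {0<..<elen N E}" using edge_coordinate[OF N E] w by blast
      have "geo_dist N w x = dist (gam N E (dist (tail N E) w)) (gam N E ?T)"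
        using geo_dist_on_edge[OF N E wc x] T(2) closure_edge_coordinate(2)[OF N E wc] by simp
      also have "\<dots> = \<bar>dist (tail N E) w - ?T\<bar>" by (rule dist_gam[OF N E])
      finally have "geo_dist N w x = sgn_at N x E * (dist (tail N E) w - ?T)" using c ends by auto
      moreover have "sgn_at N x E * (a / b) = a / (sgn_at N x E * b)" for a b using ends by auto
      ultimately show ?thesis using glue[OF E wc] \<phi>x by simp
    qed
    then have "\<forall>\<^sub>F w in at x within E. sgn_at N x E * ((\<psi> E (dist (tail N E) w) - \<psi> E ?T) / (dist (tail N E) w - ?T)) = (\<phi> w - \<phi> x) / geo_dist N w x"
      unfolding eventually_at_filter by (intro always_eventually) auto
    ultimately have "((\<lambda>w. (\<phi> w - \<phi> x) / geo_dist N w x) \<longlongrightarrow> sgn_at N x E * p E) (at x within E)"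
      by (rule Lim_transform_eventually)
    then show "inward N E \<phi> x = sgn_at N x E * p E"
      unfolding inward_def using edge_limit_nontrivial[OF N E x] by (simp add: tendsto_Lim)
  qed
qed

section \<open>Edges parametrized from a vertex\<close>

text \<open>The edge coordinate of the point at distance \<open>t\<close> from the endpoint \<open>z\<close>. If \<open>z\<close> is not an endpoint,
  the result is the reversed orientation, which does no harm for interior points of the edge.\<close>
definition coord_from :: "'a::euclidean_space network \<Rightarrow> 'a \<Rightarrow> 'a set \<Rightarrow> real \<Rightarrow> real" where
  "coord_from N z E t = (if z = tail N E then t else elen N E - t)"

definition edge_from :: "'a::euclidean_space network \<Rightarrow> 'a \<Rightarrow> 'a set \<Rightarrow> real \<Rightarrow> 'a" where
  "edge_from N z E t = gam N E (coord_from N z E t)"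

lemma coord_from_coord_from: "coord_from N z E (coord_from N z E t) = t"
  by (simp add: coord_from_def)

lemma coord_from_mem: "coord_from N z E t \<in> {0..elen N E} \<longleftrightarrow> t \<in> {0..elen N E}"
  "coord_from N z E t \<in> {0<..<elen N E} \<longleftrightarrow> t \<in> {0<..<elen N E}"
  by (auto simp: coord_from_def)

lemma coord_from_diff: "coord_from N z E s - coord_from N z E t = sgn_at N z E * (s - t)"
  by (simp add: coord_from_def sgn_at_def)

lemma sgn_at_square: "sgn_at N z E * sgn_at N z E = 1" "(sgn_at N z E)\<^sup>2 = 1" "\<bar>sgn_at N z E\<bar> = 1"
  "sgn_at N z E * (sgn_at N z E * x) = x"
  by (auto simp: sgn_at_def)

lemma coord_from_0:
  assumes "is_network N" "z \<in> verts N" "E \<in> Inc N z"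
  shows "coord_from N z E 0 = dist (tail N E) z"
  using endpoint_of_incident_edge[OF assms] by (auto simp: coord_from_def elen_def)

lemma edge_from_0:
  assumes "is_network N" "z \<in> verts N" "E \<in> Inc N z"
  shows "edge_from N z E 0 = z"
  unfolding edge_from_def coord_from_0[OF assms]
  using endpoint_of_incident_edge[OF assms] closure_edge_coordinate(2)[OF assms(1)] by blast

lemma edge_from_mem:
  assumes "is_network N" "E \<in> edges N"
  shows "t \<in> {0<..<elen N E} \<Longrightarrow> edge_from N z E t \<in> E" "t \<in> {0..elen N E} \<Longrightarrow> edge_from N z E t \<in> closure E"
proof -
  show "edge_from N z E t \<in> E" if "t \<in> {0<..<elen N E}"
  proof -
    have "gam N E (coord_from N z E t) \<in> gam N E ` {0<..<elen N E}"
      using that coord_from_mem(2) by (intro imageI) blast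
    then show ?thesis unfolding edge_from_def edge_structure(5)[OF assms, symmetric] .
  qed
  show "edge_from N z E t \<in> closure E" if "t \<in> {0..elen N E}"
  proof -
    have "gam N E (coord_from N z E t) \<in> gam N E ` {0..elen N E}"
      using that coord_from_mem(1) by (intro imageI) blast
    then show ?thesis unfolding edge_from_def edge_structure(6)[OF assms, symmetric] .
  qed
qed

lemma dist_edge_from: "is_network N \<Longrightarrow> E \<in> edges N \<Longrightarrow> dist (edge_from N z E s) (edge_from N z E t) = \<bar>s - t\<bar>"
  by (auto simp: edge_from_def dist_gam coord_from_def)

lemma edge_from_surj:
  assumes N: "is_network N" and z: "z \<in> verts N" "E \<in> Inc N z" and x: "x \<in> closure E"
  shows "dist z x \<in> {0..elen N E}" "edge_from N z E (dist z x) = x"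
proof -
  note E = endpoint_of_incident_edge(1)[OF N z]
  define t where "t = coord_from N z E (dist (tail N E) x)"
  have t: "t \<in> {0..elen N E}" "edge_from N z E t = x"
    using closure_edge_coordinate[OF N E x] unfolding t_def edge_from_def coord_from_coord_from coord_from_mem by auto
  have "dist z x = \<bar>0 - t\<bar>" using dist_edge_from[OF N E, of z 0 t] t edge_from_0[OF N z] by simp
  then have "dist z x = t" using t by simp
  then show "dist z x \<in> {0..elen N E}" "edge_from N z E (dist z x) = x" using t by auto
qed

lemma eventually_coord_from:
  assumes ev: "\<forall>\<^sub>F t in at t0 within {0..elen N E}. P (coord_from N z E t)"
  shows "\<forall>\<^sub>F t in at (coord_from N z E t0) within {0..elen N E}. P t"
proof -
  let ?r = "coord_from N z E"
  have "filterlim ?r (at (?r (?r t0)) within {0..elen N E}) (at (?r t0) within {0..elen N E})"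
    unfolding filterlim_at
  proof
    have "continuous_on UNIV ?r" unfolding coord_from_def by (cases "z = tail N E") (auto intro!: continuous_intros)
    then have "isCont ?r (?r t0)" by (simp add: continuous_on_eq_continuous_at)
    then show "(?r \<longlongrightarrow> ?r (?r t0)) (at (?r t0) within {0..elen N E})"
      using continuous_at_imp_continuous_at_within continuous_within by blast
    have "t = ?r t0" if "?r t = ?r (?r t0)" for t using that by (auto simp: coord_from_def split: if_splits)
    then show "\<forall>\<^sub>F t in at (?r t0) within {0..elen N E}. ?r t \<in> {0..elen N E} \<and> ?r t \<noteq> ?r (?r t0)"
      unfolding eventually_at_filter coord_from_mem by (intro always_eventually) auto
  qed
  moreover have "\<forall>\<^sub>F t in at (?r (?r t0)) within {0..elen N E}. P (?r t)"
    unfolding coord_from_coord_from by (rule ev)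
  ultimately have "\<forall>\<^sub>F t in at (?r t0) within {0..elen N E}. P (?r (?r t))"
    by (rule eventually_compose_filterlim[rotated])
  then show ?thesis unfolding coord_from_coord_from .
qed

lemma at_right_0_edge:
  "is_network N \<Longrightarrow> E \<in> edges N \<Longrightarrow> at_right 0 = at (0::real) within {0..elen N E}"
  using edge_structure(1) at_within_Icc_at_right by metis

lemma vertex_test_above:
  assumes N: "is_network N" and z: "z \<in> verts N"
    and jet: "\<And>E. E \<in> Inc N z \<Longrightarrow> \<forall>\<^sub>F t in at_right 0. u (edge_from N z E t) \<le> u z + p E * t + X E / 2 * t\<^sup>2"
    and XY: "\<And>E. E \<in> Inc N z \<Longrightarrow> X E < Y E"
  obtains \<phi> where "\<phi> \<in> Cm 2 N" "local_max (body N) (\<lambda>y. u y - \<phi> y) z"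
    "\<And>E. E \<in> Inc N z \<Longrightarrow> dE 1 N E \<phi> z = sgn_at N z E * p E"
    "\<And>E. E \<in> Inc N z \<Longrightarrow> dE 2 N E \<phi> z = Y E" "\<And>E. E \<in> Inc N z \<Longrightarrow> inward N E \<phi> z = p E"
proof -
  obtain \<phi> where \<phi>: "\<phi> \<in> Cm 2 N"
    "\<And>E. E \<in> Inc N z \<Longrightarrow> dE 1 N E \<phi> z = sgn_at N z E * p E" "\<And>E. E \<in> Inc N z \<Longrightarrow> dE 2 N E \<phi> z = Y E"
    "\<And>E. E \<in> Inc N z \<Longrightarrow> z \<in> verts N \<Longrightarrow> inward N E \<phi> z = sgn_at N z E * (sgn_at N z E * p E)"
    "\<And>E X. E \<in> Inc N z \<Longrightarrow> X < Y E \<Longrightarrow> \<forall>\<^sub>F t in at (dist (tail N E) z) within {0..elen N E}.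
       \<phi> z + sgn_at N z E * p E * (t - dist (tail N E) z) + X / 2 * (t - dist (tail N E) z)\<^sup>2 \<le> \<phi> (gam N E t)"
    by (rule test_function[OF N, of z "\<lambda>E. sgn_at N z E * p E" Y]) blast
  have "\<forall>\<^sub>F y in at z within body N. u y - \<phi> y \<le> u z - \<phi> z"
  proof (rule eventually_within_body[OF N])
    fix E assume E: "E \<in> Inc N z"
    note E' = endpoint_of_incident_edge(1)[OF N z E]
    let ?T = "dist (tail N E) z"
    have "\<forall>\<^sub>F t in at 0 within {0..elen N E}. u (gam N E (coord_from N z E t))
        \<le> u z + sgn_at N z E * p E * (coord_from N z E t - ?T) + X E / 2 * (coord_from N z E t - ?T)\<^sup>2"
      using jet[OF E] unfolding at_right_0_edge[OF N E'] edge_from_def coord_from_0[OF N z E, symmetric] coord_from_diff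
      by eventually_elim (simp add: power_mult_distrib sgn_at_square mult.assoc mult.left_commute)
    from eventually_coord_from[OF this]
    have "\<forall>\<^sub>F t in at ?T within {0..elen N E}. u (gam N E t) \<le> u z + sgn_at N z E * p E * (t - ?T) + X E / 2 * (t - ?T)\<^sup>2"
      unfolding coord_from_0[OF N z E] .
    with \<phi>(5)[OF E XY[OF E]] show "\<forall>\<^sub>F t in at ?T within {0..elen N E}. u (gam N E t) - \<phi> (gam N E t) \<le> u z - \<phi> z"
      by eventually_elim linarith
  qed
  moreover have "z \<in> body N" using z N body_iff[of z N] unfolding is_network_def by blast
  ultimately have "local_max (body N) (\<lambda>y. u y - \<phi> y) z" unfolding local_max_def by blast
  then show thesis using that \<phi>(1-4) z by (simp add: sgn_at_square)
qed

lemma vertex_test_below: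
  assumes N: "is_network N" and z: "z \<in> verts N"
    and jet: "\<And>E. E \<in> Inc N z \<Longrightarrow> \<forall>\<^sub>F t in at_right 0. v z + p E * t + X E / 2 * t\<^sup>2 \<le> v (edge_from N z E t)"
    and XY: "\<And>E. E \<in> Inc N z \<Longrightarrow> Y E < X E"
  obtains \<phi> where "\<phi> \<in> Cm 2 N" "local_min (body N) (\<lambda>y. v y - \<phi> y) z"
    "\<And>E. E \<in> Inc N z \<Longrightarrow> dE 1 N E \<phi> z = sgn_at N z E * p E"
    "\<And>E. E \<in> Inc N z \<Longrightarrow> dE 2 N E \<phi> z = Y E" "\<And>E. E \<in> Inc N z \<Longrightarrow> inward N E \<phi> z = p E"
proof -
  obtain \<phi> where \<phi>: "\<phi> \<in> Cm 2 N"
    "\<And>E. E \<in> Inc N z \<Longrightarrow> dE 1 N E \<phi> z = sgn_at N z E * p E" "\<And>E. E \<in> Inc N z \<Longrightarrow> dE 2 N E \<phi> z = Y E"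
    "\<And>E. E \<in> Inc N z \<Longrightarrow> z \<in> verts N \<Longrightarrow> inward N E \<phi> z = sgn_at N z E * (sgn_at N z E * p E)"
    "\<And>E X. E \<in> Inc N z \<Longrightarrow> Y E < X \<Longrightarrow> \<forall>\<^sub>F t in at (dist (tail N E) z) within {0..elen N E}.
       \<phi> (gam N E t) \<le> \<phi> z + sgn_at N z E * p E * (t - dist (tail N E) z) + X / 2 * (t - dist (tail N E) z)\<^sup>2"
    by (rule test_function[OF N, of z "\<lambda>E. sgn_at N z E * p E" Y]) blast
  have "\<forall>\<^sub>F y in at z within body N. v z - \<phi> z \<le> v y - \<phi> y"
  proof (rule eventually_within_body[OF N])
    fix E assume E: "E \<in> Inc N z"
    note E' = endpoint_of_incident_edge(1)[OF N z E]
    let ?T = "dist (tail N E) z"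
    have "\<forall>\<^sub>F t in at 0 within {0..elen N E}.
        v z + sgn_at N z E * p E * (coord_from N z E t - ?T) + X E / 2 * (coord_from N z E t - ?T)\<^sup>2
        \<le> v (gam N E (coord_from N z E t))"
      using jet[OF E] unfolding at_right_0_edge[OF N E'] edge_from_def coord_from_0[OF N z E, symmetric] coord_from_diff
      by eventually_elim (simp add: power_mult_distrib sgn_at_square mult.assoc mult.left_commute)
    from eventually_coord_from[OF this]
    have "\<forall>\<^sub>F t in at ?T within {0..elen N E}. v z + sgn_at N z E * p E * (t - ?T) + X E / 2 * (t - ?T)\<^sup>2 \<le> v (gam N E t)"
      unfolding coord_from_0[OF N z E] .
    with \<phi>(5)[OF E XY[OF E]] show "\<forall>\<^sub>F t in at ?T within {0..elen N E}. v z - \<phi> z \<le> v (gam N E t) - \<phi> (gam N E t)"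
      by eventually_elim linarith
  qed
  moreover have "z \<in> body N" using z N body_iff[of z N] unfolding is_network_def by blast
  ultimately have "local_min (body N) (\<lambda>y. v y - \<phi> y) z" unfolding local_min_def by blast
  then show thesis using that \<phi>(1-4) z by (simp add: sgn_at_square)
qed

lemma edge_test_above:
  assumes N: "is_network N" and E: "E \<in> edges N" and t0: "t0 \<in> {0<..<elen N E}"
    and jet: "\<forall>\<^sub>F t in at t0. u (edge_from N z E t) \<le> u (edge_from N z E t0) + p * (t - t0) + X / 2 * (t - t0)\<^sup>2"
    and XY: "X < Y"
  obtains \<phi> where "\<phi> \<in> Cm 2 N" "local_max (body N) (\<lambda>y. u y - \<phi> y) (edge_from N z E t0)"
    "dE 1 N E \<phi> (edge_from N z E t0) = sgn_at N z E * p" "dE 2 N E \<phi> (edge_from N z E t0) = Y"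
proof -
  let ?x = "edge_from N z E t0" let ?r = "coord_from N z E"
  have xE: "?x \<in> E" by (rule edge_from_mem(1)[OF N E t0])
  have Inc: "Inc N ?x = {E}" by (rule Inc_of_edge_point[OF N E xE])
  have T: "dist (tail N E) ?x = ?r t0"
    using t0 coord_from_mem(2)[of N z E t0] unfolding edge_from_def by (intro dist_tail_gam[OF N E]) auto
  obtain \<phi> where \<phi>: "\<phi> \<in> Cm 2 N"
    "\<And>E'. E' \<in> Inc N ?x \<Longrightarrow> dE 1 N E' \<phi> ?x = sgn_at N z E * p" "\<And>E'. E' \<in> Inc N ?x \<Longrightarrow> dE 2 N E' \<phi> ?x = Y"
    "\<And>E' X. E' \<in> Inc N ?x \<Longrightarrow> X < Y \<Longrightarrow> \<forall>\<^sub>F t in at (dist (tail N E') ?x) within {0..elen N E'}.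
       \<phi> ?x + sgn_at N z E * p * (t - dist (tail N E') ?x) + X / 2 * (t - dist (tail N E') ?x)\<^sup>2 \<le> \<phi> (gam N E' t)"
    by (rule test_function[OF N, of ?x "\<lambda>_. sgn_at N z E * p" "\<lambda>_. Y"]) blast
  have "\<forall>\<^sub>F y in at ?x within body N. u y - \<phi> y \<le> u ?x - \<phi> ?x"
  proof (rule eventually_within_body[OF N])
    fix E' assume "E' \<in> Inc N ?x"
    then have E': "E' = E" and EI: "E \<in> Inc N ?x" using Inc by auto
    have "\<forall>\<^sub>F t in at t0 within {0..elen N E}. u (gam N E (?r t))
        \<le> u ?x + sgn_at N z E * p * (?r t - ?r t0) + X / 2 * (?r t - ?r t0)\<^sup>2"
      using filter_leD[OF at_le[of "{0..elen N E}" UNIV t0, OF subset_UNIV] jet] unfolding coord_from_diff edge_from_def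
      by eventually_elim (simp add: power_mult_distrib sgn_at_square mult.assoc mult.left_commute)
    from eventually_coord_from[OF this] \<phi>(4)[OF EI XY]
    show "\<forall>\<^sub>F t in at (dist (tail N E') ?x) within {0..elen N E'}. u (gam N E' t) - \<phi> (gam N E' t) \<le> u ?x - \<phi> ?x"
      unfolding T E' by eventually_elim linarith
  qed
  moreover have "?x \<in> body N" using Inc body_iff by blast
  ultimately have "local_max (body N) (\<lambda>y. u y - \<phi> y) ?x" unfolding local_max_def by blast
  then show thesis using that \<phi>(1-3) Inc by simp
qed

lemma edge_test_below:
  assumes N: "is_network N" and E: "E \<in> edges N" and t0: "t0 \<in> {0<..<elen N E}"
    and jet: "\<forall>\<^sub>F t in at t0. v (edge_from N z E t0) + p * (t - t0) + X / 2 * (t - t0)\<^sup>2 \<le> v (edge_from N z E t)"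
    and XY: "Y < X"
  obtains \<phi> where "\<phi> \<in> Cm 2 N" "local_min (body N) (\<lambda>y. v y - \<phi> y) (edge_from N z E t0)"
    "dE 1 N E \<phi> (edge_from N z E t0) = sgn_at N z E * p" "dE 2 N E \<phi> (edge_from N z E t0) = Y"
proof -
  let ?x = "edge_from N z E t0" let ?r = "coord_from N z E"
  have xE: "?x \<in> E" by (rule edge_from_mem(1)[OF N E t0])
  have Inc: "Inc N ?x = {E}" by (rule Inc_of_edge_point[OF N E xE])
  have T: "dist (tail N E) ?x = ?r t0"
    using t0 coord_from_mem(2)[of N z E t0] unfolding edge_from_def by (intro dist_tail_gam[OF N E]) auto
  obtain \<phi> where \<phi>: "\<phi> \<in> Cm 2 N"
    "\<And>E'. E' \<in> Inc N ?x \<Longrightarrow> dE 1 N E' \<phi> ?x = sgn_at N z E * p" "\<And>E'. E' \<in> Inc N ?x \<Longrightarrow> dE 2 N E' \<phi> ?x = Y"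
    "\<And>E' X. E' \<in> Inc N ?x \<Longrightarrow> Y < X \<Longrightarrow> \<forall>\<^sub>F t in at (dist (tail N E') ?x) within {0..elen N E'}.
       \<phi> (gam N E' t) \<le> \<phi> ?x + sgn_at N z E * p * (t - dist (tail N E') ?x) + X / 2 * (t - dist (tail N E') ?x)\<^sup>2"
    by (rule test_function[OF N, of ?x "\<lambda>_. sgn_at N z E * p" "\<lambda>_. Y"]) blast
  have "\<forall>\<^sub>F y in at ?x within body N. v ?x - \<phi> ?x \<le> v y - \<phi> y"
  proof (rule eventually_within_body[OF N])
    fix E' assume "E' \<in> Inc N ?x"
    then have E': "E' = E" and EI: "E \<in> Inc N ?x" using Inc by auto
    have "\<forall>\<^sub>F t in at t0 within {0..elen N E}.
        v ?x + sgn_at N z E * p * (?r t - ?r t0) + X / 2 * (?r t - ?r t0)\<^sup>2 \<le> v (gam N E (?r t))"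
      using filter_leD[OF at_le[of "{0..elen N E}" UNIV t0, OF subset_UNIV] jet] unfolding coord_from_diff edge_from_def
      by eventually_elim (simp add: power_mult_distrib sgn_at_square mult.assoc mult.left_commute)
    from eventually_coord_from[OF this] \<phi>(4)[OF EI XY]
    show "\<forall>\<^sub>F t in at (dist (tail N E') ?x) within {0..elen N E'}. v ?x - \<phi> ?x \<le> v (gam N E' t) - \<phi> (gam N E' t)"
      unfolding T E' by eventually_elim linarith
  qed
  moreover have "?x \<in> body N" using Inc body_iff by blast
  ultimately have "local_min (body N) (\<lambda>y. v y - \<phi> y) ?x" unfolding local_min_def by blast
  then show thesis using that \<phi>(1-3) Inc by simp
qed

section \<open>The equation on the edges of a network\<close>
locale network_hamiltonian =
  fixes N :: "'a::euclidean_space network"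
    and a :: "'a set \<Rightarrow> 'a \<Rightarrow> real"
    and H :: "'a set \<Rightarrow> 'a \<Rightarrow> real \<Rightarrow> real"
    and F :: "'a \<Rightarrow> real \<Rightarrow> (nat \<Rightarrow> real) \<Rightarrow> real"
    and h :: "'a \<Rightarrow> real"
    and C lam :: real
  assumes N: "is_network N"
    and C: "C > 0"
    and H_x: "\<And>E x y p. E \<in> edges N \<Longrightarrow> x \<in> closure E \<Longrightarrow> y \<in> closure E \<Longrightarrow>
                \<bar>H E x p - H E y p\<bar> \<le> C * (1 + \<bar>p\<bar>) * dist x y"
    and H_p: "\<And>E x p q. E \<in> edges N \<Longrightarrow> x \<in> closure E \<Longrightarrow>
                \<bar>H E x p - H E x q\<bar> \<le> C * \<bar>p - q\<bar>"
    and a_square: "\<And>E. E \<in> edges N \<Longrightarrow>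
                \<exists>\<sigma>. (\<forall>x\<in>closure E. a E x = (\<sigma> x)\<^sup>2) \<and>
                    (\<forall>x\<in>closure E. \<forall>y\<in>closure E. \<bar>\<sigma> x - \<sigma> y\<bar> \<le> C * dist x y)"
    and lam: "lam > 0"
begin

definition sigma :: "'a set \<Rightarrow> 'a \<Rightarrow> real" where
  "sigma E = (SOME \<sigma>. (\<forall>x\<in>closure E. a E x = (\<sigma> x)\<^sup>2) \<and>
                    (\<forall>x\<in>closure E. \<forall>y\<in>closure E. \<bar>\<sigma> x - \<sigma> y\<bar> \<le> C * dist x y))"

lemma sigma:
  assumes "E \<in> edges N"
  shows "x \<in> closure E \<Longrightarrow> a E x = (sigma E x)\<^sup>2"
    "x \<in> closure E \<Longrightarrow> y \<in> closure E \<Longrightarrow> \<bar>sigma E x - sigma E y\<bar> \<le> C * dist x y"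
  using someI_ex[OF a_square[OF assms], folded sigma_def] by blast+

definition sigma_from :: "'a \<Rightarrow> 'a set \<Rightarrow> real \<Rightarrow> real" where
  "sigma_from z E t = sigma E (edge_from N z E t)"

definition H_from :: "'a \<Rightarrow> 'a set \<Rightarrow> real \<Rightarrow> real \<Rightarrow> real" where
  "H_from z E t p = H E (edge_from N z E t) (sgn_at N z E * p)"

lemma edge_eq_from:
  assumes E: "E \<in> edges N"
  shows "edge_eq (elen N E) C lam (sigma_from z E) (H_from z E)"
proof
  show "0 < elen N E" by (rule edge_structure(1)[OF N E])
  show "0 < C" "0 < lam" by (fact C lam)+
  note m = edge_from_mem(2)[OF N E]
  show "\<bar>H_from z E x p - H_from z E y p\<bar> \<le> C * (1 + \<bar>p\<bar>) * \<bar>x - y\<bar>"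
    if "x \<in> {0..elen N E}" "y \<in> {0..elen N E}" for x y p
    using H_x[OF E m[OF that(1)] m[OF that(2)], of z "sgn_at N z E * p" z]
    unfolding H_from_def dist_edge_from[OF N E] by (simp add: abs_mult sgn_at_square(3))
  show "\<bar>H_from z E x p - H_from z E x q\<bar> \<le> C * \<bar>p - q\<bar>" if "x \<in> {0..elen N E}" for x p q
    using H_p[OF E m[OF that], of z "sgn_at N z E * p" "sgn_at N z E * q"] unfolding H_from_def
    by (simp add: right_diff_distrib[symmetric] abs_mult sgn_at_square(3))
  show "\<bar>sigma_from z E x - sigma_from z E y\<bar> \<le> C * \<bar>x - y\<bar>"
    if "x \<in> {0..elen N E}" "y \<in> {0..elen N E}" for x y
    using sigma(2)[OF E m[OF that(1)] m[OF that(2)], of z z] unfolding sigma_from_def dist_edge_from[OF N E] .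
qed

lemma G_from:
  assumes E: "E \<in> edges N" and t: "t \<in> {0..elen N E}"
  shows "edge_eq.G lam (sigma_from z E) (H_from z E) r p X t
    = G_op lam a H E r (sgn_at N z E * p) X (edge_from N z E t)"
  unfolding edge_eq.G_def[OF edge_eq_from[OF E]] G_op_def
  using sigma(1)[OF E edge_from_mem(2)[OF N E t]] by (simp add: sigma_from_def H_from_def)

lemma G_from_0:
  assumes z: "z \<in> verts N" and E: "E \<in> Inc N z"
  shows "edge_eq.G lam (sigma_from z E) (H_from z E) r p X 0 = G_op lam a H E r (sgn_at N z E * p) X z"
proof -
  note E' = endpoint_of_incident_edge(1)[OF N z E]
  have "0 \<in> {0..elen N E}" using edge_structure(1)[OF N E'] by simp
  from G_from[OF E' this, where z = z] show ?thesis by (simp add: edge_from_0[OF N z E])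
qed

lemma usc_edge_from:
  assumes "E \<in> edges N" "usc_on {0..elen N E} (on_edge N E w)"
  shows "usc_on {0..elen N E} (\<lambda>t. w (edge_from N z E t))"
proof -
  have "usc_on {0..elen N E} (\<lambda>t. on_edge N E w (coord_from N z E t))"
  proof (rule usc_on_compose[OF assms(2)])
    show "continuous_on {0..elen N E} (coord_from N z E)"
      unfolding coord_from_def by (cases "z = tail N E") (auto intro!: continuous_intros)
    show "coord_from N z E ` {0..elen N E} \<subseteq> {0..elen N E}" using coord_from_mem(1) by blast
  qed
  then show ?thesis by (simp add: on_edge_def edge_from_def)
qed

text \<open>The function \<open>w\<close> is \<open>u\<close> or its regularization, which differs from \<open>u\<close> only at vertices.\<close>
lemma subsol_from:
  assumes u: "viscosity_subsolution N lam a H F h u" and E: "E \<in> edges N"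
    and w: "usc_on {0..elen N E} (on_edge N E w)" and wu: "\<And>x. x \<in> E \<Longrightarrow> w x = u x"
  shows "edge_eq.subsol (elen N E) lam (sigma_from z E) (H_from z E) (\<lambda>t. w (edge_from N z E t))"
proof -
  interpret e: edge_eq "elen N E" C lam "sigma_from z E" "H_from z E" by (rule edge_eq_from[OF E])
  show ?thesis unfolding e.subsol_def
  proof (intro conjI ballI allI impI)
    show "usc_on {0..elen N E} (\<lambda>t. w (edge_from N z E t))" by (rule usc_edge_from[OF E w])
    fix t0 p X assume t0: "t0 \<in> {0<..<elen N E}"
      and touch: "\<forall>\<^sub>F t in at t0. w (edge_from N z E t) \<le> w (edge_from N z E t0) + p * (t - t0) + X / 2 * (t - t0)\<^sup>2"
    let ?x = "edge_from N z E t0"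
    have t0': "t0 \<in> {0..elen N E}" using t0 by auto
    have xE: "?x \<in> E" by (rule edge_from_mem(1)[OF N E t0])
    have "\<forall>\<^sub>F t in at t0. t \<in> {0<..<elen N E}"
      using eventually_at_in_open'[OF open_greaterThanLessThan t0] .
    with touch have jet: "\<forall>\<^sub>F t in at t0. u (edge_from N z E t) \<le> u ?x + p * (t - t0) + X / 2 * (t - t0)\<^sup>2"
    proof eventually_elim
      case (elim t)
      then show ?case using wu[OF edge_from_mem(1)[OF N E elim(2)]] wu[OF xE] by simp
    qed
    show "e.G (w ?x) p X t0 \<le> 0"
    proof (rule ccontr)
      assume "\<not> ?thesis"
      then obtain Y where Y: "X < Y" "e.G (w ?x) p Y t0 > 0" using e.G_bump by (metis not_le)
      obtain \<phi> where "\<phi> \<in> Cm 2 N" "local_max (body N) (\<lambda>y. u y - \<phi> y) ?x"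
        "dE 1 N E \<phi> ?x = sgn_at N z E * p" "dE 2 N E \<phi> ?x = Y"
        using edge_test_above[OF N E t0 jet Y(1)] .
      then have "G_op lam a H E (u ?x) (sgn_at N z E * p) Y ?x \<le> 0"
        using u E xE unfolding viscosity_subsolution_def by metis
      then show False using Y(2) unfolding G_from[OF E t0'] wu[OF xE] by simp
    qed
  qed
qed

lemma supersol_from:
  assumes v: "viscosity_supersolution N lam a H F h v" and E: "E \<in> edges N"
  shows "edge_eq.supersol (elen N E) lam (sigma_from z E) (H_from z E) (\<lambda>t. v (edge_from N z E t))"
proof -
  interpret e: edge_eq "elen N E" C lam "sigma_from z E" "H_from z E" by (rule edge_eq_from[OF E])
  show ?thesis unfolding e.supersol_def
  proof (intro conjI ballI allI impI)
    have "lsc_on {0..elen N E} (on_edge N E v)"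
      using v E unfolding viscosity_supersolution_def LSC_def by blast
    then have "usc_on {0..elen N E} (on_edge N E (\<lambda>x. - v x))" unfolding lsc_on_iff on_edge_def .
    from usc_edge_from[OF E this] show "lsc_on {0..elen N E} (\<lambda>t. v (edge_from N z E t))"
      unfolding lsc_on_iff .
    fix t0 p X assume t0: "t0 \<in> {0<..<elen N E}"
      and jet: "\<forall>\<^sub>F t in at t0. v (edge_from N z E t0) + p * (t - t0) + X / 2 * (t - t0)\<^sup>2 \<le> v (edge_from N z E t)"
    let ?x = "edge_from N z E t0"
    have t0': "t0 \<in> {0..elen N E}" using t0 by auto
    have xE: "?x \<in> E" by (rule edge_from_mem(1)[OF N E t0])
    show "0 \<le> e.G (v ?x) p X t0"
    proof (rule ccontr)
      assume "\<not> ?thesis"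
      then obtain Y where Y: "Y < X" "e.G (v ?x) p Y t0 < 0" using e.G_dip by (metis not_le)
      obtain \<phi> where "\<phi> \<in> Cm 2 N" "local_min (body N) (\<lambda>y. v y - \<phi> y) ?x"
        "dE 1 N E \<phi> ?x = sgn_at N z E * p" "dE 2 N E \<phi> ?x = Y"
        using edge_test_below[OF N E t0 jet Y(1)] .
      then have "G_op lam a H E (v ?x) (sgn_at N z E * p) Y ?x \<ge> 0"
        using v E xE unfolding viscosity_supersolution_def by metis
      then show False using Y(2) unfolding G_from[OF E t0'] by simp
    qed
  qed
qed

text \<open>Coercivity is insensitive to the orientation, because \<open>\<bar>p\<bar>\<close> is.\<close>
lemma nondegenerate_from:
  assumes z: "z \<in> verts N" and E: "E \<in> Inc N z"
    and nd: "(\<exists>U. openin (top_of_set (closure E)) U \<and> z \<in> U \<and> (\<forall>x\<in>U. \<forall>p. c * \<bar>p\<bar> - d \<le> H E x p)) \<or> a E z > 0"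
    and c: "c > 0"
  shows "sigma_from z E 0 \<noteq> 0 \<or> edge_eq.coercive (elen N E) (H_from z E)"
proof -
  note E' = endpoint_of_incident_edge(1,2)[OF N z E]
  interpret e: edge_eq "elen N E" C lam "sigma_from z E" "H_from z E" by (rule edge_eq_from[OF E'(1)])
  from nd show ?thesis
  proof
    assume "a E z > 0"
    then have "sigma E z \<noteq> 0" using sigma(1)[OF E'] by auto
    then show ?thesis by (simp add: sigma_from_def edge_from_0[OF N z E])
  next
    assume "\<exists>U. openin (top_of_set (closure E)) U \<and> z \<in> U \<and> (\<forall>x\<in>U. \<forall>p. c * \<bar>p\<bar> - d \<le> H E x p)"
    then obtain U where U: "openin (top_of_set (closure E)) U" "z \<in> U"
      "\<And>x p. x \<in> U \<Longrightarrow> c * \<bar>p\<bar> - d \<le> H E x p" by blast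
    obtain \<delta> where \<delta>: "\<delta> > 0" "\<And>x. x \<in> closure E \<Longrightarrow> dist x z < \<delta> \<Longrightarrow> x \<in> U"
      using U(1,2) unfolding openin_euclidean_subtopology_iff by blast
    have "c * \<bar>p\<bar> - d \<le> H_from z E t p" if t: "t \<in> {0..elen N E}" "t < \<delta>" for t p
    proof -
      have "dist (edge_from N z E t) z < \<delta>"
        using dist_edge_from[OF N E'(1), of z t 0] edge_from_0[OF N z E] t by simp
      then have "edge_from N z E t \<in> U" using \<delta>(2) edge_from_mem(2)[OF N E'(1) t(1)] by blast
      from U(3)[OF this, of "sgn_at N z E * p"] show ?thesis
        by (simp add: H_from_def abs_mult sgn_at_square(3))
    qed
    then have "e.coercive" unfolding e.coercive_def using c \<delta>(1) by blast
    then show ?thesis by blast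
  qed
qed

text \<open>Touching jets for which the equation on the edge is violated strictly, so that only the
  vertex condition can hold; \<open>p\<close> is the inward slope.\<close>
definition jet_above :: "('a \<Rightarrow> real) \<Rightarrow> 'a \<Rightarrow> 'a set \<Rightarrow> real \<Rightarrow> real \<Rightarrow> bool" where
  "jet_above u z E p X \<longleftrightarrow> (\<forall>\<^sub>F t in at_right 0. u (edge_from N z E t) \<le> u z + p * t + X / 2 * t\<^sup>2) \<and>
     0 < G_op lam a H E (u z) (sgn_at N z E * p) X z"

definition jet_below :: "('a \<Rightarrow> real) \<Rightarrow> 'a \<Rightarrow> 'a set \<Rightarrow> real \<Rightarrow> real \<Rightarrow> bool" where
  "jet_below v z E p X \<longleftrightarrow> (\<forall>\<^sub>F t in at_right 0. v z + p * t + X / 2 * t\<^sup>2 \<le> v (edge_from N z E t)) \<and>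
     G_op lam a H E (v z) (sgn_at N z E * p) X z < 0"

lemma vertex_condition_above:
  assumes u: "viscosity_subsolution N lam a H F h u" and z: "z \<in> verts N"
    and jet: "\<And>E. E \<in> Inc N z \<Longrightarrow> jet_above u z E (p E) (X E)"
  shows "z \<in> interior_verts N \<Longrightarrow> F z (u z) (\<lambda>i\<in>{1..deg N z}. p (inc_edge N z i)) \<le> 0"
    and "z \<in> boundary_verts N \<Longrightarrow> u z \<le> h z"
proof -
  have "\<exists>Y. X E < Y \<and> 0 < G_op lam a H E (u z) (sgn_at N z E * p E) Y z" if E: "E \<in> Inc N z" for E
  proof -
    interpret e: edge_eq "elen N E" C lam "sigma_from z E" "H_from z E"
      by (rule edge_eq_from[OF endpoint_of_incident_edge(1)[OF N z E]])
    have "e.G (u z) (p E) (X E) 0 > 0" using jet[OF E] unfolding jet_above_def G_from_0[OF z E] by blast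
    then show ?thesis by (rule e.G_bump) (unfold G_from_0[OF z E], blast)
  qed
  then obtain Y where Y: "\<And>E. E \<in> Inc N z \<Longrightarrow> X E < Y E"
    "\<And>E. E \<in> Inc N z \<Longrightarrow> 0 < G_op lam a H E (u z) (sgn_at N z E * p E) (Y E) z" by metis
  obtain \<phi> where \<phi>: "\<phi> \<in> Cm 2 N" "local_max (body N) (\<lambda>y. u y - \<phi> y) z"
    "\<And>E. E \<in> Inc N z \<Longrightarrow> dE 1 N E \<phi> z = sgn_at N z E * p E"
    "\<And>E. E \<in> Inc N z \<Longrightarrow> dE 2 N E \<phi> z = Y E" "\<And>E. E \<in> Inc N z \<Longrightarrow> inward N E \<phi> z = p E"
  proof (rule vertex_test_above[OF N z])
    show "\<forall>\<^sub>F t in at_right 0. u (edge_from N z E t) \<le> u z + p E * t + X E / 2 * t\<^sup>2" if "E \<in> Inc N z" for E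
      using jet[OF that] unfolding jet_above_def by blast
    show "X E < Y E" if "E \<in> Inc N z" for E by (rule Y(1)[OF that])
  qed blast
  have pos: "G_op lam a H E (u z) (dE 1 N E \<phi> z) (dE 2 N E \<phi> z) z > 0" if "E \<in> Inc N z" for E
    using Y(2)[OF that] \<phi>(3,4)[OF that] by simp
  have Inc: "finite (Inc N z)" "Inc N z \<noteq> {}" using N z unfolding is_network_def Inc_def by auto
  show "F z (u z) (\<lambda>i\<in>{1..deg N z}. p (inc_edge N z i)) \<le> 0" if zi: "z \<in> interior_verts N"
  proof -
    let ?S = "(\<lambda>E. G_op lam a H E (u z) (dE 1 N E \<phi> z) (dE 2 N E \<phi> z) z) ` Inc N z"
    have "min (Min ?S) (F z (u z) (inward_vec N \<phi> z)) \<le> 0"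
      using u \<phi>(1,2) zi unfolding viscosity_subsolution_def by blast
    moreover have "Min ?S > 0" using Inc pos by (subst Min_gr_iff) auto
    moreover have "inward_vec N \<phi> z = (\<lambda>i\<in>{1..deg N z}. p (inc_edge N z i))"
      unfolding inward_vec_def
    proof (rule restrict_ext)
      fix i assume "i \<in> {1..deg N z}"
      moreover have "bij_betw (inc_edge N z) {1..deg N z} (Inc N z)" using N zi unfolding is_network_def by blast
      ultimately have "inc_edge N z i \<in> Inc N z" by (metis bij_betw_apply)
      then show "inward N (inc_edge N z i) \<phi> z = p (inc_edge N z i)" by (rule \<phi>(5))
    qed
    ultimately show ?thesis by simp
  qed
  show "u z \<le> h z" if zb: "z \<in> boundary_verts N"
  proof -
    obtain E where E: "E \<in> Inc N z" using Inc by blast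
    have "min (G_op lam a H E (u z) (dE 1 N E \<phi> z) (dE 2 N E \<phi> z) z) (u z - h z) \<le> 0"
      using u \<phi>(1,2) zb E unfolding viscosity_subsolution_def by blast
    then show ?thesis using pos[OF E] by (simp add: min_le_iff_disj)
  qed
qed

lemma vertex_condition_below:
  assumes v: "viscosity_supersolution N lam a H F h v" and z: "z \<in> verts N"
    and jet: "\<And>E. E \<in> Inc N z \<Longrightarrow> jet_below v z E (p E) (X E)"
  shows "z \<in> interior_verts N \<Longrightarrow> 0 \<le> F z (v z) (\<lambda>i\<in>{1..deg N z}. p (inc_edge N z i))"
    and "z \<in> boundary_verts N \<Longrightarrow> h z \<le> v z"
proof -
  have "\<exists>Y. Y < X E \<and> G_op lam a H E (v z) (sgn_at N z E * p E) Y z < 0" if E: "E \<in> Inc N z" for E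
  proof -
    interpret e: edge_eq "elen N E" C lam "sigma_from z E" "H_from z E"
      by (rule edge_eq_from[OF endpoint_of_incident_edge(1)[OF N z E]])
    have "e.G (v z) (p E) (X E) 0 < 0" using jet[OF E] unfolding jet_below_def G_from_0[OF z E] by blast
    then show ?thesis by (rule e.G_dip) (unfold G_from_0[OF z E], blast)
  qed
  then obtain Y where Y: "\<And>E. E \<in> Inc N z \<Longrightarrow> Y E < X E"
    "\<And>E. E \<in> Inc N z \<Longrightarrow> G_op lam a H E (v z) (sgn_at N z E * p E) (Y E) z < 0" by metis
  obtain \<phi> where \<phi>: "\<phi> \<in> Cm 2 N" "local_min (body N) (\<lambda>y. v y - \<phi> y) z"
    "\<And>E. E \<in> Inc N z \<Longrightarrow> dE 1 N E \<phi> z = sgn_at N z E * p E"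
    "\<And>E. E \<in> Inc N z \<Longrightarrow> dE 2 N E \<phi> z = Y E" "\<And>E. E \<in> Inc N z \<Longrightarrow> inward N E \<phi> z = p E"
  proof (rule vertex_test_below[OF N z])
    show "\<forall>\<^sub>F t in at_right 0. v z + p E * t + X E / 2 * t\<^sup>2 \<le> v (edge_from N z E t)" if "E \<in> Inc N z" for E
      using jet[OF that] unfolding jet_below_def by blast
    show "Y E < X E" if "E \<in> Inc N z" for E by (rule Y(1)[OF that])
  qed blast
  have neg: "G_op lam a H E (v z) (dE 1 N E \<phi> z) (dE 2 N E \<phi> z) z < 0" if "E \<in> Inc N z" for E
    using Y(2)[OF that] \<phi>(3,4)[OF that] by simp
  have Inc: "finite (Inc N z)" "Inc N z \<noteq> {}" using N z unfolding is_network_def Inc_def by auto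
  show "0 \<le> F z (v z) (\<lambda>i\<in>{1..deg N z}. p (inc_edge N z i))" if zi: "z \<in> interior_verts N"
  proof -
    let ?S = "(\<lambda>E. G_op lam a H E (v z) (dE 1 N E \<phi> z) (dE 2 N E \<phi> z) z) ` Inc N z"
    have "max (Max ?S) (F z (v z) (inward_vec N \<phi> z)) \<ge> 0"
      using v \<phi>(1,2) zi unfolding viscosity_supersolution_def by blast
    moreover have "Max ?S < 0" using Inc neg by (subst Max_less_iff) auto
    moreover have "inward_vec N \<phi> z = (\<lambda>i\<in>{1..deg N z}. p (inc_edge N z i))"
      unfolding inward_vec_def
    proof (rule restrict_ext)
      fix i assume "i \<in> {1..deg N z}"
      moreover have "bij_betw (inc_edge N z) {1..deg N z} (Inc N z)" using N zi unfolding is_network_def by blast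
      ultimately have "inc_edge N z i \<in> Inc N z" by (metis bij_betw_apply)
      then show "inward N (inc_edge N z i) \<phi> z = p (inc_edge N z i)" by (rule \<phi>(5))
    qed
    ultimately show ?thesis by simp
  qed
  show "h z \<le> v z" if zb: "z \<in> boundary_verts N"
  proof -
    obtain E where E: "E \<in> Inc N z" using Inc by blast
    have "max (G_op lam a H E (v z) (dE 1 N E \<phi> z) (dE 2 N E \<phi> z) z) (v z - h z) \<ge> 0"
      using v \<phi>(1,2) zb E unfolding viscosity_supersolution_def by blast
    then show ?thesis using neg[OF E] by (simp add: le_max_iff_disj)
  qed
qed

end

section \<open>Boundary regularization\<close>

lemma bdry_reg_off_boundary: "x \<notin> boundary_verts N \<Longrightarrow> bdry_reg N u x = u x"
  by (simp add: bdry_reg_def)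

lemma boundary_Inc:
  assumes "z \<in> boundary_verts N"
  obtains E where "Inc N z = {E}"
  using assms unfolding boundary_verts_def deg_def by (auto simp: card_1_singleton_iff)

lemma bdry_reg_Limsup:
  assumes N: "is_network N" and z: "z \<in> boundary_verts N" and Inc: "Inc N z = {E}"
    and B: "\<And>x. x \<in> body N \<Longrightarrow> \<bar>u x\<bar> \<le> B"
  shows "ereal (bdry_reg N u z) = Limsup (at z within E) (\<lambda>y. ereal (u y))"
    "\<bar>bdry_reg N u z\<bar> \<le> B"
proof -
  let ?L = "Limsup (at z within E) (\<lambda>y. ereal (u y))"
  have E: "E \<in> edges N" "z \<in> closure E" using Inc by (auto simp: Inc_def)
  note nt = edge_limit_nontrivial[OF N E]
  have ev: "\<forall>\<^sub>F y in at z within E. \<bar>u y\<bar> \<le> B"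
    unfolding eventually_at_filter
    using B E closure_subset[of E] unfolding body_def by (intro always_eventually) blast
  have "?L \<le> ereal B" using ev by (intro Limsup_bounded) (auto elim: eventually_mono)
  moreover have "ereal (- B) \<le> ?L"
  proof -
    have "\<forall>\<^sub>F y in at z within E. ereal (- B) \<le> ereal (u y)" using ev by eventually_elim auto
    then have "ereal (- B) \<le> Liminf (at z within E) (\<lambda>y. ereal (u y))" by (rule Liminf_bounded)
    also have "\<dots> \<le> ?L" by (rule Liminf_le_Limsup) (rule nt)
    finally show ?thesis .
  qed
  ultimately obtain l where l: "?L = ereal l" "\<bar>l\<bar> \<le> B" by (cases ?L) auto
  have "bdry_reg N u z = l" using z by (simp add: bdry_reg_def Inc l)
  then show "ereal (bdry_reg N u z) = ?L" "\<bar>bdry_reg N u z\<bar> \<le> B" using l by auto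
qed

lemma bdry_reg_limsup_from:
  assumes N: "is_network N" and z: "z \<in> boundary_verts N" and Inc: "Inc N z = {E}"
    and B: "\<And>x. x \<in> body N \<Longrightarrow> \<bar>u x\<bar> \<le> B"
  shows "bdry_reg N u z < c \<Longrightarrow> \<forall>\<^sub>F t in at_right 0. u (edge_from N z E t) < c"
    and "c < bdry_reg N u z \<Longrightarrow> \<exists>\<^sub>F t in at_right 0. c < u (edge_from N z E t)"
proof -
  note L = bdry_reg_Limsup(1)[OF N z Inc B]
  have zv: "z \<in> verts N" and EI: "E \<in> Inc N z" using z Inc by (auto simp: boundary_verts_def)
  note E = endpoint_of_incident_edge(1,2)[OF N zv EI]
  have el: "0 < elen N E" by (rule edge_structure(1)[OF N E(1)])
  have zE: "z \<notin> E" using edge_verts_disjoint[OF N E(1)] zv by blast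
  have near: "\<forall>\<^sub>F t in at_right 0. t \<in> {0<..<elen N E}"
    unfolding eventually_at_right_field using el by (intro exI[of _ "elen N E"]) auto
  have d0: "dist z (edge_from N z E t) = \<bar>t\<bar>" for t using dist_edge_from[OF N E(1), of z 0 t] edge_from_0[OF N zv EI] by simp
  show "\<forall>\<^sub>F t in at_right 0. u (edge_from N z E t) < c" if c: "bdry_reg N u z < c"
  proof -
    have "Limsup (at z within E) (\<lambda>y. ereal (u y)) < ereal c" using c L[symmetric] by simp
    then have "\<forall>\<^sub>F y in at z within E. ereal (u y) < ereal c" by (rule Limsup_lessD)
    then have ev: "\<forall>\<^sub>F y in at z within E. u y < c" by simp
    have "filterlim (edge_from N z E) (at z within E) (at_right 0)"
      unfolding filterlim_at
    proof
      show "(edge_from N z E \<longlongrightarrow> z) (at_right 0)"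
      proof (rule tendstoI)
        fix e :: real assume "e > 0"
        then have "\<forall>\<^sub>F t in at_right (0::real). t < e" unfolding eventually_at_right_field by blast
        with near show "\<forall>\<^sub>F t in at_right 0. dist (edge_from N z E t) z < e"
          by eventually_elim (simp add: dist_commute[of _ z] d0)
      qed
      show "\<forall>\<^sub>F t in at_right 0. edge_from N z E t \<in> E \<and> edge_from N z E t \<noteq> z"
        using near by eventually_elim (use edge_from_mem(1)[OF N E(1)] zE in metis)
    qed
    from eventually_compose_filterlim[OF ev this] show ?thesis .
  qed
  show "\<exists>\<^sub>F t in at_right 0. c < u (edge_from N z E t)" if c: "c < bdry_reg N u z"
  proof (rule ccontr)
    assume "\<not> ?thesis"
    then have ev: "\<forall>\<^sub>F t in at_right 0. u (edge_from N z E t) \<le> c" by (simp add: frequently_def not_less)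
    have "filterlim (\<lambda>y. dist z y) (at_right 0) (at z within E)"
      unfolding filterlim_at
    proof
      have "((\<lambda>y. dist z y) \<longlongrightarrow> dist z z) (at z within E)" by (intro tendsto_intros)
      then show "((\<lambda>y. dist z y) \<longlongrightarrow> 0) (at z within E)" by simp
      show "\<forall>\<^sub>F y in at z within E. dist z y \<in> {0<..} \<and> dist z y \<noteq> 0"
        unfolding eventually_at_filter using zE by (intro always_eventually) auto
    qed
    from eventually_compose_filterlim[OF ev this]
    have "\<forall>\<^sub>F y in at z within E. u (edge_from N z E (dist z y)) \<le> c" .
    then have "\<forall>\<^sub>F y in at z within E. ereal (u y) \<le> ereal c"
      unfolding eventually_at_filter
      by eventually_elim (use edge_from_surj(2)[OF N zv EI] closure_subset[of E] in auto)
    then have "Limsup (at z within E) (\<lambda>y. ereal (u y)) \<le> ereal c" by (rule Limsup_bounded)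
    then show False using c L[symmetric] by simp
  qed
qed

lemma bdry_reg_le:
  assumes N: "is_network N" and u: "u \<in> USC N" and B: "\<And>x. x \<in> body N \<Longrightarrow> \<bar>u x\<bar> \<le> B"
    and x: "x \<in> body N"
  shows "bdry_reg N u x \<le> u x"
proof (cases "x \<in> boundary_verts N")
  case True
  then obtain E where Inc: "Inc N x = {E}" by (rule boundary_Inc)
  have xv: "x \<in> verts N" and EI: "E \<in> Inc N x" using True Inc by (auto simp: boundary_verts_def)
  note E = endpoint_of_incident_edge(1)[OF N xv EI]
  show ?thesis
  proof (rule ccontr)
    assume "\<not> ?thesis"
    then obtain c where c: "u x < c" "c < bdry_reg N u x" using dense by (metis not_le)
    have "usc_on {0..elen N E} (on_edge N E u)" using u E by (simp add: USC_def)
    moreover have "on_edge N E u (coord_from N x E 0) = u x"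
      using edge_from_0[OF N xv EI] by (simp add: on_edge_def edge_from_def)
    moreover have "coord_from N x E 0 \<in> {0..elen N E}"
      using edge_structure(1)[OF N E] by (simp add: coord_from_def)
    ultimately have "\<forall>\<^sub>F t in at (coord_from N x E 0) within {0..elen N E}. on_edge N E u t < c"
      using c(1) unfolding usc_on_def by metis
    then have "\<forall>\<^sub>F t in at (coord_from N x E (coord_from N x E (coord_from N x E 0))) within {0..elen N E}.
        on_edge N E u (coord_from N x E (coord_from N x E t)) < c"
      by (simp add: coord_from_coord_from)
    then have "\<forall>\<^sub>F t in at (coord_from N x E (coord_from N x E 0)) within {0..elen N E}.
        on_edge N E u (coord_from N x E t) < c"
      using eventually_coord_from[where ?t0.0 = "coord_from N x E 0" and z = x and N = N and E = E
          and P = "\<lambda>t. on_edge N E u (coord_from N x E t) < c"]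
      by (simp add: coord_from_coord_from)
    then have "\<forall>\<^sub>F t in at_right 0. u (edge_from N x E t) < c"
      by (simp add: coord_from_coord_from at_right_0_edge[OF N E] on_edge_def edge_from_def)
    then have "\<forall>\<^sub>F t in at_right 0. \<not> c < u (edge_from N x E t)" by eventually_elim simp
    then show False using bdry_reg_limsup_from(2)[where u = u, OF N True Inc B c(2)]
      by (simp add: frequently_def)
  qed
qed (simp add: bdry_reg_off_boundary)

text \<open>Passing to the upper limit does not destroy upper semicontinuity, since the regularization
  only changes finitely many values, and lowers them.\<close>
lemma bdry_reg_USC:
  assumes N: "is_network N" and u: "u \<in> USC N" and B: "\<And>x. x \<in> body N \<Longrightarrow> \<bar>u x\<bar> \<le> B"
  shows "bdry_reg N u \<in> USC N"
  unfolding USC_def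
proof (clarify, unfold usc_on_def, intro ballI allI impI)
  fix E t0 c assume E: "E \<in> edges N" and t0: "t0 \<in> {0..elen N E}" and c: "on_edge N E (bdry_reg N u) t0 < c"
  let ?x = "gam N E t0"
  have xE: "?x \<in> closure E" unfolding edge_structure(6)[OF N E] using t0 by blast
  have le: "on_edge N E (bdry_reg N u) t \<le> on_edge N E u t" if "t \<in> {0..elen N E}" for t
  proof -
    have "gam N E t \<in> closure E" unfolding edge_structure(6)[OF N E] using that by blast
    then have "gam N E t \<in> body N" using E by (auto simp: body_def)
    from bdry_reg_le[OF N u B this] show ?thesis by (simp add: on_edge_def)
  qed
  have "\<forall>\<^sub>F t in at t0 within {0..elen N E}. on_edge N E u t < c"
  proof (cases "?x \<in> boundary_verts N")
    case False
    then have "on_edge N E u t0 < c" using c by (simp add: on_edge_def bdry_reg_off_boundary)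
    then show ?thesis using u E t0 unfolding USC_def usc_on_def by blast
  next
    case True
    have EI: "E \<in> Inc N ?x" using E xE by (simp add: Inc_def)
    then have Inc: "Inc N ?x = {E}" using True boundary_Inc by (metis singletonD)
    have xv: "?x \<in> verts N" using True by (simp add: boundary_verts_def)
    have T: "coord_from N ?x E 0 = t0"
      unfolding coord_from_0[OF N xv EI] using t0 by (simp add: dist_tail_gam[OF N E])
    have "\<forall>\<^sub>F t in at 0 within {0..elen N E}. on_edge N E u (coord_from N ?x E t) < c"
      using bdry_reg_limsup_from(1)[where u = u and c = c, OF N True Inc B] c
      unfolding at_right_0_edge[OF N E] edge_from_def on_edge_def by blast
    from eventually_coord_from[OF this] show ?thesis unfolding T .
  qed
  moreover have "\<forall>\<^sub>F t in at t0 within {0..elen N E}. t \<in> {0..elen N E}" by (simp add: eventually_at_filter)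
  ultimately show "\<forall>\<^sub>F t in at t0 within {0..elen N E}. on_edge N E (bdry_reg N u) t < c"
    by eventually_elim (use le in force)
qed

section \<open>Comparison\<close>
locale network_comparison = network_hamiltonian +
  fixes u v :: "'a \<Rightarrow> real" and c d B :: real
  assumes F_mono: "\<And>z r s p q. z \<in> interior_verts N \<Longrightarrow>
                p \<in> extensional {1..deg N z} \<Longrightarrow> q \<in> extensional {1..deg N z} \<Longrightarrow>
                r \<ge> s \<Longrightarrow> (\<forall>i\<in>{1..deg N z}. p i \<le> q i) \<Longrightarrow>
                F z r p \<ge> F z s q \<and>
                ((\<exists>j\<in>{1..deg N z}. p j < q j) \<longrightarrow> F z r p > F z s q)"
    and F_coercive: "\<And>z r p i. z \<in> interior_verts N \<Longrightarrow>
                p \<in> extensional {1..deg N z} \<Longrightarrow> i \<in> {1..deg N z} \<Longrightarrow>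
                filterlim (\<lambda>t. F z r (p(i := t))) at_top at_bot"
    and c: "c > 0"
    and vertex_cond: "\<And>z E. z \<in> verts N \<Longrightarrow> E \<in> Inc N z \<Longrightarrow>
                (\<exists>U. openin (top_of_set (closure E)) U \<and> z \<in> U \<and>
                     (\<forall>x\<in>U. \<forall>p. c * \<bar>p\<bar> - d \<le> H E x p)) \<or> a E z > 0"
    and sub: "viscosity_subsolution N lam a H F h u" and u_bdd: "\<And>x. x \<in> body N \<Longrightarrow> \<bar>u x\<bar> \<le> B"
    and super: "viscosity_supersolution N lam a H F h v" and v_bdd: "\<And>x. x \<in> body N \<Longrightarrow> \<bar>v x\<bar> \<le> B"
begin

abbreviation ub :: "'a \<Rightarrow> real" where "ub \<equiv> bdry_reg N u"

lemma u_USC: "u \<in> USC N"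
  using sub by (simp add: viscosity_subsolution_def)

lemma ub_bdd:
  assumes "x \<in> body N" shows "\<bar>ub x\<bar> \<le> B"
proof (cases "x \<in> boundary_verts N")
  case True
  then obtain E where "Inc N x = {E}" by (rule boundary_Inc)
  from bdry_reg_Limsup(2)[where u = u, OF N True this u_bdd] show ?thesis .
qed (use u_bdd assms in \<open>simp add: bdry_reg_off_boundary\<close>)

lemma ub_usc: "E \<in> edges N \<Longrightarrow> usc_on {0..elen N E} (on_edge N E ub)"
  using bdry_reg_USC[where u = u, OF N u_USC u_bdd] by (simp add: USC_def)

lemma ub_on_edge: "E \<in> edges N \<Longrightarrow> x \<in> E \<Longrightarrow> ub x = u x"
  using edge_verts_disjoint[OF N, of E] by (intro bdry_reg_off_boundary) (auto simp: boundary_verts_def)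

lemma edge_from_in_body: "E \<in> edges N \<Longrightarrow> t \<in> {0..elen N E} \<Longrightarrow> edge_from N z E t \<in> body N"
  using edge_from_mem(2)[OF N, of E t z] by (auto simp: body_def)

lemma vert_in_body: "z \<in> verts N \<Longrightarrow> z \<in> body N"
  using N body_iff[of z N] unfolding is_network_def by blast

lemma jet_above_exists:
  assumes z: "z \<in> verts N" and E: "E \<in> Inc N z"
  obtains p X where "jet_above u z E p X"
proof -
  note E' = endpoint_of_incident_edge(1)[OF N z E]
  interpret e: edge_eq "elen N E" C lam "sigma_from z E" "H_from z E" by (rule edge_eq_from[OF E'])
  have "usc_on {0..elen N E} (on_edge N E u)" using u_USC E' by (simp add: USC_def)
  then have f: "e.subsol (\<lambda>t. u (edge_from N z E t))" by (rule subsol_from[OF sub E']) simp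
  obtain P X where "0 < e.G (u (edge_from N z E 0)) P X 0"
    "\<forall>\<^sub>F t in at_right 0. u (edge_from N z E t) \<le> u (edge_from N z E 0) + P * t + X / 2 * t\<^sup>2"
    by (rule e.upper_barrier[OF f u_bdd[OF edge_from_in_body[OF E']] nondegenerate_from[OF z E vertex_cond[OF z E] c]]) blast
  then have "jet_above u z E P X" unfolding jet_above_def G_from_0[OF z E] edge_from_0[OF N z E] by blast
  then show thesis by (rule that)
qed

text \<open>The boundary condition is attained in the classical sense by subsolutions, since the barrier of
  \<open>upper_barrier\<close> excludes the alternative \<open>G \<le> 0\<close>.\<close>
lemma boundary_value_attained_above:
  assumes z: "z \<in> boundary_verts N" shows "ub z \<le> h z"
proof -
  have zv: "z \<in> verts N" using z by (simp add: boundary_verts_def)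
  have "\<forall>E\<in>Inc N z. \<exists>p X. jet_above u z E p X" using jet_above_exists[OF zv] by metis
  then obtain p X where "\<And>E. E \<in> Inc N z \<Longrightarrow> jet_above u z E (p E) (X E)" by metis
  then have "u z \<le> h z" using vertex_condition_above(2)[OF sub zv _ z] by blast
  moreover have "ub z \<le> u z" by (rule bdry_reg_le[where u = u, OF N u_USC u_bdd vert_in_body[OF zv]])
  ultimately show ?thesis by simp
qed

text \<open>
  If \<open>u\<close> had slope \<open>- \<infinity>\<close> along \<open>E\<close>, every line of negative slope would touch it from above. Combined
  with barriers on the other edges, a very negative slope on \<open>E\<close> violates both the equation, by
  coercivity of \<open>H\<close>, and the vertex condition, by coercivity of \<open>F\<close>.
\<close>
lemma interior_slope_bounded:
  assumes z: "z \<in> interior_verts N" and E: "E \<in> Inc N z"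
    and co: "edge_eq.coercive (elen N E) (H_from z E)" and s0: "sigma_from z E 0 = 0"
  obtains K where "\<exists>\<^sub>F t in at_right 0. u z - K * t < u (edge_from N z E t)"
proof -
  have zv: "z \<in> verts N" using z by (simp add: interior_verts_def)
  note E' = endpoint_of_incident_edge(1)[OF N zv E]
  interpret e: edge_eq "elen N E" C lam "sigma_from z E" "H_from z E" by (rule edge_eq_from[OF E'])
  have "\<exists>K. \<exists>\<^sub>F t in at_right 0. u z - K * t < u (edge_from N z E t)"
  proof (rule ccontr)
    assume "\<not> ?thesis"
    then have steep: "\<forall>\<^sub>F t in at_right 0. u (edge_from N z E t) \<le> u z - K * t" for K
      by (simp add: frequently_def not_less)
    have "\<forall>E\<in>Inc N z. \<exists>p X. jet_above u z E p X" using jet_above_exists[OF zv] by metis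
    then obtain p X where J: "\<And>E. E \<in> Inc N z \<Longrightarrow> jet_above u z E (p E) (X E)" by metis
    have bij: "bij_betw (inc_edge N z) {1..deg N z} (Inc N z)" using N z unfolding is_network_def by blast
    then obtain i where i: "i \<in> {1..deg N z}" "inc_edge N z i = E"
      using E by (metis (no_types, lifting) bij_betw_iff_bijections)
    define P where "P = (\<lambda>j\<in>{1..deg N z}. p (inc_edge N z j))"
    have "filterlim (\<lambda>t. F z (u z) (P(i := t))) at_top at_bot"
      by (rule F_coercive[OF z _ i(1)]) (simp add: P_def)
    then have "\<forall>\<^sub>F t in at_bot. 0 < F z (u z) (P(i := t))"
      by (simp add: filterlim_at_top_dense)
    then obtain K0 where K0: "\<And>t. t \<le> K0 \<Longrightarrow> 0 < F z (u z) (P(i := t))"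
      unfolding eventually_at_bot_linorder by blast
    obtain c' d' where c': "c' > 0" "\<And>p. c' * \<bar>p\<bar> - d' \<le> H_from z E 0 p"
      using co unfolding e.coercive_def using e.L by force
    define K where "K = max \<bar>K0\<bar> ((\<bar>d'\<bar> + lam * \<bar>u z\<bar> + 1) / c')"
    have "(\<bar>d'\<bar> + lam * \<bar>u z\<bar> + 1) / c' \<le> K" by (simp add: K_def)
    then have "\<bar>d'\<bar> + lam * \<bar>u z\<bar> + 1 \<le> c' * K" using c' by (simp add: pos_divide_le_eq mult.commute)
    moreover have "K \<ge> 0" by (simp add: K_def)
    moreover have "- (lam * \<bar>u z\<bar>) \<le> lam * u z"
      using lam by (metis abs_ge_minus_self abs_mult abs_of_pos minus_le_iff)
    ultimately have "e.G (u z) (- K) 0 0 > 0" using c'(2)[of "- K"] by (simp add: e.G_def)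
    then have JE: "jet_above u z E (- K) 0"
      using steep[of K] unfolding jet_above_def G_from_0[OF zv E] by simp
    have "F z (u z) (\<lambda>j\<in>{1..deg N z}. (p(E := - K)) (inc_edge N z j)) \<le> 0"
      by (rule vertex_condition_above(1)[OF sub zv _ z, where X = "X(E := 0)"]) (use J JE in auto)
    moreover have "(\<lambda>j\<in>{1..deg N z}. (p(E := - K)) (inc_edge N z j)) = P(i := - K)"
    proof
      fix j
      have "inc_edge N z j = E \<longleftrightarrow> j = i" if "j \<in> {1..deg N z}"
        using that i bij_betw_imp_inj_on[OF bij] by (auto dest: inj_onD)
      then show "(\<lambda>j\<in>{1..deg N z}. (p(E := - K)) (inc_edge N z j)) j = (P(i := - K)) j"
        using i(1) by (auto simp: P_def restrict_def)
    qed
    moreover have "0 < F z (u z) (P(i := - K))" by (rule K0) (simp add: K_def)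
    ultimately show False by simp
  qed
  then show thesis using that by blast
qed

lemma separating_jets_at_vertex:
  assumes z: "z \<in> verts N" and E: "E \<in> Inc N z" and pos: "v z < ub z"
    and max: "\<And>x. x \<in> body N \<Longrightarrow> ub x - v x \<le> ub z - v z"
  obtains p q X Y where "p < q" "jet_above ub z E p X" "jet_below v z E q Y"
proof -
  note E' = endpoint_of_incident_edge(1)[OF N z E]
  interpret e: edge_eq "elen N E" C lam "sigma_from z E" "H_from z E" by (rule edge_eq_from[OF E'])
  note a0 = edge_from_0[OF N z E]
  have f: "e.subsol (\<lambda>t. ub (edge_from N z E t))"
    by (rule subsol_from[OF sub E' ub_usc[OF E'] ub_on_edge[OF E']])
  have g: "e.supersol (\<lambda>t. v (edge_from N z E t))" by (rule supersol_from[OF super E'])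
  have mem: "t \<in> {0..elen N E} \<Longrightarrow> edge_from N z E t \<in> body N" for t by (rule edge_from_in_body[OF E'])
  have slope: "\<exists>K. \<exists>\<^sub>F t in at_right 0. ub (edge_from N z E 0) - K * t < ub (edge_from N z E t)"
    if s0: "sigma_from z E 0 = 0" and co: "e.coercive"
  proof (cases "z \<in> boundary_verts N")
    case True
    then have Inc: "Inc N z = {E}" using boundary_Inc E by (metis singletonD)
    have near: "\<forall>\<^sub>F t in at_right 0. t \<in> {0<..<elen N E}"
      unfolding eventually_at_right_field using e.L by (intro exI[of _ "elen N E"]) auto
    have "\<exists>\<^sub>F t in at_right 0. b < ub (edge_from N z E t)" if "b < ub (edge_from N z E 0)" for b
      using bdry_reg_limsup_from(2)[where u = u and c = b, OF N True Inc u_bdd] that near unfolding a0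
      by (auto intro: frequently_conj_eventually simp: ub_on_edge[OF E' edge_from_mem(1)[OF N E']])
    from e.limsup_slope_bounded[OF f ub_bdd[OF mem] s0 co this] show ?thesis by metis
  next
    case False
    then have zi: "z \<in> interior_verts N" using boundary_or_interior[OF N z] by blast
    have near: "\<forall>\<^sub>F t in at_right 0. t \<in> {0<..<elen N E}"
      unfolding eventually_at_right_field using e.L by (intro exI[of _ "elen N E"]) auto
    obtain K where "\<exists>\<^sub>F t in at_right 0. u z - K * t < u (edge_from N z E t)"
      by (rule interior_slope_bounded[OF zi E co s0])
    then have "\<exists>\<^sub>F t in at_right 0. ub (edge_from N z E 0) - K * t < ub (edge_from N z E t)"
      using near by (rule frequently_conj_eventually)
        (simp add: a0 bdry_reg_off_boundary[OF False] ub_on_edge[OF E' edge_from_mem(1)[OF N E']])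
    then show ?thesis by blast
  qed
  have nd: "sigma_from z E 0 \<noteq> 0 \<or> e.coercive \<and> (\<exists>K. \<exists>\<^sub>F t in at_right 0. ub (edge_from N z E 0) - K * t < ub (edge_from N z E t))"
    using nondegenerate_from[OF z E vertex_cond[OF z E] c] slope by blast
  obtain p q X Y where pq: "p < q"
    and p: "\<forall>\<^sub>F t in at_right 0. ub (edge_from N z E t) \<le> ub (edge_from N z E 0) + p * t + X / 2 * t\<^sup>2"
      "0 < e.G (ub (edge_from N z E 0)) p X 0"
    and q: "\<forall>\<^sub>F t in at_right 0. v (edge_from N z E 0) + q * t + Y / 2 * t\<^sup>2 \<le> v (edge_from N z E t)"
      "e.G (v (edge_from N z E 0)) q Y 0 < 0"
  proof (rule e.separating_jets[OF f g ub_bdd[OF mem] v_bdd[OF mem] _ _ nd])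
    show "ub (edge_from N z E x) - v (edge_from N z E x) \<le> ub (edge_from N z E 0) - v (edge_from N z E 0)"
      if "x \<in> {0..elen N E}" for x unfolding a0 by (rule max[OF mem[OF that]])
    show "v (edge_from N z E 0) < ub (edge_from N z E 0)" unfolding a0 by (rule pos)
  qed
  have "jet_above ub z E p X" "jet_below v z E q Y"
    using p q unfolding jet_above_def jet_below_def a0 G_from_0[OF z E] by blast+
  with pq show thesis by (rule that)
qed

text \<open>
  At a vertex, the slopes \<open>p < q\<close> of \<open>separating_jets_at_vertex\<close> on the incident edges form two test
  functions, one for \<open>u\<close> and one for \<open>v\<close>, for which the vertex conditions are incompatible.
\<close>
lemma no_positive_maximum:
  assumes x: "x \<in> body N" and max: "\<And>y. y \<in> body N \<Longrightarrow> ub y - v y \<le> ub x - v x"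
  shows "ub x \<le> v x"
proof (cases "x \<in> verts N")
  case False
  obtain E where E: "E \<in> edges N" "x \<in> closure E" using x by (auto simp: body_def)
  then have xE: "x \<in> E" using closure_edge_cases[OF N E] edge_structure(2,3)[OF N E(1)] False by metis
  interpret e: edge_eq "elen N E" C lam "sigma_from (tail N E) E" "H_from (tail N E) E" by (rule edge_eq_from[OF E(1)])
  define T where "T = dist (tail N E) x"
  have T: "T \<in> {0<..<elen N E}" using edge_coordinate[OF N E(1)] xE by (simp add: T_def)
  have xT: "edge_from N (tail N E) E T = x"
    using closure_edge_coordinate(2)[OF N E] by (simp add: edge_from_def coord_from_def T_def)
  have "ub (edge_from N (tail N E) E T) \<le> v (edge_from N (tail N E) E T)"
    by (rule e.no_interior_maximum[OF subsol_from[OF sub E(1) ub_usc[OF E(1)] ub_on_edge[OF E(1)]] supersol_from[OF super E(1)] T])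
      (use max edge_from_in_body[OF E(1)] xT in auto)
  then show ?thesis by (simp add: xT)
next
  case True
  show ?thesis
  proof (rule ccontr)
    assume "\<not> ?thesis"
    then have pos: "v x < ub x" by simp
    have "\<forall>E\<in>Inc N x. \<exists>p q X Y. p < q \<and> jet_above ub x E p X \<and> jet_below v x E q Y"
      using separating_jets_at_vertex[OF True _ pos max] by metis
    then obtain p q X Y where J: "\<And>E. E \<in> Inc N x \<Longrightarrow> p E < q E"
      "\<And>E. E \<in> Inc N x \<Longrightarrow> jet_above ub x E (p E) (X E)"
      "\<And>E. E \<in> Inc N x \<Longrightarrow> jet_below v x E (q E) (Y E)" by metis
    show False
    proof (cases "x \<in> boundary_verts N")
      case bd: True
      have "h x \<le> v x" using vertex_condition_below(2)[OF super True J(3) bd] .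
      then show False using boundary_value_attained_above[OF bd] pos by simp
    next
      case False
      then have xi: "x \<in> interior_verts N" using boundary_or_interior[OF N True] by blast
      have bij: "bij_betw (inc_edge N x) {1..deg N x} (Inc N x)" using N xi unfolding is_network_def by blast
      have lt: "p (inc_edge N x i) < q (inc_edge N x i)" if "i \<in> {1..deg N x}" for i
        using J(1) bij_betw_apply[OF bij that] by blast
      have "jet_above u x E (p E) (X E)" if E: "E \<in> Inc N x" for E
      proof -
        note E' = endpoint_of_incident_edge(1)[OF N True E]
        have "\<forall>\<^sub>F t in at_right 0. t \<in> {0<..<elen N E}"
          unfolding eventually_at_right_field using edge_structure(1)[OF N E'] by (intro exI[of _ "elen N E"]) auto
        then have "\<forall>\<^sub>F t in at_right 0. ub (edge_from N x E t) = u (edge_from N x E t)"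
          by eventually_elim (rule ub_on_edge[OF E' edge_from_mem(1)[OF N E']])
        with J(2)[OF E] show ?thesis unfolding jet_above_def bdry_reg_off_boundary[OF False]
          by (auto elim: eventually_elim2)
      qed
      then have "F x (u x) (\<lambda>i\<in>{1..deg N x}. p (inc_edge N x i)) \<le> 0"
        using vertex_condition_above(1)[OF sub True _ xi] by blast
      moreover have "0 \<le> F x (v x) (\<lambda>i\<in>{1..deg N x}. q (inc_edge N x i))"
        using vertex_condition_below(1)[OF super True J(3) xi] .
      moreover have "F x (v x) (\<lambda>i\<in>{1..deg N x}. q (inc_edge N x i)) < F x (u x) (\<lambda>i\<in>{1..deg N x}. p (inc_edge N x i))"
        (is "F x _ ?q < F x _ ?p")
      proof -
        have "1 \<in> {1..deg N x}" using xi by (simp add: interior_verts_def)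
        then have "\<exists>j\<in>{1..deg N x}. ?p j < ?q j" using lt[of 1] by (intro bexI[of _ 1]) simp_all
        moreover have "\<forall>i\<in>{1..deg N x}. ?p i \<le> ?q i" using less_imp_le[OF lt] by simp
        moreover have "v x \<le> u x" using pos by (simp add: bdry_reg_off_boundary[OF False])
        ultimately show ?thesis
          using F_mono[OF xi restrict_extensional restrict_extensional] by blast
      qed
      ultimately show False by simp
    qed
  qed
qed

lemma maximum_attained:
  assumes "body N \<noteq> {}"
  obtains x where "x \<in> body N" "\<And>y. y \<in> body N \<Longrightarrow> ub y - v y \<le> ub x - v x"
proof -
  have edge_max: "\<exists>x\<in>closure E. \<forall>y\<in>closure E. ub y - v y \<le> ub x - v x" if E: "E \<in> edges N" for E
  proof -
    have "lsc_on {0..elen N E} (on_edge N E v)" using super E by (simp add: viscosity_supersolution_def LSC_def)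
    then have "usc_on {0..elen N E} (\<lambda>t. on_edge N E ub t + - on_edge N E v t)"
      unfolding lsc_on_iff by (intro usc_on_add ub_usc[OF E])
    then obtain t where t: "t \<in> {0..elen N E}"
      "\<And>s. s \<in> {0..elen N E} \<Longrightarrow> on_edge N E ub s - on_edge N E v s \<le> on_edge N E ub t - on_edge N E v t"
      using usc_attains_max[OF compact_Icc, of 0 "elen N E"] edge_structure(1)[OF N E] by force
    then show ?thesis unfolding edge_structure(6)[OF N E] on_edge_def by blast
  qed
  then obtain m where m: "\<And>E. E \<in> edges N \<Longrightarrow> m E \<in> closure E"
    "\<And>E y. E \<in> edges N \<Longrightarrow> y \<in> closure E \<Longrightarrow> ub y - v y \<le> ub (m E) - v (m E)" by metis
  have fin: "finite (edges N)" "edges N \<noteq> {}" using N assms by (auto simp: is_network_def body_def)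
  define w where "w = (\<lambda>E. ub (m E) - v (m E))"
  have "Max (w ` edges N) \<in> w ` edges N" using fin by (intro Max_in) auto
  then obtain E where E: "E \<in> edges N" "w E = Max (w ` edges N)" by auto
  have top: "w E' \<le> w E" if "E' \<in> edges N" for E' unfolding E(2) using fin that by simp
  show thesis
  proof
    show "m E \<in> body N" using m(1)[OF E(1)] E(1) by (auto simp: body_def)
    fix y assume "y \<in> body N"
    then obtain E' where E': "E' \<in> edges N" "y \<in> closure E'" by (auto simp: body_def)
    then have "ub y - v y \<le> w E'" unfolding w_def by (rule m(2))
    then show "ub y - v y \<le> ub (m E) - v (m E)" using top[OF E'(1)] unfolding w_def by linarith
  qed
qed

lemma regularized_comparison:
  assumes y: "y \<in> body N" shows "ub y \<le> v y"
proof -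
  have "body N \<noteq> {}" using y by blast
  then obtain x where "x \<in> body N" "\<And>y. y \<in> body N \<Longrightarrow> ub y - v y \<le> ub x - v x"
    using maximum_attained by blast
  then show ?thesis using no_positive_maximum[of x] y by force
qed

end

theorem theorem5p5:
  fixes N :: "'a::euclidean_space network"
    and a :: "'a set \<Rightarrow> 'a \<Rightarrow> real"
    and H :: "'a set \<Rightarrow> 'a \<Rightarrow> real \<Rightarrow> real"
    and F :: "'a \<Rightarrow> real \<Rightarrow> (nat \<Rightarrow> real) \<Rightarrow> real"
    and h :: "'a \<Rightarrow> real"
    and C_H C_a lam :: real
    and u v :: "'a \<Rightarrow> real"
  assumes network: "is_network N"
    and constants: "C_H > 0" "C_a > 0"
    and H_cont: "\<And>E. E \<in> edges N \<Longrightarrow> continuous_on (closure E \<times> UNIV) (\<lambda>(x, p). H E x p)"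
    and H_x: "\<And>E x y p. E \<in> edges N \<Longrightarrow> x \<in> closure E \<Longrightarrow> y \<in> closure E \<Longrightarrow>
                \<bar>H E x p - H E y p\<bar> \<le> C_H * (1 + \<bar>p\<bar>) * dist x y"
    and H_p: "\<And>E x p q. E \<in> edges N \<Longrightarrow> x \<in> closure E \<Longrightarrow>
                \<bar>H E x p - H E x q\<bar> \<le> C_H * \<bar>p - q\<bar>"
    and a_square: "\<And>E. E \<in> edges N \<Longrightarrow>
                \<exists>\<sigma>. (\<forall>x\<in>closure E. a E x = (\<sigma> x)\<^sup>2) \<and>
                    (\<forall>x\<in>closure E. \<forall>y\<in>closure E. \<bar>\<sigma> x - \<sigma> y\<bar> \<le> C_a * dist x y)"
    and F_cont: "\<And>z. z \<in> interior_verts N \<Longrightarrow>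
                continuous_map (prod_topology euclideanreal (powertop_real {1..deg N z})) euclideanreal
                  (\<lambda>(r, p). F z r p)"
    and F_mono: "\<And>z r s p q. z \<in> interior_verts N \<Longrightarrow>
                p \<in> extensional {1..deg N z} \<Longrightarrow> q \<in> extensional {1..deg N z} \<Longrightarrow>
                r \<ge> s \<Longrightarrow> (\<forall>i\<in>{1..deg N z}. p i \<le> q i) \<Longrightarrow>
                F z r p \<ge> F z s q \<and>
                ((\<exists>j\<in>{1..deg N z}. p j < q j) \<longrightarrow> F z r p > F z s q)"
    and F_coercive: "\<And>z r p i. z \<in> interior_verts N \<Longrightarrow>
                p \<in> extensional {1..deg N z} \<Longrightarrow> i \<in> {1..deg N z} \<Longrightarrow>
                filterlim (\<lambda>t. F z r (p(i := t))) at_top at_bot"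
    and vertex_cond: "\<And>z E. z \<in> verts N \<Longrightarrow> E \<in> Inc N z \<Longrightarrow>
                (\<exists>U. openin (top_of_set (closure E)) U \<and> z \<in> U \<and>
                     (\<forall>x\<in>U. \<forall>p. H E x p \<ge> inverse C_H * \<bar>p\<bar> - C_H)) \<or> a E z > 0"
    and lam: "lam > 0"
    and sub: "viscosity_subsolution N lam a H F h u" and u_bdd: "bounded (u ` body N)"
    and super: "viscosity_supersolution N lam a H F h v" and v_bdd: "bounded (v ` body N)"
  shows "(\<forall>x \<in> body N - boundary_verts N. u x \<le> v x) \<and>
         (\<forall>x \<in> body N. bdry_reg N u x \<le> v x)"
proof -
  obtain Bu where Bu: "\<And>x. x \<in> body N \<Longrightarrow> \<bar>u x\<bar> \<le> Bu"
    using u_bdd unfolding bounded_iff by auto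
  obtain Bv where Bv: "\<And>x. x \<in> body N \<Longrightarrow> \<bar>v x\<bar> \<le> Bv"
    using v_bdd unfolding bounded_iff by auto
  define C where "C = max C_H C_a"
  have C: "C > 0" "C_H \<le> C" "C_a \<le> C" using constants by (auto simp: C_def)
  interpret network_comparison N a H F h C lam u v "inverse C_H" C_H "max Bu Bv"
  proof
    show "is_network N" "C > 0" "lam > 0" "inverse C_H > 0" using network C lam constants by auto
    show "\<bar>H E x p - H E y p\<bar> \<le> C * (1 + \<bar>p\<bar>) * dist x y"
      if "E \<in> edges N" "x \<in> closure E" "y \<in> closure E" for E x y p
    proof -
      have "C_H * (1 + \<bar>p\<bar>) * dist x y \<le> C * (1 + \<bar>p\<bar>) * dist x y"
        using C by (intro mult_right_mono) auto
      then show ?thesis using H_x[OF that, of p] by linarith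
    qed
    show "\<bar>H E x p - H E x q\<bar> \<le> C * \<bar>p - q\<bar>" if "E \<in> edges N" "x \<in> closure E" for E x p q
    proof -
      have "C_H * \<bar>p - q\<bar> \<le> C * \<bar>p - q\<bar>" using C by (intro mult_right_mono) auto
      then show ?thesis using H_p[OF that, of p q] by linarith
    qed
    show "\<exists>\<sigma>. (\<forall>x\<in>closure E. a E x = (\<sigma> x)\<^sup>2) \<and> (\<forall>x\<in>closure E. \<forall>y\<in>closure E. \<bar>\<sigma> x - \<sigma> y\<bar> \<le> C * dist x y)"
      if E: "E \<in> edges N" for E
    proof -
      obtain \<sigma> where \<sigma>: "\<forall>x\<in>closure E. a E x = (\<sigma> x)\<^sup>2"
        "\<forall>x\<in>closure E. \<forall>y\<in>closure E. \<bar>\<sigma> x - \<sigma> y\<bar> \<le> C_a * dist x y" using a_square[OF E] by blast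
      have "C_a * dist x y \<le> C * dist x y" for x y :: 'a using C by (intro mult_right_mono) auto
      then have "\<forall>x\<in>closure E. \<forall>y\<in>closure E. \<bar>\<sigma> x - \<sigma> y\<bar> \<le> C * dist x y" using \<sigma>(2) order_trans by blast
      then show ?thesis using \<sigma>(1) by blast
    qed
    show "\<bar>u x\<bar> \<le> max Bu Bv" "\<bar>v x\<bar> \<le> max Bu Bv" if "x \<in> body N" for x
      using Bu[OF that] Bv[OF that] by auto
  qed (fact F_mono F_coercive vertex_cond sub super)+
  have "u x \<le> v x" if "x \<in> body N - boundary_verts N" for x
    using regularized_comparison[of x] that by (simp add: bdry_reg_off_boundary)
  then show ?thesis using regularized_comparison by blast
qed

end
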